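(* Let $(H\to N,\Gamma^\infty,\nabla)$ be a smooth field of Hilbert spaces. Let $\{U_i\}_{i\in I}$ (an open cover of $N$), $\{\mathcal H_i\}_{i\in I}$ (Hilbert spaces) and unitary operators $T_i(\lambda):\mathcal H(\lambda)\to\mathcal H_i$, $\lambda\in U_i$, define a Hilbert bundle structure on $H\to N$ such that $\Gamma^\infty(U_i)\subseteq\Gamma^\infty(U_i,H|_{U_i})$ for each $i\in I$. Assume that for each $i\in I$ there is a dense smooth subspace $\tilde\Gamma_i^\infty\subseteq C^\infty(U_i,\mathcal H_i)$ such that $T_i\in\mathfrak A^\infty(\Gamma^\infty|_{U_i},\tilde\Gamma_i^\infty)$. The following statements are equivalent: a) The Hilbert bundle $H\to N$ admits a connection $\tilde\nabla$ such that $\tilde\nabla|_{\Gamma^\infty}=\nabla$. b) For every $i\in I$ and $X\in\operatorname{Vect}(U_i)$, $\tilde A_i(X)=-\hat\nabla_X(T_i)T_i^*:\tilde\Gamma_i^\infty\to C^\infty(U_i,\mathcal H_i)$ is a field of bounded operators such that $\tilde A_i(X)[C^\infty(U_i,\mathcal H_i)]\subseteq C^\infty(U_i,\mathcal H_i)$, and the following identities hold for all $i,j\in I$, $a\in C^\infty(U_i)$, $f,g\in C^\infty(U_i,\mathcal H_i)$ and $X,Y\in\operatorname{Vect}(U_i)$ (the first one over $U_i\cap U_j$): $$\hat X(\tau_{ij})f=\big(\tau_{ij}\tilde A_i(X)-\tilde A_j(X)\tau_{ij}\big)f,$$ $$\tilde A_i(X+Y)=\tilde A_i(X)+\tilde A_i(Y),\qquad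 \tilde A_i(aX)=a\tilde A_i(X),$$ $$\langle\tilde A_i(X)f,g\rangle=\langle f,-\tilde A_i(\overline X)g\rangle,$$ where $\tau_{ij}(\lambda)=T_j(\lambda)T_i^*(\lambda)$ for $\lambda\in U_i\cap U_j$ and $\hat X(\tau_{ij})f=X(\tau_{ij}f)-\tau_{ij}X(f)$.
   Context: $N$ is a finite-dimensional smooth manifold, $C^\infty(N)$ the smooth complex functions, $\operatorname{Vect}(N)$ the complexified smooth vector fields. A field of Hilbert spaces is a surjective map $p:H\to N$ whose fibers $\mathcal H(\lambda)=p^{-1}(\lambda)$ are complex Hilbert spaces (inner products antilinear in the second variable); $h(\varphi,\psi)(\lambda)=\langle\varphi(\lambda),\psi(\lambda)\rangle_\lambda$ for sections $\varphi,\psi$. Smooth field of Hilbert spaces $(H\to N,\Gamma^\infty,\nabla)$: $\Gamma^\infty$ is a set of sections closed under addition and multiplication by $C^\infty(N)$, and $\nabla:\operatorname{Vect}(N)\times\Gamma^\infty\to\Gamma^\infty$ satisfies (i) $\nabla_{X+Y}=\nabla_X+\nabla_Y$, $\nabla_{aX}=a\nabla_X$, $\nabla_X(a\varphi)=X(a)\varphi+a\nabla_X\varphi$; (ii) $h(\varphi,\psi)\in C^\infty(N)$, $Xh(\varphi,\psi)=h(\nabla_X\varphi,\psi)+h(\varphi,\nabla_{\overline X}\psi)$; (iii) $\{\varphi(\lambda)\mid\varphi\in\Gamma^\infty\}$ is dense in $\mathcal H(\lambda)$ for all $\lambda$. Spaces $\Gamma^n(U)$, $U\subseteq N$ open: $\nabla$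 induces a connection on restrictions $\Gamma^\infty|_U$. $\Gamma^0(U)$: sections over $U$ that are locally uniform limits of sequences in $\Gamma^\infty$. $\Gamma^1(U)$: those $\varphi\in\Gamma^0(U)$ for which there is a sequence $\varphi_j\in\Gamma^\infty$ with $\varphi_j\to\varphi$ and $\nabla_X\varphi_j$ convergent, locally uniformly on $U$, for all $X\in\operatorname{Vect}(U)$; then $\nabla_X\varphi:=\lim\nabla_X\varphi_j$. Inductively $\varphi\in\Gamma^n(U)$ if $\varphi,\nabla_X\varphi\in\Gamma^{n-1}(U)$ for all $X\in\operatorname{Vect}(U)$; $\Gamma^\infty(U)=\bigcap_n\Gamma^n(U)$. Hilbert bundle structure: $(U_i,\mathcal H_i,T_i)_{i\in I}$ defines one if $H$ has a Banach manifold structure with $p$ smooth and every map $p^{-1}(U_i)\ni x\mapsto(p(x),T_i(p(x))x)\in U_i\times\mathcal H_i$ is a diffeomorphism. $\Gamma^\infty(N,H)$ and $\Gamma^\infty(U_i,H|_{U_i})$ denote the smooth sections over $N$ and $U_i$. A connection on a Hilbert bundle is a map $\tilde\nabla:\operatorname{Vect}(N)\times\Gamma^\infty(N,H)\to\Gamma^\infty(N,H)$ satisfying (i) and (ii) on $\Gamma^\infty(N,H)$. A dense smooth subspace of $C^\infty(U_i,\mathcal H_i)$ is a linear subspace, dense in the canonical Fréchet topology, stable under multiplication by $C^\infty(U_i)$ and under derivation by every $X\in\operatorname{Vect}(U_i)$. $T_i\in\mathfrak A^\infty(\Gamma^\infty|_{U_i},\tilde\Gamma_i^\infty)$ means $T_i(\Gamma^\infty|_{U_i})\subseteq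 C^\infty(U_i,\mathcal H_i)$ and $T_i^*(\tilde\Gamma_i^\infty)\subseteq\Gamma^\infty(U_i)$, where $(T_i\varphi)(\lambda)=T_i(\lambda)\varphi(\lambda)$. Here $\hat\nabla_X(T_i)\psi=X(T_i\psi)-T_i\nabla_X\psi$ for $\psi\in\Gamma^\infty(U_i)$ (which makes sense because under the hypotheses $T_i(\Gamma^\infty(U_i))\subseteq C^\infty(U_i,\mathcal H_i)$), so $\tilde A_i(X)f=-\hat\nabla_X(T_i)(T_i^*f)$ for $f\in\tilde\Gamma_i^\infty$. A densely defined bounded operator is identified with its bounded extension; this gives the action of $\tilde A_i(X)$ on $C^\infty(U_i,\mathcal H_i)$. *)

theory Defs
  imports "HOL-Analysis.Analysis"
begin

section \<open>Complex Hilbert spaces\<close>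

text \<open>The inner product is linear in the first and antilinear in the second argument.\<close>

class complex_hilbert = banach +
  fixes scaleC :: "complex \<Rightarrow> 'a \<Rightarrow> 'a" (infixr "*\<^sub>C" 75)
    and cinner :: "'a \<Rightarrow> 'a \<Rightarrow> complex"
  assumes scaleC_add_right: "a *\<^sub>C (x + y) = a *\<^sub>C x + a *\<^sub>C y"
    and scaleC_add_left: "(a + b) *\<^sub>C x = a *\<^sub>C x + b *\<^sub>C x"
    and scaleC_scaleC: "a *\<^sub>C (b *\<^sub>C x) = (a * b) *\<^sub>C x"
    and scaleC_of_real: "complex_of_real r *\<^sub>C x = r *\<^sub>R x"
    and cinner_add_left: "cinner (x + y) z = cinner x z + cinner y z"
    and cinner_scaleC_left: "cinner (a *\<^sub>C x) y = a * cinner x y"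
    and cinner_commute: "cinner x y = cnj (cinner y x)"
    and cinner_self: "cinner x x = complex_of_real ((norm x)\<^sup>2)"

instantiation complex :: complex_hilbert
begin

definition scaleC_complex :: "complex \<Rightarrow> complex \<Rightarrow> complex" where
  "scaleC_complex a x = a * x"

definition cinner_complex :: "complex \<Rightarrow> complex \<Rightarrow> complex" where
  "cinner_complex x y = x * cnj y"

instance
proof
  fix a b :: complex and x y z :: complex and r :: real
  show "a *\<^sub>C (x + y) = a *\<^sub>C x + a *\<^sub>C y" by (simp add: scaleC_complex_def distrib_left)
  show "(a + b) *\<^sub>C x = a *\<^sub>C x + b *\<^sub>C x" by (simp add: scaleC_complex_def distrib_right)
  show "a *\<^sub>C (b *\<^sub>C x) = (a * b) *\<^sub>C x" by (simp add: scaleC_complex_def mult.assoc)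
  show "complex_of_real r *\<^sub>C x = r *\<^sub>R x" by (simp add: scaleC_complex_def scaleR_conv_of_real)
  show "cinner (x + y) z = cinner x z + cinner y z" by (simp add: cinner_complex_def distrib_right)
  show "cinner (a *\<^sub>C x) y = a * cinner x y"
    by (simp add: cinner_complex_def scaleC_complex_def mult.assoc)
  show "cinner x y = cnj (cinner y x)" by (simp add: cinner_complex_def mult.commute)
  show "cinner x x = complex_of_real ((norm x)\<^sup>2)"
    unfolding cinner_complex_def by (rule complex_norm_square[symmetric])
qed

end

definition closed_csubspace :: "'k::complex_hilbert set \<Rightarrow> bool" where
  "closed_csubspace S \<longleftrightarrow> closed S \<and> 0 \<in> S \<and> (\<forall>x\<in>S. \<forall>y\<in>S. x + y \<in> S) \<and>
     (\<forall>a. \<forall>x\<in>S. a *\<^sub>C x \<in> S)"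

definition bounded_clinear_on :: "'k::complex_hilbert set \<Rightarrow> ('k \<Rightarrow> 'k) \<Rightarrow> bool" where
  "bounded_clinear_on S L \<longleftrightarrow>
     (\<forall>x\<in>S. L x \<in> S) \<and>
     (\<forall>x\<in>S. \<forall>y\<in>S. L (x + y) = L x + L y) \<and>
     (\<forall>a. \<forall>x\<in>S. L (a *\<^sub>C x) = a *\<^sub>C L x) \<and>
     (\<exists>K. \<forall>x\<in>S. norm (L x) \<le> K * norm x)"


section \<open>Smooth maps between Banach spaces\<close>

text \<open>
  Infinite Frechet differentiability of \<open>f\<close> on a relatively open subset \<open>S\<close> of a closed real
  linear subspace \<open>F\<close>.  The value \<open>D x [v\<^sub>1, \<dots>, v\<^sub>k]\<close> is the \<open>k\<close>-th derivative of \<open>f\<close> at \<open>x\<close>,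
  a bounded \<open>k\<close>-linear map on \<open>F\<close>; the last clause says that \<open>x \<mapsto> D x\<close> on lists of length
  \<open>k\<close> is Frechet differentiable for the operator norm of \<open>k\<close>-linear maps, with derivative \<open>D x\<close>
  on lists of length \<open>Suc k\<close>.  (Lists are used because the iterated operator spaces
  \<open>F \<Rightarrow>\<^sub>L (F \<Rightarrow>\<^sub>L \<dots>)\<close> have a type depending on \<open>k\<close>.)
\<close>

definition smooth_within ::
  "'a::real_normed_vector set \<Rightarrow> 'a set \<Rightarrow> ('a \<Rightarrow> 'b::real_normed_vector) \<Rightarrow> bool" where
  "smooth_within F S f \<longleftrightarrow> (\<exists>D :: 'a \<Rightarrow> 'a list \<Rightarrow> 'b.
     (\<forall>x\<in>S. D x [] = f x) \<and>
     (\<forall>x\<in>S. \<forall>us\<in>lists F. \<forall>ws\<in>lists F. \<forall>u\<in>F. \<forall>v\<in>F. \<forall>a b :: real.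
        D x (us @ (a *\<^sub>R u + b *\<^sub>R v) # ws) = a *\<^sub>R D x (us @ u # ws) + b *\<^sub>R D x (us @ v # ws)) \<and>
     (\<forall>k. \<forall>x\<in>S. \<exists>K. \<forall>vs\<in>lists F. length vs = k \<longrightarrow> norm (D x vs) \<le> K * prod_list (map norm vs)) \<and>
     (\<forall>k. \<forall>x\<in>S. \<forall>e>0. \<exists>d>0. \<forall>y\<in>S. norm (y - x) < d \<longrightarrow>
        (\<forall>vs\<in>lists F. length vs = k \<longrightarrow>
           norm (D y vs - D x vs - D x ((y - x) # vs)) \<le> e * norm (y - x) * prod_list (map norm vs))))"


section \<open>Manifolds\<close>

text \<open>
  A chart is a bijection of \<open>cdom\<close> onto a relatively open subset of the model space \<open>cmodel\<close>,
  a closed linear subspace of \<open>'e\<close>.  Subspaces as models allow dimension 0, manifolds modelled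
  on different Banach spaces on different components, and products with the (subspace-valued)
  Hilbert spaces below.
\<close>

record ('m, 'e) chart =
  cdom :: "'m set"
  cmap :: "'m \<Rightarrow> 'e"
  cmodel :: "'e set"

definition chart_inv :: "('m, 'e) chart \<Rightarrow> 'e \<Rightarrow> 'm" where
  "chart_inv c = inv_into (cdom c) (cmap c)"

definition is_chart :: "('m, 'e::real_normed_vector) chart \<Rightarrow> bool" where
  "is_chart c \<longleftrightarrow> subspace (cmodel c) \<and> closed (cmodel c) \<and> inj_on (cmap c) (cdom c) \<and>
     openin (top_of_set (cmodel c)) (cmap c ` cdom c)"

text \<open>
  Atlas of a Banach manifold with underlying set \<open>M\<close>; as in Lang's definition, the topology of the
  manifold is the one induced by the atlas.
\<close>

definition smooth_atlas :: "'m set \<Rightarrow> ('m, 'e::real_normed_vector) chart set \<Rightarrow> bool" where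
  "smooth_atlas M A \<longleftrightarrow>
     (\<Union>c\<in>A. cdom c) = M \<and> (\<forall>c\<in>A. is_chart c) \<and>
     (\<forall>c\<in>A. \<forall>d\<in>A.
        openin (top_of_set (cmodel c)) (cmap c ` (cdom c \<inter> cdom d)) \<and>
        smooth_within (cmodel c) (cmap c ` (cdom c \<inter> cdom d)) (cmap d \<circ> chart_inv c))"

definition smooth_manifold ::
  "('m::{t2_space, second_countable_topology}, 'e::euclidean_space) chart set \<Rightarrow> bool" where
  "smooth_manifold A \<longleftrightarrow> smooth_atlas UNIV A \<and>
     (\<exists>n. \<forall>c\<in>A. dim (cmodel c) = n) \<and>
     (\<forall>c\<in>A. open (cdom c) \<and> homeomorphism (cdom c) (cmap c ` cdom c) (cmap c) (chart_inv c))"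

text \<open>
  Smoothness of \<open>f\<close> on an open subset \<open>W\<close> of a manifold; the openness clause is
  the continuity of \<open>f\<close> for the topologies induced by the atlases.
\<close>

definition mfd_smooth ::
  "('m, 'e::real_normed_vector) chart set \<Rightarrow> ('n, 'b::real_normed_vector) chart set \<Rightarrow>
   'm set \<Rightarrow> ('m \<Rightarrow> 'n) \<Rightarrow> bool" where
  "mfd_smooth A B W f \<longleftrightarrow> (\<forall>c\<in>A. \<forall>d\<in>B.
     (let S = cmap c ` (W \<inter> cdom c \<inter> f -` cdom d) in
        openin (top_of_set (cmodel c)) S \<and>
        smooth_within (cmodel c) S (cmap d \<circ> f \<circ> chart_inv c)))"

definition mfd_diffeo ::
  "('m, 'e::real_normed_vector) chart set \<Rightarrow> ('n, 'b::real_normed_vector) chart set \<Rightarrow>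
   'm set \<Rightarrow> 'n set \<Rightarrow> ('m \<Rightarrow> 'n) \<Rightarrow> bool" where
  "mfd_diffeo A B S S' f \<longleftrightarrow>
     bij_betw f S S' \<and> mfd_smooth A B S f \<and> mfd_smooth B A S' (inv_into S f)"

text \<open>The product of the open submanifold \<open>U\<close> with a closed linear subspace \<open>K\<close>.\<close>

definition prod_atlas ::
  "('m, 'e::real_normed_vector) chart set \<Rightarrow> 'm set \<Rightarrow> 'k::real_normed_vector set \<Rightarrow>
   ('m \<times> 'k, 'e \<times> 'k) chart set" where
  "prod_atlas A U K =
     (\<lambda>c. \<lparr>cdom = (cdom c \<inter> U) \<times> K, cmap = (\<lambda>(x, v). (cmap c x, v)), cmodel = cmodel c \<times> K\<rparr>) ` A"


section \<open>Smooth functions and vector fields\<close>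

text \<open>
  Convention: functions, vector fields and sections over an open set \<open>U\<close> are represented by
  total functions extended by zero outside \<open>U\<close>, so that they are determined by their
  restrictions to \<open>U\<close>.  No regularity is required at the boundary of \<open>U\<close>.
\<close>

definition Cinf ::
  "('m, 'e::real_normed_vector) chart set \<Rightarrow> 'm set \<Rightarrow> 'k::complex_hilbert set \<Rightarrow> ('m \<Rightarrow> 'k) set" where
  "Cinf A U K = {f. (\<forall>x\<in>U. f x \<in> K) \<and> (\<forall>x. x \<notin> U \<longrightarrow> f x = 0) \<and>
     (\<forall>c\<in>A. smooth_within (cmodel c) (cmap c ` (U \<inter> cdom c)) (f \<circ> chart_inv c))}"

abbreviation Cfun :: "('m, 'e::real_normed_vector) chart set \<Rightarrow> 'm set \<Rightarrow> ('m \<Rightarrow> complex) set" where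
  "Cfun A U \<equiv> Cinf A U UNIV"

text \<open>
  A tangent vector at \<open>x\<close> is a family of vectors, one in the model space of every chart around
  \<open>x\<close>, transforming with the derivatives of the coordinate changes (the equivalence
  class of its coordinate representatives).  A complexified vector field is a pair \<open>(X\<^sub>1, X\<^sub>2)\<close>
  of real ones and stands for \<open>X\<^sub>1 + \<i> X\<^sub>2\<close>.
\<close>

type_synonym ('m, 'e) rvfield = "('m, 'e) chart \<Rightarrow> 'm \<Rightarrow> 'e"
type_synonym ('m, 'e) vfield = "('m, 'e) rvfield \<times> ('m, 'e) rvfield"

definition rVect :: "('m, 'e::real_normed_vector) chart set \<Rightarrow> 'm set \<Rightarrow> ('m, 'e) rvfield set" where
  "rVect A U = {X.
     (\<forall>c x. c \<notin> A \<or> x \<notin> U \<inter> cdom c \<longrightarrow> X c x = 0) \<and>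
     (\<forall>c\<in>A. \<forall>x\<in>U \<inter> cdom c. X c x \<in> cmodel c) \<and>
     (\<forall>c\<in>A. smooth_within (cmodel c) (cmap c ` (U \<inter> cdom c)) (X c \<circ> chart_inv c)) \<and>
     (\<forall>c\<in>A. \<forall>d\<in>A. \<forall>x\<in>U \<inter> cdom c \<inter> cdom d.
        X d x = vector_derivative (\<lambda>t::real. cmap d (chart_inv c (cmap c x + t *\<^sub>R X c x))) (at 0))}"

definition Vect :: "('m, 'e::real_normed_vector) chart set \<Rightarrow> 'm set \<Rightarrow> ('m, 'e) vfield set" where
  "Vect A U = rVect A U \<times> rVect A U"

definition vadd :: "('m, 'e::real_vector) vfield \<Rightarrow> ('m, 'e) vfield \<Rightarrow> ('m, 'e) vfield" where
  "vadd X Y = ((\<lambda>c x. fst X c x + fst Y c x), (\<lambda>c x. snd X c x + snd Y c x))"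

definition vscale :: "('m \<Rightarrow> complex) \<Rightarrow> ('m, 'e::real_vector) vfield \<Rightarrow> ('m, 'e) vfield" where
  "vscale a X = ((\<lambda>c x. Re (a x) *\<^sub>R fst X c x - Im (a x) *\<^sub>R snd X c x),
                 (\<lambda>c x. Im (a x) *\<^sub>R fst X c x + Re (a x) *\<^sub>R snd X c x))"

definition vconj :: "('m, 'e::real_vector) vfield \<Rightarrow> ('m, 'e) vfield" where
  "vconj X = (fst X, (\<lambda>c x. - snd X c x))"

definition vagree :: "'m set \<Rightarrow> ('m, 'e) vfield \<Rightarrow> ('m, 'e) vfield \<Rightarrow> bool" where
  "vagree W X Y \<longleftrightarrow> (\<forall>x\<in>W. \<forall>c. fst X c x = fst Y c x \<and> snd X c x = snd Y c x)"

text \<open>Directional derivative, computed in some chart around \<open>x\<close> (the choice is immaterial for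
  smooth \<open>f\<close>).\<close>

definition rvact ::
  "('m, 'e::real_normed_vector) chart set \<Rightarrow> ('m, 'e) rvfield \<Rightarrow> ('m \<Rightarrow> 'k::real_normed_vector) \<Rightarrow> 'm \<Rightarrow> 'k" where
  "rvact A X f x = (let c = (SOME c. c \<in> A \<and> x \<in> cdom c) in
     vector_derivative (\<lambda>t::real. f (chart_inv c (cmap c x + t *\<^sub>R X c x))) (at 0))"

definition vact ::
  "('m, 'e::real_normed_vector) chart set \<Rightarrow> ('m, 'e) vfield \<Rightarrow> ('m \<Rightarrow> 'k::complex_hilbert) \<Rightarrow> 'm \<Rightarrow> 'k" where
  "vact A X f = (\<lambda>x. rvact A (fst X) f x + \<i> *\<^sub>C rvact A (snd X) f x)"

text \<open>
  The Frechet topology of \<open>C\<^sup>\<infinity>(U, K)\<close>, given by the seminorms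
  \<open>f \<mapsto> sup\<^bsub>x\<in>C\<^esub> \<parallel>(X\<^sub>1 \<dots> X\<^sub>n f)(x)\<parallel>\<close> for \<open>C \<subseteq> U\<close> compact and vector fields \<open>X\<^sub>1, \<dots>, X\<^sub>n\<close> on \<open>U\<close>.
\<close>

definition Cinf_topology ::
  "('m::topological_space, 'e::real_normed_vector) chart set \<Rightarrow> 'm set \<Rightarrow> 'k::complex_hilbert set \<Rightarrow>
   ('m \<Rightarrow> 'k) topology" where
  "Cinf_topology A U K = topology_generated_by
     {{g \<in> Cinf A U K. \<forall>x\<in>C. norm (foldr (vact A) Xs (\<lambda>y. g y - f y) x) < e} | f C Xs e.
        f \<in> Cinf A U K \<and> compact C \<and> C \<subseteq> U \<and> set Xs \<subseteq> Vect A U \<and> (e::real) > 0}"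

definition dense_smooth_subspace ::
  "('m::topological_space, 'e::real_normed_vector) chart set \<Rightarrow> 'm set \<Rightarrow> 'k::complex_hilbert set \<Rightarrow>
   ('m \<Rightarrow> 'k) set \<Rightarrow> bool" where
  "dense_smooth_subspace A U K D \<longleftrightarrow>
     D \<subseteq> Cinf A U K \<and>
     (\<lambda>x. 0) \<in> D \<and> (\<forall>f\<in>D. \<forall>g\<in>D. (\<lambda>x. f x + g x) \<in> D) \<and> (\<forall>z. \<forall>f\<in>D. (\<lambda>x. z *\<^sub>C f x) \<in> D) \<and>
     Cinf_topology A U K closure_of D = Cinf A U K \<and>
     (\<forall>a\<in>Cfun A U. \<forall>f\<in>D. (\<lambda>x. a x *\<^sub>C f x) \<in> D) \<and>
     (\<forall>X\<in>Vect A U. \<forall>f\<in>D. vact A X f \<in> D)"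


section \<open>Smooth fields of Hilbert spaces\<close>

text \<open>
  The total space is the type \<open>'h\<close>.  The fiberwise operations are only meaningful on pairs of
  points in the same fiber; \<open>fzero x\<close> is the zero of the fiber over \<open>x\<close>.
\<close>

record ('m, 'h) hfield =
  proj :: "'h \<Rightarrow> 'm"
  fadd :: "'h \<Rightarrow> 'h \<Rightarrow> 'h"
  fzero :: "'m \<Rightarrow> 'h"
  fscale :: "complex \<Rightarrow> 'h \<Rightarrow> 'h"
  finner :: "'h \<Rightarrow> 'h \<Rightarrow> complex"

definition fiber :: "('m, 'h) hfield \<Rightarrow> 'm \<Rightarrow> 'h set" where
  "fiber F x = proj F -` {x}"

definition fdist :: "('m, 'h) hfield \<Rightarrow> 'h \<Rightarrow> 'h \<Rightarrow> real" where
  "fdist F v w = (let d = fadd F v (fscale F (-1) w) in sqrt (Re (finner F d d)))"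

locale hilbert_on =
  fixes S :: "'h set" and add :: "'h \<Rightarrow> 'h \<Rightarrow> 'h" and zero :: 'h
    and scale :: "complex \<Rightarrow> 'h \<Rightarrow> 'h" and inner :: "'h \<Rightarrow> 'h \<Rightarrow> complex"
  assumes add_closed: "\<lbrakk>v \<in> S; w \<in> S\<rbrakk> \<Longrightarrow> add v w \<in> S"
    and zero_closed: "zero \<in> S"
    and scale_closed: "v \<in> S \<Longrightarrow> scale a v \<in> S"
    and add_assoc: "\<lbrakk>u \<in> S; v \<in> S; w \<in> S\<rbrakk> \<Longrightarrow> add (add u v) w = add u (add v w)"
    and add_commute: "\<lbrakk>v \<in> S; w \<in> S\<rbrakk> \<Longrightarrow> add v w = add w v"
    and add_zero: "v \<in> S \<Longrightarrow> add zero v = v"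
    and add_uminus: "v \<in> S \<Longrightarrow> add v (scale (-1) v) = zero"
    and scale_add_right: "\<lbrakk>v \<in> S; w \<in> S\<rbrakk> \<Longrightarrow> scale a (add v w) = add (scale a v) (scale a w)"
    and scale_add_left: "v \<in> S \<Longrightarrow> scale (a + b) v = add (scale a v) (scale b v)"
    and scale_scale: "v \<in> S \<Longrightarrow> scale a (scale b v) = scale (a * b) v"
    and scale_one: "v \<in> S \<Longrightarrow> scale 1 v = v"
    and inner_add_left: "\<lbrakk>u \<in> S; v \<in> S; w \<in> S\<rbrakk> \<Longrightarrow> inner (add u v) w = inner u w + inner v w"
    and inner_scale_left: "\<lbrakk>v \<in> S; w \<in> S\<rbrakk> \<Longrightarrow> inner (scale a v) w = a * inner v w"
    and inner_commute: "\<lbrakk>v \<in> S; w \<in> S\<rbrakk> \<Longrightarrow> inner v w = cnj (inner w v)"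
    and inner_pos: "\<lbrakk>v \<in> S; v \<noteq> zero\<rbrakk> \<Longrightarrow> Re (inner v v) > 0"
    and complete: "\<lbrakk>\<forall>n. s n \<in> S;
        \<forall>e>0. \<exists>N. \<forall>m\<ge>N. \<forall>n\<ge>N.
          (let d = add (s m) (scale (-1) (s n)) in sqrt (Re (inner d d))) < e\<rbrakk>
      \<Longrightarrow> \<exists>l\<in>S. (\<lambda>n. let d = add (s n) (scale (-1) l) in sqrt (Re (inner d d))) \<longlonglongrightarrow> 0"

definition field_of_hilbert_spaces :: "('m, 'h) hfield \<Rightarrow> bool" where
  "field_of_hilbert_spaces F \<longleftrightarrow> surj (proj F) \<and>
     (\<forall>x. hilbert_on (fiber F x) (fadd F) (fzero F x) (fscale F) (finner F))"

definition sections :: "('m, 'h) hfield \<Rightarrow> 'm set \<Rightarrow> ('m \<Rightarrow> 'h) set" where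
  "sections F U = {\<phi>. (\<forall>x. \<phi> x \<in> fiber F x) \<and> (\<forall>x. x \<notin> U \<longrightarrow> \<phi> x = fzero F x)}"

definition restr :: "('m, 'h) hfield \<Rightarrow> 'm set \<Rightarrow> ('m \<Rightarrow> 'h) \<Rightarrow> 'm \<Rightarrow> 'h" where
  "restr F U \<phi> = (\<lambda>x. if x \<in> U then \<phi> x else fzero F x)"

definition sadd :: "('m, 'h) hfield \<Rightarrow> ('m \<Rightarrow> 'h) \<Rightarrow> ('m \<Rightarrow> 'h) \<Rightarrow> 'm \<Rightarrow> 'h" where
  "sadd F \<phi> \<psi> = (\<lambda>x. fadd F (\<phi> x) (\<psi> x))"

definition sscale :: "('m, 'h) hfield \<Rightarrow> ('m \<Rightarrow> complex) \<Rightarrow> ('m \<Rightarrow> 'h) \<Rightarrow> 'm \<Rightarrow> 'h" where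
  "sscale F a \<phi> = (\<lambda>x. fscale F (a x) (\<phi> x))"

definition sinner :: "('m, 'h) hfield \<Rightarrow> ('m \<Rightarrow> 'h) \<Rightarrow> ('m \<Rightarrow> 'h) \<Rightarrow> 'm \<Rightarrow> complex" where
  "sinner F \<phi> \<psi> = (\<lambda>x. finner F (\<phi> x) (\<psi> x))"

text \<open>
  Axioms (i) and (ii) for a map \<open>nabla : Vect(N) \<times> \<Gamma> \<rightarrow> \<Gamma>\<close>; additivity in the section
  is not an axiom (it follows from (ii) when \<open>\<Gamma>\<close> is pointwise dense).
\<close>

definition connection_on ::
  "('m, 'e::real_normed_vector) chart set \<Rightarrow> ('m, 'h) hfield \<Rightarrow> ('m \<Rightarrow> 'h) set \<Rightarrow>
   (('m, 'e) vfield \<Rightarrow> ('m \<Rightarrow> 'h) \<Rightarrow> 'm \<Rightarrow> 'h) \<Rightarrow> bool" where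
  "connection_on A F \<Gamma> nabla \<longleftrightarrow>
     (\<forall>X\<in>Vect A UNIV. \<forall>\<phi>\<in>\<Gamma>. nabla X \<phi> \<in> \<Gamma>) \<and>
     (\<forall>X\<in>Vect A UNIV. \<forall>Y\<in>Vect A UNIV. \<forall>\<phi>\<in>\<Gamma>.
        nabla (vadd X Y) \<phi> = sadd F (nabla X \<phi>) (nabla Y \<phi>)) \<and>
     (\<forall>a\<in>Cfun A UNIV. \<forall>X\<in>Vect A UNIV. \<forall>\<phi>\<in>\<Gamma>.
        nabla (vscale a X) \<phi> = sscale F a (nabla X \<phi>)) \<and>
     (\<forall>a\<in>Cfun A UNIV. \<forall>X\<in>Vect A UNIV. \<forall>\<phi>\<in>\<Gamma>.
        nabla X (sscale F a \<phi>) = sadd F (sscale F (vact A X a) \<phi>) (sscale F a (nabla X \<phi>))) \<and>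
     (\<forall>\<phi>\<in>\<Gamma>. \<forall>\<psi>\<in>\<Gamma>. sinner F \<phi> \<psi> \<in> Cfun A UNIV) \<and>
     (\<forall>X\<in>Vect A UNIV. \<forall>\<phi>\<in>\<Gamma>. \<forall>\<psi>\<in>\<Gamma>. \<forall>x.
        vact A X (sinner F \<phi> \<psi>) x = sinner F (nabla X \<phi>) \<psi> x + sinner F \<phi> (nabla (vconj X) \<psi>) x)"

definition smooth_field ::
  "('m, 'e::real_normed_vector) chart set \<Rightarrow> ('m, 'h) hfield \<Rightarrow> ('m \<Rightarrow> 'h) set \<Rightarrow>
   (('m, 'e) vfield \<Rightarrow> ('m \<Rightarrow> 'h) \<Rightarrow> 'm \<Rightarrow> 'h) \<Rightarrow> bool" where
  "smooth_field A F \<Gamma> nabla \<longleftrightarrow>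
     field_of_hilbert_spaces F \<and>
     \<Gamma> \<subseteq> sections F UNIV \<and>
     (\<forall>\<phi>\<in>\<Gamma>. \<forall>\<psi>\<in>\<Gamma>. sadd F \<phi> \<psi> \<in> \<Gamma>) \<and>
     (\<forall>a\<in>Cfun A UNIV. \<forall>\<phi>\<in>\<Gamma>. sscale F a \<phi> \<in> \<Gamma>) \<and>
     connection_on A F \<Gamma> nabla \<and>
     (\<forall>x. \<forall>v\<in>fiber F x. \<forall>e>0. \<exists>\<phi>\<in>\<Gamma>. fdist F (\<phi> x) v < e)"

subsection \<open>The spaces \<open>\<Gamma>\<^sup>n(U)\<close>\<close>

definition loc_unif_conv ::
  "('m::topological_space, 'h) hfield \<Rightarrow> 'm set \<Rightarrow> (nat \<Rightarrow> 'm \<Rightarrow> 'h) \<Rightarrow> ('m \<Rightarrow> 'h) \<Rightarrow> bool" where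
  "loc_unif_conv F U s \<phi> \<longleftrightarrow> (\<forall>x\<in>U. \<exists>W. open W \<and> x \<in> W \<and> W \<subseteq> U \<and>
     uniform_limit W (\<lambda>j y. fdist F (s j y) (\<phi> y)) (\<lambda>y. 0) sequentially)"

text \<open>
  The connection induced by \<open>nabla\<close> on restrictions to \<open>U\<close>: at \<open>x\<close> a vector field over \<open>U\<close> is
  replaced by any global one agreeing with it near \<open>x\<close>; the choice is immaterial because
  \<open>nabla\<close> is linear over smooth functions in the vector field.
\<close>

definition nabla_restr ::
  "('m::topological_space, 'e::real_normed_vector) chart set \<Rightarrow> ('m, 'h) hfield \<Rightarrow>
   (('m, 'e) vfield \<Rightarrow> ('m \<Rightarrow> 'h) \<Rightarrow> 'm \<Rightarrow> 'h) \<Rightarrow> 'm set \<Rightarrow>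
   ('m, 'e) vfield \<Rightarrow> ('m \<Rightarrow> 'h) \<Rightarrow> 'm \<Rightarrow> 'h" where
  "nabla_restr A F nabla U X \<phi> = restr F U (\<lambda>x.
     nabla (SOME Y. Y \<in> Vect A UNIV \<and> (\<exists>W. open W \<and> x \<in> W \<and> W \<subseteq> U \<and> vagree W Y X)) \<phi> x)"

definition Gamma0 ::
  "('m::topological_space, 'h) hfield \<Rightarrow> ('m \<Rightarrow> 'h) set \<Rightarrow> 'm set \<Rightarrow> ('m \<Rightarrow> 'h) set" where
  "Gamma0 F \<Gamma> U = {\<phi> \<in> sections F U. \<exists>s. (\<forall>j. s j \<in> \<Gamma>) \<and> loc_unif_conv F U s \<phi>}"

definition C1_approx ::
  "('m::topological_space, 'e::real_normed_vector) chart set \<Rightarrow> ('m, 'h) hfield \<Rightarrow> ('m \<Rightarrow> 'h) set \<Rightarrow>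
   (('m, 'e) vfield \<Rightarrow> ('m \<Rightarrow> 'h) \<Rightarrow> 'm \<Rightarrow> 'h) \<Rightarrow> 'm set \<Rightarrow> ('m \<Rightarrow> 'h) \<Rightarrow> (nat \<Rightarrow> 'm \<Rightarrow> 'h) \<Rightarrow> bool" where
  "C1_approx A F \<Gamma> nabla U \<phi> s \<longleftrightarrow> (\<forall>j. s j \<in> \<Gamma>) \<and> loc_unif_conv F U s \<phi> \<and>
     (\<forall>X\<in>Vect A U. \<exists>\<xi>\<in>sections F U. loc_unif_conv F U (\<lambda>j. nabla_restr A F nabla U X (s j)) \<xi>)"

text \<open>The value of \<open>\<nabla>\<^sub>X \<phi>\<close> for \<open>\<phi> \<in> \<Gamma>\<^sup>1(U)\<close>; it does not depend on the approximating sequence.\<close>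

definition cov_deriv ::
  "('m::topological_space, 'e::real_normed_vector) chart set \<Rightarrow> ('m, 'h) hfield \<Rightarrow> ('m \<Rightarrow> 'h) set \<Rightarrow>
   (('m, 'e) vfield \<Rightarrow> ('m \<Rightarrow> 'h) \<Rightarrow> 'm \<Rightarrow> 'h) \<Rightarrow> 'm set \<Rightarrow> ('m, 'e) vfield \<Rightarrow> ('m \<Rightarrow> 'h) \<Rightarrow> 'm \<Rightarrow> 'h" where
  "cov_deriv A F \<Gamma> nabla U X \<phi> = (THE \<xi>. \<xi> \<in> sections F U \<and>
     (\<exists>s. C1_approx A F \<Gamma> nabla U \<phi> s \<and>
          loc_unif_conv F U (\<lambda>j. nabla_restr A F nabla U X (s j)) \<xi>))"

fun GammaN ::
  "('m::topological_space, 'e::real_normed_vector) chart set \<Rightarrow> ('m, 'h) hfield \<Rightarrow> ('m \<Rightarrow> 'h) set \<Rightarrow>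
   (('m, 'e) vfield \<Rightarrow> ('m \<Rightarrow> 'h) \<Rightarrow> 'm \<Rightarrow> 'h) \<Rightarrow> 'm set \<Rightarrow> nat \<Rightarrow> ('m \<Rightarrow> 'h) set" where
  "GammaN A F \<Gamma> nabla U 0 = Gamma0 F \<Gamma> U"
| "GammaN A F \<Gamma> nabla U (Suc 0) =
     {\<phi> \<in> Gamma0 F \<Gamma> U. \<exists>s. C1_approx A F \<Gamma> nabla U \<phi> s}"
| "GammaN A F \<Gamma> nabla U (Suc (Suc n)) =
     {\<phi> \<in> GammaN A F \<Gamma> nabla U (Suc n).
        \<forall>X\<in>Vect A U. cov_deriv A F \<Gamma> nabla U X \<phi> \<in> GammaN A F \<Gamma> nabla U (Suc n)}"

definition GammaInf ::
  "('m::topological_space, 'e::real_normed_vector) chart set \<Rightarrow> ('m, 'h) hfield \<Rightarrow> ('m \<Rightarrow> 'h) set \<Rightarrow>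
   (('m, 'e) vfield \<Rightarrow> ('m \<Rightarrow> 'h) \<Rightarrow> 'm \<Rightarrow> 'h) \<Rightarrow> 'm set \<Rightarrow> ('m \<Rightarrow> 'h) set" where
  "GammaInf A F \<Gamma> nabla U = (\<Inter>n. GammaN A F \<Gamma> nabla U n)"


section \<open>Operator fields and Hilbert bundles\<close>

definition unitary_from_fiber ::
  "('m, 'h) hfield \<Rightarrow> 'm \<Rightarrow> 'k::complex_hilbert set \<Rightarrow> ('h \<Rightarrow> 'k) \<Rightarrow> bool" where
  "unitary_from_fiber F x K T \<longleftrightarrow>
     T ` fiber F x = K \<and>
     (\<forall>v\<in>fiber F x. \<forall>w\<in>fiber F x. T (fadd F v w) = T v + T w) \<and>
     (\<forall>a. \<forall>v\<in>fiber F x. T (fscale F a v) = a *\<^sub>C T v) \<and>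
     (\<forall>v\<in>fiber F x. \<forall>w\<in>fiber F x. cinner (T v) (T w) = finner F v w)"

definition adj :: "('m, 'h) hfield \<Rightarrow> ('m \<Rightarrow> 'h \<Rightarrow> 'k::complex_hilbert) \<Rightarrow> 'm \<Rightarrow> 'k \<Rightarrow> 'h" where
  "adj F T x w = (THE v. v \<in> fiber F x \<and> (\<forall>u\<in>fiber F x. cinner (T x u) w = finner F u v))"

text \<open>The action of a family of operators \<open>T(x)\<close>, \<open>x \<in> U\<close>, on sections or functions over \<open>U\<close>.\<close>

definition op_app :: "'m set \<Rightarrow> ('m \<Rightarrow> 'h \<Rightarrow> 'k::zero) \<Rightarrow> ('m \<Rightarrow> 'h) \<Rightarrow> 'm \<Rightarrow> 'k" where
  "op_app U T \<phi> = (\<lambda>x. if x \<in> U then T x (\<phi> x) else 0)"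

definition adj_app ::
  "('m, 'h) hfield \<Rightarrow> 'm set \<Rightarrow> ('m \<Rightarrow> 'h \<Rightarrow> 'k::complex_hilbert) \<Rightarrow> ('m \<Rightarrow> 'k) \<Rightarrow> 'm \<Rightarrow> 'h" where
  "adj_app F U T f = restr F U (\<lambda>x. adj F T x (f x))"

definition smooth_op_field ::
  "('m::topological_space, 'e::real_normed_vector) chart set \<Rightarrow> ('m, 'h) hfield \<Rightarrow> ('m \<Rightarrow> 'h) set \<Rightarrow>
   (('m, 'e) vfield \<Rightarrow> ('m \<Rightarrow> 'h) \<Rightarrow> 'm \<Rightarrow> 'h) \<Rightarrow> 'm set \<Rightarrow> 'k::complex_hilbert set \<Rightarrow>
   ('m \<Rightarrow> 'k) set \<Rightarrow> ('m \<Rightarrow> 'h \<Rightarrow> 'k) \<Rightarrow> bool" where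
  "smooth_op_field A F \<Gamma> nabla U K D T \<longleftrightarrow>
     (\<forall>\<phi>\<in>\<Gamma>. op_app U T (restr F U \<phi>) \<in> Cinf A U K) \<and>
     (\<forall>f\<in>D. adj_app F U T f \<in> GammaInf A F \<Gamma> nabla U)"

definition nabla_hat ::
  "('m::topological_space, 'e::real_normed_vector) chart set \<Rightarrow> ('m, 'h) hfield \<Rightarrow> ('m \<Rightarrow> 'h) set \<Rightarrow>
   (('m, 'e) vfield \<Rightarrow> ('m \<Rightarrow> 'h) \<Rightarrow> 'm \<Rightarrow> 'h) \<Rightarrow> 'm set \<Rightarrow> ('m \<Rightarrow> 'h \<Rightarrow> 'k::complex_hilbert) \<Rightarrow>
   ('m, 'e) vfield \<Rightarrow> ('m \<Rightarrow> 'h) \<Rightarrow> 'm \<Rightarrow> 'k" where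
  "nabla_hat A F \<Gamma> nabla U T X \<psi> = (\<lambda>x.
     vact A X (op_app U T \<psi>) x - op_app U T (cov_deriv A F \<Gamma> nabla U X \<psi>) x)"

definition A_tilde ::
  "('m::topological_space, 'e::real_normed_vector) chart set \<Rightarrow> ('m, 'h) hfield \<Rightarrow> ('m \<Rightarrow> 'h) set \<Rightarrow>
   (('m, 'e) vfield \<Rightarrow> ('m \<Rightarrow> 'h) \<Rightarrow> 'm \<Rightarrow> 'h) \<Rightarrow> 'm set \<Rightarrow> ('m \<Rightarrow> 'h \<Rightarrow> 'k::complex_hilbert) \<Rightarrow>
   ('m, 'e) vfield \<Rightarrow> ('m \<Rightarrow> 'k) \<Rightarrow> 'm \<Rightarrow> 'k" where
  "A_tilde A F \<Gamma> nabla U T X f = (\<lambda>x. - nabla_hat A F \<Gamma> nabla U T X (adj_app F U T f) x)"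

text \<open>
  An operator \<open>P\<close>, defined on the functions in \<open>D\<close>, is a field of (densely defined) bounded
  operators with bounded extensions \<open>L x : K \<rightarrow> K\<close>.  If the values \<open>f x\<close>, \<open>f \<in> D\<close>, are dense in \<open>K\<close>
  for all \<open>x \<in> U\<close>, then the extensions are unique.
\<close>

definition bounded_op_field ::
  "'m set \<Rightarrow> 'k::complex_hilbert set \<Rightarrow> ('m \<Rightarrow> 'k) set \<Rightarrow> (('m \<Rightarrow> 'k) \<Rightarrow> 'm \<Rightarrow> 'k) \<Rightarrow>
   ('m \<Rightarrow> 'k \<Rightarrow> 'k) \<Rightarrow> bool" where
  "bounded_op_field U K D P L \<longleftrightarrow>
     (\<forall>x\<in>U. bounded_clinear_on K (L x) \<and> (\<forall>f\<in>D. P f x = L x (f x)))"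

text \<open>
  The Banach manifold structure on the total space is given by the atlas \<open>B\<close>; the Hilbert
  spaces of the local trivializations are closed subspaces of the Hilbert space \<open>'k\<close>, which may
  be different for each index.
\<close>

definition hilbert_bundle_structure ::
  "('m::topological_space, 'e::real_normed_vector) chart set \<Rightarrow> ('m, 'h) hfield \<Rightarrow>
   ('h, 'b::real_normed_vector) chart set \<Rightarrow>
   'i set \<Rightarrow> ('i \<Rightarrow> 'm set) \<Rightarrow> ('i \<Rightarrow> 'k::complex_hilbert set) \<Rightarrow> ('i \<Rightarrow> 'm \<Rightarrow> 'h \<Rightarrow> 'k) \<Rightarrow> bool" where
  "hilbert_bundle_structure A F B I U K T \<longleftrightarrow>
     (\<forall>i\<in>I. open (U i)) \<and> (\<Union>i\<in>I. U i) = UNIV \<and>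
     (\<forall>i\<in>I. closed_csubspace (K i)) \<and>
     (\<forall>i\<in>I. \<forall>x\<in>U i. unitary_from_fiber F x (K i) (T i x)) \<and>
     smooth_atlas UNIV B \<and>
     mfd_smooth B A UNIV (proj F) \<and>
     (\<forall>i\<in>I. mfd_diffeo B (prod_atlas A (U i) (K i)) (proj F -` U i) (U i \<times> K i)
        (\<lambda>v. (proj F v, T i (proj F v) v)))"

definition smooth_sections ::
  "('m, 'e::real_normed_vector) chart set \<Rightarrow> ('m, 'h) hfield \<Rightarrow> ('h, 'b::real_normed_vector) chart set \<Rightarrow>
   'm set \<Rightarrow> ('m \<Rightarrow> 'h) set" where
  "smooth_sections A F B U = {\<phi> \<in> sections F U. mfd_smooth A B U \<phi>}"

definition tau ::
  "('m, 'h) hfield \<Rightarrow> ('i \<Rightarrow> 'm \<Rightarrow> 'h \<Rightarrow> 'k::complex_hilbert) \<Rightarrow> 'i \<Rightarrow> 'i \<Rightarrow> 'm \<Rightarrow> 'k \<Rightarrow> 'k" where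
  "tau F T i j x v = T j x (adj F (T i) x v)"

text \<open>\<open>tau_hat\<close> is \<open>f \<mapsto> X(\<tau>\<^sub>i\<^sub>j f) - \<tau>\<^sub>i\<^sub>j X(f)\<close>, meaningful over \<open>U i \<inter> U j\<close>.\<close>

definition tau_hat ::
  "('m, 'e::real_normed_vector) chart set \<Rightarrow> ('m, 'h) hfield \<Rightarrow> ('i \<Rightarrow> 'm set) \<Rightarrow>
   ('i \<Rightarrow> 'm \<Rightarrow> 'h \<Rightarrow> 'k::complex_hilbert) \<Rightarrow> 'i \<Rightarrow> 'i \<Rightarrow> ('m, 'e) vfield \<Rightarrow> ('m \<Rightarrow> 'k) \<Rightarrow> 'm \<Rightarrow> 'k" where
  "tau_hat A F U T i j X f = (\<lambda>x.
     vact A X (op_app (U i \<inter> U j) (tau F T i j) f) x - tau F T i j x (vact A X f x))"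

end

theory Submission
  imports Defs
begin

text \<open>
  In the trivialization \<open>T\<^sub>i\<close> a connection that satisfies the Leibniz rule has the form
  \<open>T\<^sub>i \<nabla>\<^sub>X T\<^sub>i\<^sup>* = X + A\<^sub>i(X)\<close> with operators \<open>A\<^sub>i(X)(\<lambda>)\<close> acting fiberwise.  Linearity in \<open>X\<close> of the
  connection is linearity of \<open>A\<^sub>i\<close>, metric compatibility is skewness of \<open>A\<^sub>i\<close>, and the fact that two
  trivializations describe the same derivative is the identity with the derivative of \<open>\<tau>\<^sub>i\<^sub>j\<close>.  So a
  connection on the bundle is the same as a compatible family \<open>(A\<^sub>i)\<close>, and what remains is to recognize
  the \<open>A\<^sub>i\<close> of an extension of the given \<open>\<nabla>\<close> as the bounded extensions of the densely defined operators
  \<open>-\<nabla>\<^sub>X(T\<^sub>i) T\<^sub>i\<^sup>*\<close>.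

  From a connection to the operators: \<open>A\<^sub>i(X)(x) v\<close> is \<open>T\<^sub>i \<nabla>\<^sub>X \<phi>\<close> at \<open>x\<close> for a smooth section \<open>\<phi>\<close> that equals
  \<open>T\<^sub>i\<^sup>* v\<close> near \<open>x\<close> (\<open>conn_form\<close>).  Differentiating the inner product of two such sections, which is constant
  near \<open>x\<close>, gives \<open>\<langle>A\<^sub>i(X) v, w\<rangle> = -\<langle>v, A\<^sub>i(conj X) w\<rangle>\<close> (\<open>conn_form_skew\<close>).  Skewness does the work that a
  Taylor expansion would do in finite rank: testing against locally constant sections shows
  \<open>T\<^sub>i \<nabla>\<^sub>X \<phi> = X(T\<^sub>i \<phi>) + A\<^sub>i(X) T\<^sub>i \<phi>\<close> (\<open>nab_triv\<close>), and an everywhere defined operator with an everywhere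
  defined adjoint is bounded (\<open>Hellinger_Toeplitz\<close>).

  From the operators to a connection: \<open>T\<^sub>i\<^sup>* (X + A\<^sub>i(X)) T\<^sub>i\<close> does not depend on \<open>i\<close> (\<open>glued_triv\<close>) and is a
  connection (\<open>glued_connection\<close>).  It agrees with \<open>\<nabla>\<close> on \<open>\<Gamma>\<^sup>\<infinity>\<close> because both derivatives of a section have
  the same inner products with \<open>T\<^sub>i\<^sup>* f\<close>, \<open>f\<close> in the dense smooth subspace (\<open>glued_extends_nabla\<close>).

  In both directions one has to compute with \<open>\<nabla>\<^sub>X (T\<^sub>i\<^sup>* f)\<close>, which is only defined as a locally uniform limit.
  The bridge is the product rule \<open>X h(\<psi>, \<eta>) = h(\<nabla>\<^sub>X \<psi>, \<eta>) + h(\<psi>, \<nabla>\<^bsub>conj X\<^esub> \<eta>)\<close> for such limits \<open>\<psi>\<close>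
  (\<open>metric_limit\<close>).  It needs that \<open>X u\<close> is the limit of \<open>X u\<^sub>j\<close> if \<open>u\<^sub>j \<rightarrow> u\<close> and \<open>X u\<^sub>j\<close> converge uniformly,
  for a single vector field \<open>X\<close>; this follows from a maximum principle (\<open>rvact_limit\<close>).

  Everything rests on the calculus of smooth maps whose higher derivatives are multilinear maps on lists.
  All domains here are open in a finite-dimensional space, so smoothness can be proved by exhibiting a class
  of functions that is closed under partial derivatives (\<open>smooth_withinI_partials\<close>); the chain rule through
  the Banach charts of the total space (\<open>smooth_within_compose\<close>) is obtained in this way, and with it the
  description of smooth sections by their local representatives (\<open>smooth_sections_iff\<close>).
\<close>

section \<open>Smooth maps on finite-dimensional domains\<close>

definition multilinear_on :: "'a::real_normed_vector set \<Rightarrow> ('a list \<Rightarrow> 'b::real_normed_vector) \<Rightarrow> bool" where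
  "multilinear_on F M \<longleftrightarrow>
     (\<forall>us\<in>lists F. \<forall>ws\<in>lists F. \<forall>u\<in>F. \<forall>v\<in>F. \<forall>a b :: real.
        M (us @ (a *\<^sub>R u + b *\<^sub>R v) # ws) = a *\<^sub>R M (us @ u # ws) + b *\<^sub>R M (us @ v # ws))"

text \<open>The witness in the definition of smoothness: \<open>D x vs\<close> is the derivative of order \<open>length vs\<close> in the
  directions \<open>vs\<close>, the head of \<open>vs\<close> being the direction of the last differentiation.\<close>

definition jet ::
  "'a::real_normed_vector set \<Rightarrow> 'a set \<Rightarrow> ('a \<Rightarrow> 'b::real_normed_vector) \<Rightarrow> ('a \<Rightarrow> 'a list \<Rightarrow> 'b) \<Rightarrow> bool"
  where
  "jet F S f D \<longleftrightarrow>
     (\<forall>x\<in>S. D x [] = f x) \<and>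
     (\<forall>x\<in>S. multilinear_on F (D x)) \<and>
     (\<forall>k. \<forall>x\<in>S. \<exists>K. \<forall>vs\<in>lists F. length vs = k \<longrightarrow> norm (D x vs) \<le> K * prod_list (map norm vs)) \<and>
     (\<forall>k. \<forall>x\<in>S. \<forall>e>0. \<exists>d>0. \<forall>y\<in>S. norm (y - x) < d \<longrightarrow>
        (\<forall>vs\<in>lists F. length vs = k \<longrightarrow>
           norm (D y vs - D x vs - D x ((y - x) # vs)) \<le> e * norm (y - x) * prod_list (map norm vs)))"

lemma smooth_within_jet: "smooth_within F S f \<longleftrightarrow> (\<exists>D. jet F S f D)"
  unfolding smooth_within_def jet_def multilinear_on_def ..

lemma jet_0: "jet F S f D \<Longrightarrow> x \<in> S \<Longrightarrow> D x [] = f x"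
  by (simp add: jet_def)

lemma jet_multilinear: "jet F S f D \<Longrightarrow> x \<in> S \<Longrightarrow> multilinear_on F (D x)"
  by (simp add: jet_def)

lemma prod_list_norm_nonneg [simp]: "0 \<le> prod_list (map norm vs)"
  by (induction vs) auto

lemma prod_list_norm_comp_nonneg [simp]: "0 \<le> prod_list (map (norm \<circ> g) vs)"
  by (induction vs) auto

lemma jet_bound:
  assumes "jet F S f D" "x \<in> S"
  obtains K where "K \<ge> 0"
    "\<And>vs. vs \<in> lists F \<Longrightarrow> length vs = k \<Longrightarrow> norm (D x vs) \<le> K * prod_list (map norm vs)"
proof -
  obtain K where K: "\<forall>vs\<in>lists F. length vs = k \<longrightarrow> norm (D x vs) \<le> K * prod_list (map norm vs)"
  proof -
    have "\<forall>k. \<forall>x\<in>S. \<exists>K. \<forall>vs\<in>lists F. length vs = k \<longrightarrow> norm (D x vs) \<le> K * prod_list (map norm vs)"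
      using assms(1) unfolding jet_def by (elim conjE)
    from this[rule_format, OF assms(2), of k] show thesis using that by blast
  qed
  show thesis
  proof (rule that[of "\<bar>K\<bar>"])
    fix vs assume "vs \<in> lists F" "length vs = k"
    then have "norm (D x vs) \<le> K * prod_list (map norm vs)" using K by blast
    also have "\<dots> \<le> \<bar>K\<bar> * prod_list (map norm vs)" by (intro mult_right_mono) auto
    finally show "norm (D x vs) \<le> \<bar>K\<bar> * prod_list (map norm vs)" .
  qed simp
qed

lemma jet_diff:
  assumes "jet F S f D" "x \<in> S" "e > 0"
  obtains d where "d > 0"
    "\<And>y vs. y \<in> S \<Longrightarrow> norm (y - x) < d \<Longrightarrow> vs \<in> lists F \<Longrightarrow> length vs = k \<Longrightarrow>
       norm (D y vs - D x vs - D x ((y - x) # vs)) \<le> e * norm (y - x) * prod_list (map norm vs)"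
proof -
  have "\<forall>k. \<forall>x\<in>S. \<forall>e>0. \<exists>d>0. \<forall>y\<in>S. norm (y - x) < d \<longrightarrow>
        (\<forall>vs\<in>lists F. length vs = k \<longrightarrow>
           norm (D y vs - D x vs - D x ((y - x) # vs)) \<le> e * norm (y - x) * prod_list (map norm vs))"
    using assms(1) unfolding jet_def by (elim conjE)
  from this[rule_format, OF assms(2,3), of k] show thesis using that by blast
qed

lemma multilinear_on_zero:
  assumes "multilinear_on F M" "us \<in> lists F" "ws \<in> lists F" "0 \<in> F"
  shows "M (us @ 0 # ws) = 0"
  using assms(1)[unfolded multilinear_on_def, rule_format, OF assms(2,3,4,4), of 0 0] by simp

lemma multilinear_on_sum:
  assumes "multilinear_on F M" "us \<in> lists F" "ws \<in> lists F" "subspace F" "finite B" "B \<subseteq> F"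
  shows "M (us @ (\<Sum>b\<in>B. c b *\<^sub>R b) # ws) = (\<Sum>b\<in>B. c b *\<^sub>R M (us @ b # ws))"
  using assms(5,6)
proof (induction B rule: finite_induct)
  case empty
  then show ?case using multilinear_on_zero[OF assms(1-3)] subspace_0[OF assms(4)] by simp
next
  case (insert b B)
  have "(\<Sum>b\<in>B. c b *\<^sub>R b) \<in> F" using insert.prems
    by (intro subspace_sum[OF assms(4)] subspace_scale[OF assms(4)]) auto
  then have "M (us @ (c b *\<^sub>R b + 1 *\<^sub>R (\<Sum>b\<in>B. c b *\<^sub>R b)) # ws) =
      c b *\<^sub>R M (us @ b # ws) + 1 *\<^sub>R M (us @ (\<Sum>b\<in>B. c b *\<^sub>R b) # ws)"
    using assms(1-3) insert.prems unfolding multilinear_on_def by blast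
  then show ?case using insert by simp
qed

lemma multilinear_on_Cons:
  assumes "multilinear_on F M" "u \<in> F"
  shows "multilinear_on F (\<lambda>l. M (u # l))"
  unfolding multilinear_on_def
proof (intro ballI allI)
  fix us ws v w and a b :: real
  assume "us \<in> lists F" "ws \<in> lists F" "v \<in> F" "w \<in> F"
  then show "M (u # us @ (a *\<^sub>R v + b *\<^sub>R w) # ws) = a *\<^sub>R M (u # us @ v # ws) + b *\<^sub>R M (u # us @ w # ws)"
    using assms(1)[unfolded multilinear_on_def, rule_format, of "u # us" ws v w a b] assms(2) by simp
qed

lemma multilinear_on_diff_Cons:
  assumes M: "multilinear_on F M" and "subspace F" "u \<in> F" "v \<in> F" "ws \<in> lists F"
  shows "M ((u - v) # ws) = M (u # ws) - M (v # ws)"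
  using M[unfolded multilinear_on_def, rule_format, of "[]" ws u v 1 "-1"] assms by simp

subsection \<open>Orthonormal frames\<close>

text \<open>Only the expansion formula of an orthonormal basis is recorded: it turns a multilinear map on \<open>F\<close>
  into a finite sum of its values on frame vectors.\<close>

definition frame_of :: "'a::euclidean_space set \<Rightarrow> 'a set \<Rightarrow> bool" where
  "frame_of F B \<longleftrightarrow> finite B \<and> B \<subseteq> F \<and> (\<forall>h\<in>F. (\<Sum>b\<in>B. (h \<bullet> b) *\<^sub>R b) = h)"

lemma frame_exists:
  fixes F :: "'a::euclidean_space set"
  assumes "subspace F"
  obtains B where "frame_of F B"
proof -
  obtain B where B: "B \<subseteq> F" "pairwise orthogonal B" "\<And>x. x \<in> B \<Longrightarrow> norm x = 1"
      "independent B" "span B = F"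
    using orthonormal_basis_subspace[OF assms] by metis
  have fin: "finite B" using B(4) by (rule independent_imp_finite)
  have "(\<Sum>b\<in>B. (h \<bullet> b) *\<^sub>R b) = h" if "h \<in> F" for h
    using orthonormal_basis_expand[OF B(2,3) _ fin, of h] that B(5) by (simp add: inner_commute)
  then show thesis using that[of B] B(1) fin by (simp add: frame_of_def)
qed

lemma frame_linear:
  fixes f :: "'a::euclidean_space \<Rightarrow> 'b::real_normed_vector"
  shows "bounded_linear (\<lambda>h. \<Sum>b\<in>B. (h \<bullet> b) *\<^sub>R f b)"
  by (intro bounded_linear_sum bounded_linear_scaleR_const bounded_linear_inner_left)

subsection \<open>Directional derivatives\<close>

definition dirder :: "'a::real_normed_vector \<Rightarrow> ('a \<Rightarrow> 'b::real_normed_vector) \<Rightarrow> 'a \<Rightarrow> 'b" where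
  "dirder v f x = vector_derivative (\<lambda>t::real. f (x + t *\<^sub>R v)) (at 0)"

lemma eventually_line_in:
  fixes S :: "'a::real_normed_vector set"
  assumes "openin (top_of_set F) S" "subspace F" "x \<in> S" "v \<in> F"
  shows "eventually (\<lambda>t::real. x + t *\<^sub>R v \<in> S) (nhds 0)"
proof -
  obtain O' where O: "open O'" "S = F \<inter> O'" using assms(1) by (auto simp: openin_open)
  have "open ((\<lambda>t::real. x + t *\<^sub>R v) -` O')"
    by (intro open_vimage O continuous_intros)
  moreover have "0 \<in> (\<lambda>t::real. x + t *\<^sub>R v) -` O'" using assms O by auto
  ultimately have "eventually (\<lambda>t. t \<in> (\<lambda>t::real. x + t *\<^sub>R v) -` O') (nhds 0)"
    by (rule eventually_nhds_in_open)
  then show ?thesis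
  proof eventually_elim
    case (elim t)
    have "x + t *\<^sub>R v \<in> F" using assms O by (intro subspace_add subspace_scale) auto
    then show ?case using elim O by auto
  qed
qed

text \<open>Chart images are open in a subspace \<open>F\<close>, so derivatives within them are determined only along \<open>F\<close>.
  They are evaluated along curves that stay in the set.\<close>

lemma has_derivative_along_curve:
  fixes f :: "'a::real_normed_vector \<Rightarrow> 'b::real_normed_vector" and \<gamma> :: "real \<Rightarrow> 'a"
  assumes \<gamma>: "(\<gamma> has_vector_derivative v) (at 0)" and ev: "eventually (\<lambda>t. \<gamma> t \<in> S) (nhds 0)"
    and f: "(f has_derivative f') (at (\<gamma> 0) within S)"
  shows "((\<lambda>t. f (\<gamma> t)) has_vector_derivative f' v) (at 0)"
proof -
  obtain T where T: "open T" "(0::real) \<in> T" "\<And>t. t \<in> T \<Longrightarrow> \<gamma> t \<in> S"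
    using ev unfolding eventually_nhds by blast
  have "(\<gamma> has_derivative (\<lambda>t. t *\<^sub>R v)) (at 0 within T)"
    using \<gamma> unfolding has_vector_derivative_def by (rule has_derivative_at_withinI)
  moreover have "(f has_derivative f') (at (\<gamma> 0) within (\<gamma> ` T))"
    by (rule has_derivative_subset[OF f]) (use T(3) in auto)
  ultimately have "(f \<circ> \<gamma> has_derivative f' \<circ> (\<lambda>t. t *\<^sub>R v)) (at 0 within T)"
    by (rule diff_chain_within)
  then have "((\<lambda>t::real. f (\<gamma> t)) has_derivative (\<lambda>t. f' (t *\<^sub>R v))) (at 0)"
    unfolding o_def at_within_open[OF T(2,1)] .
  moreover have "f' (t *\<^sub>R v) = t *\<^sub>R f' v" for t
    using f by (simp add: has_derivative_def bounded_linear.linear linear_scale)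
  ultimately show ?thesis by (simp add: has_vector_derivative_def)
qed

lemma has_derivative_along_line:
  fixes f :: "'a::real_normed_vector \<Rightarrow> 'b::real_normed_vector"
  assumes "openin (top_of_set F) S" "subspace F" "x \<in> S" "v \<in> F"
    and f: "(f has_derivative f') (at x within S)"
  shows "((\<lambda>t::real. f (x + t *\<^sub>R v)) has_vector_derivative f' v) (at 0)"
proof (rule has_derivative_along_curve[OF _ eventually_line_in[OF assms(1-4)]])
  show "((\<lambda>t::real. x + t *\<^sub>R v) has_vector_derivative v) (at 0)"
    by (auto intro!: derivative_eq_intros)
qed (use f in simp)

text \<open>Fixing the direction of the first differentiation shows that a partial derivative is again
  smooth, with the same higher derivatives.\<close>

lemma jet_slice:
  assumes "jet F S f D" "b \<in> F"
  shows "jet F S (\<lambda>x. D x [b]) (\<lambda>x vs. D x (vs @ [b]))"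
  unfolding jet_def multilinear_on_def
proof (intro conjI ballI allI impI)
  fix x us ws u v and a c :: real
  assume "x \<in> S" "us \<in> lists F" "ws \<in> lists F" "u \<in> F" "v \<in> F"
  then show "D x ((us @ (a *\<^sub>R u + c *\<^sub>R v) # ws) @ [b]) =
       a *\<^sub>R D x ((us @ u # ws) @ [b]) + c *\<^sub>R D x ((us @ v # ws) @ [b])"
    using jet_multilinear[OF assms(1), of x, unfolded multilinear_on_def, rule_format, of us "ws @ [b]" u v a c]
      assms(2) by simp
next
  fix k x assume x: "x \<in> S"
  obtain K where K: "K \<ge> 0"
    "\<And>vs. vs \<in> lists F \<Longrightarrow> length vs = Suc k \<Longrightarrow> norm (D x vs) \<le> K * prod_list (map norm vs)"
    using jet_bound[OF assms(1) x] by blast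
  have "norm (D x (vs @ [b])) \<le> (K * norm b) * prod_list (map norm vs)"
    if "vs \<in> lists F" "length vs = k" for vs
    using K(2)[of "vs @ [b]"] that assms(2) by (simp add: mult_ac)
  then show "\<exists>K. \<forall>vs\<in>lists F. length vs = k \<longrightarrow> norm (D x (vs @ [b])) \<le> K * prod_list (map norm vs)"
    by blast
next
  fix k x and e :: real assume x: "x \<in> S" and e: "0 < e"
  have "e / (norm b + 1) > 0" using e by (simp add: add_nonneg_pos)
  then obtain d where d: "d > 0"
    "\<And>y vs. y \<in> S \<Longrightarrow> norm (y - x) < d \<Longrightarrow> vs \<in> lists F \<Longrightarrow> length vs = Suc k \<Longrightarrow>
       norm (D y vs - D x vs - D x ((y - x) # vs)) \<le> e / (norm b + 1) * norm (y - x) * prod_list (map norm vs)"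
    using jet_diff[OF assms(1) x] by blast
  have "norm (D y (vs @ [b]) - D x (vs @ [b]) - D x (((y - x) # vs) @ [b]))
        \<le> e * norm (y - x) * prod_list (map norm vs)"
    if "y \<in> S" "norm (y - x) < d" "vs \<in> lists F" "length vs = k" for y vs
  proof -
    have "norm (D y (vs @ [b]) - D x (vs @ [b]) - D x ((y - x) # vs @ [b]))
      \<le> e / (norm b + 1) * norm (y - x) * (prod_list (map norm vs) * norm b)"
      using d(2)[of y "vs @ [b]"] that assms(2) by simp
    also have "\<dots> = (norm b / (norm b + 1)) * (e * norm (y - x) * prod_list (map norm vs))"
      by (simp add: field_simps)
    also have "\<dots> \<le> 1 * (e * norm (y - x) * prod_list (map norm vs))"
      using e by (intro mult_right_mono) (auto simp: divide_le_eq add_nonneg_pos)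
    finally show ?thesis by simp
  qed
  then show "\<exists>d>0. \<forall>y\<in>S. norm (y - x) < d \<longrightarrow>
           (\<forall>vs\<in>lists F. length vs = k \<longrightarrow>
             norm (D y (vs @ [b]) - D x (vs @ [b]) - D x (((y - x) # vs) @ [b]))
             \<le> e * norm (y - x) * prod_list (map norm vs))"
    using d(1) by blast
qed simp

lemma jet_has_derivative:
  assumes D: "jet F S f D" and F: "subspace F" "S \<subseteq> F" "frame_of F B" and x: "x \<in> S"
  shows "(f has_derivative (\<lambda>h. \<Sum>b\<in>B. (h \<bullet> b) *\<^sub>R D x [b])) (at x within S)"
  unfolding has_derivative_within_alt
proof (intro conjI allI impI frame_linear)
  fix e :: real assume "e > 0"
  then obtain d where d: "d > 0"
    "\<And>y vs. y \<in> S \<Longrightarrow> norm (y - x) < d \<Longrightarrow> vs \<in> lists F \<Longrightarrow> length vs = 0 \<Longrightarrow>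
       norm (D y vs - D x vs - D x ((y - x) # vs)) \<le> e * norm (y - x) * prod_list (map norm vs)"
    using jet_diff[OF D x] by blast
  have "norm (f y - f x - (\<Sum>b\<in>B. ((y - x) \<bullet> b) *\<^sub>R D x [b])) \<le> e * norm (y - x)"
    if y: "y \<in> S" "norm (y - x) < d" for y
  proof -
    have "y - x \<in> F" using F x y by (auto intro: subspace_diff)
    then have *: "(\<Sum>b\<in>B. ((y - x) \<bullet> b) *\<^sub>R b) = y - x" using F(3) by (simp add: frame_of_def)
    have "D x [y - x] = (\<Sum>b\<in>B. ((y - x) \<bullet> b) *\<^sub>R D x [b])"
      using multilinear_on_sum[OF jet_multilinear[OF D x], of "[]" "[]" B "\<lambda>b. (y - x) \<bullet> b"] F
      by (simp add: frame_of_def *)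
    then show ?thesis using d(2)[of y "[]"] y x by (simp add: jet_0[OF D])
  qed
  then show "\<exists>d>0. \<forall>y\<in>S. norm (y - x) < d \<longrightarrow>
       norm (f y - f x - (\<Sum>b\<in>B. ((y - x) \<bullet> b) *\<^sub>R D x [b])) \<le> e * norm (y - x)"
    using d(1) by blast
qed

lemma smooth_within_cong:
  assumes "\<And>x. x \<in> S \<Longrightarrow> f x = g x"
  shows "smooth_within F S f \<longleftrightarrow> smooth_within F S g"
  unfolding smooth_within_def using assms by simp

lemma jet_subset:
  assumes D: "jet F S f D" and sub: "S' \<subseteq> S"
  shows "jet F S' f D"
  unfolding jet_def
proof (intro conjI ballI allI impI)
  show "D x [] = f x" if "x \<in> S'" for x using jet_0[OF D] sub that by blast
  show "multilinear_on F (D x)" if "x \<in> S'" for x using jet_multilinear[OF D] sub that by blast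
next
  fix k x assume "x \<in> S'"
  then show "\<exists>K. \<forall>vs\<in>lists F. length vs = k \<longrightarrow> norm (D x vs) \<le> K * prod_list (map norm vs)"
    using jet_bound[OF D, of x k] sub by (metis subsetD)
next
  fix k x and e :: real assume x: "x \<in> S'" and e: "e > 0"
  obtain d where "d > 0"
    "\<And>y vs. y \<in> S \<Longrightarrow> norm (y - x) < d \<Longrightarrow> vs \<in> lists F \<Longrightarrow> length vs = k \<Longrightarrow>
       norm (D y vs - D x vs - D x ((y - x) # vs)) \<le> e * norm (y - x) * prod_list (map norm vs)"
    using jet_diff[OF D _ e, of x] x sub by blast
  then show "\<exists>d>0. \<forall>y\<in>S'. norm (y - x) < d \<longrightarrow> (\<forall>vs\<in>lists F. length vs = k \<longrightarrow>
       norm (D y vs - D x vs - D x ((y - x) # vs)) \<le> e * norm (y - x) * prod_list (map norm vs))"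
    using sub by (intro exI[of _ d]) auto
qed

lemma smooth_within_subset: "smooth_within F S f \<Longrightarrow> S' \<subseteq> S \<Longrightarrow> smooth_within F S' f"
  unfolding smooth_within_jet using jet_subset by blast

text \<open>A directional derivative is a limit of difference quotients, so it lies in every closed subspace
  that contains the values near the point.\<close>

lemma dirder_in_closed_subspace:
  fixes f :: "'a::real_normed_vector \<Rightarrow> 'b::real_normed_vector"
  assumes "((\<lambda>t::real. f (x + t *\<^sub>R v)) has_vector_derivative l) (at 0)"
    and ev: "eventually (\<lambda>t::real. f (x + t *\<^sub>R v) \<in> K) (nhds 0)" and K: "closed K" "subspace K"
  shows "l \<in> K"
proof (rule Lim_in_closed_set[OF K(1)])
  have fx: "f x \<in> K" using eventually_nhds_x_imp_x[OF ev] by simp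
  have "((\<lambda>t. (1 / t) *\<^sub>R (f (x + t *\<^sub>R v) - f x)) \<longlongrightarrow> l) (at 0)"
    using assms(1) unfolding has_vector_derivative_def has_derivative_at
  proof (elim conjE)
    assume "((\<lambda>h. norm (f (x + (0 + h) *\<^sub>R v) - f (x + 0 *\<^sub>R v) - h *\<^sub>R l) / norm h) \<longlongrightarrow> 0) (at 0)"
    then have "((\<lambda>h. norm ((1 / h) *\<^sub>R (f (x + h *\<^sub>R v) - f x) - l)) \<longlongrightarrow> 0) (at 0)"
    proof (rule Lim_transform_eventually)
      show "\<forall>\<^sub>F h in at 0. norm (f (x + (0 + h) *\<^sub>R v) - f (x + 0 *\<^sub>R v) - h *\<^sub>R l) / norm h =
              norm ((1 / h) *\<^sub>R (f (x + h *\<^sub>R v) - f x) - l)"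
      proof (rule eventually_at_filter[THEN iffD2], rule always_eventually, intro allI impI)
        fix h :: real assume h: "h \<noteq> 0"
        have "(1 / h) *\<^sub>R (f (x + h *\<^sub>R v) - f x) - l = (1 / h) *\<^sub>R (f (x + h *\<^sub>R v) - f x - h *\<^sub>R l)"
          using h by (simp add: scaleR_diff_right)
        then show "norm (f (x + (0 + h) *\<^sub>R v) - f (x + 0 *\<^sub>R v) - h *\<^sub>R l) / norm h =
              norm ((1 / h) *\<^sub>R (f (x + h *\<^sub>R v) - f x) - l)"
          by simp
      qed
    qed
    then show ?thesis using Lim_null tendsto_norm_zero_iff by blast
  qed
  then show "((\<lambda>t. (1 / t) *\<^sub>R (f (x + t *\<^sub>R v) - f x)) \<longlongrightarrow> l) (at 0)" .
  show "\<forall>\<^sub>F t in at 0. (1 / t) *\<^sub>R (f (x + t *\<^sub>R v) - f x) \<in> K"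
    using ev fx K(2) unfolding eventually_at_filter
    by (auto elim!: eventually_mono intro!: subspace_scale subspace_diff)
qed simp

text \<open>Smoothness expressed through first derivatives; \<open>smooth_withinI_partials\<close> is the converse.\<close>

lemma smooth_within_dirder:
  assumes f: "smooth_within F S f" and F: "subspace F" "openin (top_of_set F) S"
  shows "\<And>b. b \<in> F \<Longrightarrow> smooth_within F S (dirder b f)"
    and "\<And>B x. frame_of F B \<Longrightarrow> x \<in> S \<Longrightarrow>
      (f has_derivative (\<lambda>h. \<Sum>b\<in>B. (h \<bullet> b) *\<^sub>R dirder b f x)) (at x within S)"
    and "\<And>b x. b \<in> F \<Longrightarrow> x \<in> S \<Longrightarrow>
      ((\<lambda>t::real. f (x + t *\<^sub>R b)) has_vector_derivative dirder b f x) (at 0)"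
proof -
  obtain D where D: "jet F S f D" using f by (auto simp: smooth_within_jet)
  have SF: "S \<subseteq> F" using F(2) openin_imp_subset by blast
  have *: "((\<lambda>t::real. f (x + t *\<^sub>R b)) has_vector_derivative D x [b]) (at 0)"
    if "b \<in> F" "x \<in> S" for b x
  proof -
    obtain B where B: "frame_of F B" using frame_exists F by blast
    have "D x [b] = (\<Sum>b'\<in>B. (b \<bullet> b') *\<^sub>R D x [b'])"
      using multilinear_on_sum[OF jet_multilinear[OF D that(2)], of "[]" "[]" B "\<lambda>b'. b \<bullet> b'"] F B that
      by (simp add: frame_of_def)
    then show ?thesis
      using has_derivative_along_line[OF F(2,1) that(2,1) jet_has_derivative[OF D F(1) SF B that(2)]]
      by simp
  qed
  then have eq: "dirder b f x = D x [b]" if "b \<in> F" "x \<in> S" for b x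
    unfolding dirder_def using that by (intro vector_derivative_at) blast
  show "smooth_within F S (dirder b f)" if "b \<in> F" for b
    using jet_slice[OF D that] smooth_within_cong[of S "dirder b f" "\<lambda>x. D x [b]" F] eq[OF that]
    by (auto simp: smooth_within_jet)
  show "((\<lambda>t::real. f (x + t *\<^sub>R b)) has_vector_derivative dirder b f x) (at 0)"
    if "b \<in> F" "x \<in> S" for b x using * eq that by simp
  show "(f has_derivative (\<lambda>h. \<Sum>b\<in>B. (h \<bullet> b) *\<^sub>R dirder b f x)) (at x within S)"
    if "frame_of F B" "x \<in> S" for B x
  proof -
    have "(\<Sum>b\<in>B. (h \<bullet> b) *\<^sub>R dirder b f x) = (\<Sum>b\<in>B. (h \<bullet> b) *\<^sub>R D x [b])" for h
      using that eq by (intro sum.cong) (auto simp: frame_of_def)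
    then show ?thesis using jet_has_derivative[OF D F(1) SF that] by simp
  qed
qed

lemma smooth_within_continuous:
  assumes "smooth_within F S f" "subspace F" "openin (top_of_set F) S"
  shows "continuous_on S (f :: 'a::euclidean_space \<Rightarrow> 'b::real_normed_vector)"
proof -
  obtain B where "frame_of F B" using frame_exists assms by blast
  then show ?thesis unfolding continuous_on_eq_continuous_within
    using has_derivative_continuous smooth_within_dirder(2)[OF assms] by blast
qed

subsection \<open>A criterion for smoothness\<close>

text \<open>The higher derivatives of \<open>u\<close>, when \<open>d u b\<close> is a choice of its partial derivative along \<open>b\<close>.  The
  list starts with the direction of the first differentiation, which is the reverse of the order in a jet.\<close>

fun iter_partial :: "'a::euclidean_space set \<Rightarrow> (('a \<Rightarrow> 'b::real_normed_vector) \<Rightarrow> 'a \<Rightarrow> 'a \<Rightarrow> 'b) \<Rightarrow>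
   ('a \<Rightarrow> 'b) \<Rightarrow> 'a list \<Rightarrow> 'a \<Rightarrow> 'b" where
  "iter_partial B d u [] x = u x"
| "iter_partial B d u (v # vs) x = (\<Sum>b\<in>B. (v \<bullet> b) *\<^sub>R iter_partial B d (d u b) vs x)"

lemma iter_partial_linear:
  "iter_partial B d u (us @ (a *\<^sub>R v + c *\<^sub>R w) # ws) x =
   a *\<^sub>R iter_partial B d u (us @ v # ws) x + c *\<^sub>R iter_partial B d u (us @ w # ws) x"
proof (induction us arbitrary: u)
  case Nil
  then show ?case
    by (simp add: inner_add_left scaleR_add_left sum.distrib scaleR_right.sum)
next
  case (Cons z us)
  then show ?case
    by (simp add: scaleR_add_right sum.distrib scaleR_right.sum mult.commute)
qed

lemma iter_partial_bound:
  assumes "finite B"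
  shows "\<exists>K. \<forall>vs. length vs = k \<longrightarrow> norm (iter_partial B d u vs x) \<le> K * prod_list (map norm vs)"
proof (induction k arbitrary: u)
  case 0
  then show ?case by (auto intro: exI[of _ "norm (u x)"])
next
  case (Suc k)
  have "\<exists>K. \<forall>b vs. length vs = k \<longrightarrow> norm (iter_partial B d (d u b) vs x) \<le> K b * prod_list (map norm vs)"
    by (rule choice) (use Suc.IH in blast)
  then obtain K where K: "\<And>b vs. length vs = k \<Longrightarrow> norm (iter_partial B d (d u b) vs x) \<le> K b * prod_list (map norm vs)"
    by blast
  have "norm (iter_partial B d u (v # vs) x) \<le> (\<Sum>b\<in>B. norm b * K b) * prod_list (map norm (v # vs))"
    if "length vs = k" for v vs
  proof -
    have "norm (iter_partial B d u (v # vs) x) \<le> (\<Sum>b\<in>B. norm ((v \<bullet> b) *\<^sub>R iter_partial B d (d u b) vs x))"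
      unfolding iter_partial.simps by (rule norm_sum)
    also have "\<dots> \<le> (\<Sum>b\<in>B. (norm v * norm b) * (K b * prod_list (map norm vs)))"
      unfolding norm_scaleR
      by (intro sum_mono mult_mono K that) (auto simp: Cauchy_Schwarz_ineq2)
    also have "\<dots> = (\<Sum>b\<in>B. norm b * K b) * prod_list (map norm (v # vs))"
      by (simp add: sum_distrib_left sum_distrib_right mult_ac)
    finally show ?thesis .
  qed
  then show ?case by (intro exI[of _ "\<Sum>b\<in>B. norm b * K b"]) (auto simp: length_Suc_conv)
qed

lemma iter_partial_diff:
  assumes fin: "finite B" and x: "x \<in> S"
    and C: "\<And>u b. u \<in> C \<Longrightarrow> b \<in> B \<Longrightarrow> d u b \<in> C"
    and der: "\<And>u. u \<in> C \<Longrightarrow> (u has_derivative (\<lambda>h. \<Sum>b\<in>B. (h \<bullet> b) *\<^sub>R d u b x)) (at x within S)"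
    and u: "u \<in> C" and e: "e > 0"
  shows "eventually (\<lambda>y. \<forall>vs. length vs = k \<longrightarrow>
     norm (iter_partial B d u vs y - iter_partial B d u vs x - iter_partial B d u (vs @ [y - x]) x)
       \<le> e * norm (y - x) * prod_list (map norm vs)) (at x within S)"
  using u e
proof (induction k arbitrary: u e)
  case 0
  then show ?case using der[OF 0(1)] unfolding has_derivative_within_alt2 by auto
next
  case (Suc k)
  define e' where "e' = e / (1 + (\<Sum>b\<in>B. norm b))"
  have pos: "0 < 1 + (\<Sum>b\<in>B. norm b)" by (simp add: add_pos_nonneg sum_nonneg)
  have e': "e' > 0" using Suc.prems(2) pos by (simp add: e'_def)
  have "eventually (\<lambda>y. \<forall>b\<in>B. \<forall>vs. length vs = k \<longrightarrow>
     norm (iter_partial B d (d u b) vs y - iter_partial B d (d u b) vs x - iter_partial B d (d u b) (vs @ [y - x]) x)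
       \<le> e' * norm (y - x) * prod_list (map norm vs)) (at x within S)"
    using Suc C e' by (intro eventually_ball_finite fin) auto
  then show ?case
  proof eventually_elim
    case (elim y)
    have "norm (iter_partial B d u (v # vs) y - iter_partial B d u (v # vs) x - iter_partial B d u ((v # vs) @ [y - x]) x)
       \<le> e * norm (y - x) * prod_list (map norm (v # vs))" if "length vs = k" for v vs
    proof -
      let ?t = "\<lambda>b. iter_partial B d (d u b) vs y - iter_partial B d (d u b) vs x - iter_partial B d (d u b) (vs @ [y - x]) x"
      have "norm (iter_partial B d u (v # vs) y - iter_partial B d u (v # vs) x - iter_partial B d u ((v # vs) @ [y - x]) x)
         = norm (\<Sum>b\<in>B. (v \<bullet> b) *\<^sub>R ?t b)"
        by (simp add: sum_subtractf[symmetric] scaleR_diff_right)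
      also have "\<dots> \<le> (\<Sum>b\<in>B. norm ((v \<bullet> b) *\<^sub>R ?t b))" by (rule norm_sum)
      also have "\<dots> \<le> (\<Sum>b\<in>B. (norm v * norm b) * (e' * norm (y - x) * prod_list (map norm vs)))"
        unfolding norm_scaleR using elim that
        by (intro sum_mono mult_mono) (auto simp: Cauchy_Schwarz_ineq2)
      also have "\<dots> = (\<Sum>b\<in>B. norm b) * e' * (norm (y - x) * prod_list (map norm (v # vs)))"
        by (simp add: sum_distrib_left sum_distrib_right mult_ac)
      also have "\<dots> \<le> e * (norm (y - x) * prod_list (map norm (v # vs)))"
      proof (rule mult_right_mono)
        have "(\<Sum>b\<in>B. norm b) * e' \<le> (1 + (\<Sum>b\<in>B. norm b)) * e'" using e' by (intro mult_right_mono) auto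
        also have "\<dots> = e" using pos by (simp add: e'_def)
        finally show "(\<Sum>b\<in>B. norm b) * e' \<le> e" .
      qed (auto intro: mult_nonneg_nonneg)
      finally show ?thesis by (simp add: mult_ac)
    qed
    then show ?case by (auto simp: length_Suc_conv)
  qed
qed

text \<open>A class of differentiable functions that contains the partial derivatives of its members
  consists of smooth functions: iterating the choice of partial derivatives gives the jets, and all
  estimates reduce to first-order ones because there are finitely many frame directions.\<close>

lemma smooth_withinI_partials:
  fixes C :: "('a::euclidean_space \<Rightarrow> 'b::real_normed_vector) set"
  assumes B: "frame_of F B"
    and closed: "\<And>u. u \<in> C \<Longrightarrow> \<exists>d. (\<forall>b\<in>B. d b \<in> C) \<and>
      (\<forall>x\<in>S. (u has_derivative (\<lambda>h. \<Sum>b\<in>B. (h \<bullet> b) *\<^sub>R d b x)) (at x within S))"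
    and u: "u \<in> C"
  shows "smooth_within F S u"
proof -
  have fin: "finite B" using B by (simp add: frame_of_def)
  obtain d where d: "\<And>u b. u \<in> C \<Longrightarrow> b \<in> B \<Longrightarrow> d u b \<in> C"
      "\<And>u x. u \<in> C \<Longrightarrow> x \<in> S \<Longrightarrow> (u has_derivative (\<lambda>h. \<Sum>b\<in>B. (h \<bullet> b) *\<^sub>R d u b x)) (at x within S)"
  proof -
    have "\<exists>d. \<forall>u\<in>C. (\<forall>b\<in>B. d u b \<in> C) \<and>
      (\<forall>x\<in>S. (u has_derivative (\<lambda>h. \<Sum>b\<in>B. (h \<bullet> b) *\<^sub>R d u b x)) (at x within S))"
      by (rule bchoice, rule ballI, rule closed)
    then show thesis using that by blast
  qed
  have "jet F S u (\<lambda>x vs. iter_partial B d u (rev vs) x)"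
    unfolding jet_def multilinear_on_def
  proof (intro conjI ballI allI impI)
    fix k x
    obtain K where K: "\<And>vs. length vs = k \<Longrightarrow> norm (iter_partial B d u vs x) \<le> K * prod_list (map norm vs)"
      using iter_partial_bound[OF fin] by blast
    have "norm (iter_partial B d u (rev vs) x) \<le> K * prod_list (map norm vs)" if "length vs = k" for vs
      using K[of "rev vs"] that by (simp add: rev_map[symmetric] prod_list.rev)
    then show "\<exists>K. \<forall>vs\<in>lists F. length vs = k \<longrightarrow> norm (iter_partial B d u (rev vs) x) \<le> K * prod_list (map norm vs)"
      by blast
  next
    fix k x and e :: real assume x: "x \<in> S" and e: "e > 0"
    obtain \<delta> where \<delta>: "\<delta> > 0"
      "\<And>y vs. y \<in> S \<Longrightarrow> y \<noteq> x \<Longrightarrow> dist y x < \<delta> \<Longrightarrow> length vs = k \<Longrightarrow>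
        norm (iter_partial B d u vs y - iter_partial B d u vs x - iter_partial B d u (vs @ [y - x]) x)
       \<le> e * norm (y - x) * prod_list (map norm vs)"
      using iter_partial_diff[OF fin x d(1,2) u e, of k] x unfolding eventually_at by blast
    have "norm (iter_partial B d u (rev vs) y - iter_partial B d u (rev vs) x - iter_partial B d u (rev ((y - x) # vs)) x)
        \<le> e * norm (y - x) * prod_list (map norm vs)" if y: "y \<in> S" "norm (y - x) < \<delta>" "length vs = k" for y vs
    proof (cases "y = x")
      case True
      have "iter_partial B d u (rev vs @ [0]) x = 0"
        using iter_partial_linear[of B d u "rev vs" 0 0 0 0 "[]" x] by simp
      then show ?thesis using True by simp
    next
      case False
      then show ?thesis using \<delta>(2)[of y "rev vs"] y by (simp add: rev_map[symmetric] prod_list.rev dist_norm)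
    qed
    then show "\<exists>d'>0. \<forall>y\<in>S. norm (y - x) < d' \<longrightarrow>
           (\<forall>vs\<in>lists F. length vs = k \<longrightarrow>
             norm (iter_partial B d u (rev vs) y - iter_partial B d u (rev vs) x - iter_partial B d u (rev ((y - x) # vs)) x)
             \<le> e * norm (y - x) * prod_list (map norm vs))"
      using \<delta>(1) by blast
  qed (auto simp: iter_partial_linear)
  then show ?thesis by (auto simp: smooth_within_jet)
qed

inductive_set lin_hull :: "('a \<Rightarrow> 'b::real_vector) set \<Rightarrow> ('a \<Rightarrow> 'b) set" for G where
  zero: "(\<lambda>x. 0) \<in> lin_hull G"
| base: "u \<in> G \<Longrightarrow> u \<in> lin_hull G"
| add: "u \<in> lin_hull G \<Longrightarrow> v \<in> lin_hull G \<Longrightarrow> (\<lambda>x. u x + v x) \<in> lin_hull G"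
| scale: "u \<in> lin_hull G \<Longrightarrow> (\<lambda>x. c *\<^sub>R u x) \<in> lin_hull G"

text \<open>The form of the criterion that is used most: the partial derivatives of the generators are linear
  combinations of generators, as in the product rule or the chain rule.\<close>

lemma smooth_withinI_hull:
  fixes G :: "('a::euclidean_space \<Rightarrow> 'b::real_normed_vector) set"
  assumes B: "frame_of F B"
    and closed: "\<And>u. u \<in> G \<Longrightarrow> \<exists>d. (\<forall>b\<in>B. d b \<in> lin_hull G) \<and>
      (\<forall>x\<in>S. (u has_derivative (\<lambda>h. \<Sum>b\<in>B. (h \<bullet> b) *\<^sub>R d b x)) (at x within S))"
    and u: "u \<in> lin_hull G"
  shows "smooth_within F S u"
proof (rule smooth_withinI_partials[OF B _ u])
  fix u assume "u \<in> lin_hull G"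
  then show "\<exists>d. (\<forall>b\<in>B. d b \<in> lin_hull G) \<and>
      (\<forall>x\<in>S. (u has_derivative (\<lambda>h. \<Sum>b\<in>B. (h \<bullet> b) *\<^sub>R d b x)) (at x within S))"
  proof induction
    case zero
    then show ?case by (intro exI[of _ "\<lambda>_ _. 0"]) (auto intro: lin_hull.zero)
  next
    case (base u)
    then show ?case by (rule closed)
  next
    case (add u v)
    then obtain d d' where dd: "\<forall>b\<in>B. d b \<in> lin_hull G" "\<forall>b\<in>B. d' b \<in> lin_hull G"
      "\<And>x. x \<in> S \<Longrightarrow> (u has_derivative (\<lambda>h. \<Sum>b\<in>B. (h \<bullet> b) *\<^sub>R d b x)) (at x within S)"
      "\<And>x. x \<in> S \<Longrightarrow> (v has_derivative (\<lambda>h. \<Sum>b\<in>B. (h \<bullet> b) *\<^sub>R d' b x)) (at x within S)" by auto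
    show ?case
      using dd by (intro exI[of _ "\<lambda>b x. d b x + d' b x"])
        (auto simp: scaleR_add_right sum.distrib intro: lin_hull.add has_derivative_add)
  next
    case (scale u c)
    then obtain d where dd: "\<forall>b\<in>B. d b \<in> lin_hull G"
      "\<And>x. x \<in> S \<Longrightarrow> (u has_derivative (\<lambda>h. \<Sum>b\<in>B. (h \<bullet> b) *\<^sub>R d b x)) (at x within S)" by auto
    have "((\<lambda>x. c *\<^sub>R u x) has_derivative (\<lambda>h. \<Sum>b\<in>B. (h \<bullet> b) *\<^sub>R c *\<^sub>R d b x)) (at x within S)" if "x \<in> S" for x
      using has_derivative_scaleR_right[OF dd(2)[OF that], of c]
      by (simp add: scaleR_sum_right mult.commute)
    then show ?case
      using dd by (intro exI[of _ "\<lambda>b x. c *\<^sub>R d b x"] conjI ballI) (simp_all add: lin_hull.scale)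
  qed
qed

subsection \<open>Gluing and algebraic operations\<close>

text \<open>The class of locally smooth functions is closed under partial derivatives, since \<open>dirder\<close> is
  defined by the function alone and hence agrees on overlaps.\<close>

lemma smooth_within_local:
  fixes f :: "'a::euclidean_space \<Rightarrow> 'b::real_normed_vector"
  assumes F: "subspace F" and loc: "\<And>x. x \<in> S \<Longrightarrow> \<exists>O'. openin (top_of_set F) O' \<and> x \<in> O' \<and> smooth_within F O' f"
  shows "smooth_within F S f"
proof -
  obtain B where B: "frame_of F B" using frame_exists F by blast
  let ?C = "{u::'a \<Rightarrow> 'b. \<forall>x\<in>S. \<exists>O'. openin (top_of_set F) O' \<and> x \<in> O' \<and> smooth_within F O' u}"
  show ?thesis
  proof (rule smooth_withinI_partials[OF B, of ?C])
    fix u assume u: "u \<in> ?C"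
    show "\<exists>d. (\<forall>b\<in>B. d b \<in> ?C) \<and>
            (\<forall>x\<in>S. (u has_derivative (\<lambda>h. \<Sum>b\<in>B. (h \<bullet> b) *\<^sub>R d b x)) (at x within S))"
    proof (intro exI[of _ "\<lambda>b. dirder b u"] conjI ballI)
      fix b assume b: "b \<in> B"
      have "b \<in> F" using b B by (auto simp: frame_of_def)
      then show "dirder b u \<in> ?C" using u smooth_within_dirder(1)[OF _ F] by fast
    next
      fix x assume x: "x \<in> S"
      have SF: "S \<subseteq> F" using loc openin_imp_subset by blast
      obtain O' where O: "openin (top_of_set F) O'" "x \<in> O'" "smooth_within F O' u" using u x by blast
      then obtain T where T: "open T" "O' = F \<inter> T" by (auto simp: openin_open)
      have "(u has_derivative (\<lambda>h. \<Sum>b\<in>B. (h \<bullet> b) *\<^sub>R dirder b u x)) (at x within O')"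
        by (rule smooth_within_dirder(2)[OF O(3) F O(1) B O(2)])
      then have "(u has_derivative (\<lambda>h. \<Sum>b\<in>B. (h \<bullet> b) *\<^sub>R dirder b u x)) (at x within (S \<inter> T))"
        by (rule has_derivative_subset) (use SF T in auto)
      moreover have "at x within (S \<inter> T) = at x within S"
        using O T by (intro at_within_nhd[of x T]) auto
      ultimately show "(u has_derivative (\<lambda>h. \<Sum>b\<in>B. (h \<bullet> b) *\<^sub>R dirder b u x)) (at x within S)"
        by simp
    qed
  qed (use loc in simp)
qed

lemma smooth_within_affine:
  assumes F: "subspace F" and L: "bounded_linear L"
  shows "smooth_within F S (\<lambda>x::'a::euclidean_space. L x + (c::'b::real_normed_vector))"
proof -
  let ?D = "\<lambda>x vs. case vs of [] \<Rightarrow> L x + c | [v] \<Rightarrow> L v | _ \<Rightarrow> 0"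
  have "jet F S (\<lambda>x. L x + c) ?D"
    unfolding jet_def multilinear_on_def
  proof (intro conjI ballI allI impI)
    fix x us ws u v and a b :: real
    show "?D x (us @ (a *\<^sub>R u + b *\<^sub>R v) # ws) = a *\<^sub>R ?D x (us @ u # ws) + b *\<^sub>R ?D x (us @ v # ws)"
      using L by (cases us; cases ws)
        (auto simp: bounded_linear.linear linear_add linear_scale split: list.splits)
  next
    fix k x
    obtain K where K: "\<And>v. norm (L v) \<le> norm v * K" "K \<ge> 0"
      using bounded_linear.nonneg_bounded[OF L] by blast
    have "norm (?D x vs) \<le> (norm (L x + c) + K) * prod_list (map norm vs)" for vs
    proof (cases vs)
      case (Cons v vs')
      show ?thesis
      proof (cases vs')
        case Nil
        have "norm (L v) \<le> K * norm v" using K(1)[of v] by (simp add: mult.commute)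
        also have "\<dots> \<le> (norm (L x + c) + K) * norm v" by (intro mult_right_mono) auto
        finally show ?thesis using Cons Nil by simp
      qed (use Cons K in \<open>auto intro!: mult_nonneg_nonneg\<close>)
    qed (use K in auto)
    then show "\<exists>K. \<forall>vs\<in>lists F. length vs = k \<longrightarrow> norm (?D x vs) \<le> K * prod_list (map norm vs)" by blast
  next
    fix k x and e :: real assume "e > 0"
    have "?D y vs - ?D x vs - ?D x ((y - x) # vs) = 0" for y vs
      using L by (auto simp: bounded_linear.linear linear_diff split: list.splits)
    then show "\<exists>d>0. \<forall>y\<in>S. norm (y - x) < d \<longrightarrow> (\<forall>vs\<in>lists F. length vs = k \<longrightarrow>
       norm (?D y vs - ?D x vs - ?D x ((y - x) # vs)) \<le> e * norm (y - x) * prod_list (map norm vs))"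
      using \<open>e > 0\<close> by (intro exI[of _ 1]) (simp add: mult_nonneg_nonneg)
  qed simp
  then show ?thesis by (auto simp: smooth_within_jet)
qed

lemma smooth_within_const: "subspace F \<Longrightarrow> smooth_within F S (\<lambda>x::'a::euclidean_space. c)"
  using smooth_within_affine[OF _ bounded_linear_zero, of F S c] by simp

lemma smooth_within_linear:
  "subspace F \<Longrightarrow> bounded_linear L \<Longrightarrow> smooth_within F S (L :: 'a::euclidean_space \<Rightarrow> _)"
  using smooth_within_affine[of F L S 0] by simp

text \<open>By the product rule the linear combinations of the functions \<open>p(f, g)\<close>, with \<open>f\<close> and \<open>g\<close> smooth,
  are closed under partial derivatives.\<close>

lemma smooth_within_bilinear:
  fixes f :: "'a::euclidean_space \<Rightarrow> 'b::real_normed_vector"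
  assumes bil: "bounded_bilinear p" and F: "subspace F" "openin (top_of_set F) S"
    and fg: "smooth_within F S f" "smooth_within F S g"
  shows "smooth_within F S (\<lambda>x. p (f x) (g x))"
proof -
  interpret p: bounded_bilinear p by fact
  obtain B where B: "frame_of F B" using frame_exists F by blast
  then have BF: "B \<subseteq> F" by (simp add: frame_of_def)
  let ?G = "{\<lambda>x. p (f x) (g x) |f g. smooth_within F S f \<and> smooth_within F S g}"
  show ?thesis
  proof (rule smooth_withinI_hull[OF B, of ?G])
    fix u assume "u \<in> ?G"
    then obtain f g where u: "u = (\<lambda>x. p (f x) (g x))" and f: "smooth_within F S f" and g: "smooth_within F S g"
      by blast
    let ?d = "\<lambda>b x. p (f x) (dirder b g x) + p (dirder b f x) (g x)"
    have "?d b \<in> lin_hull ?G" if "b \<in> B" for b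
    proof -
      have "smooth_within F S (dirder b f)" "smooth_within F S (dirder b g)"
        using smooth_within_dirder(1)[OF _ F] f g BF that by auto
      then show ?thesis using f g by (intro lin_hull.add lin_hull.base) blast+
    qed
    moreover have "(u has_derivative (\<lambda>h. \<Sum>b\<in>B. (h \<bullet> b) *\<^sub>R ?d b x)) (at x within S)" if "x \<in> S" for x
    proof -
      have "(\<Sum>b\<in>B. (h \<bullet> b) *\<^sub>R ?d b x) =
          p (f x) (\<Sum>b\<in>B. (h \<bullet> b) *\<^sub>R dirder b g x) + p (\<Sum>b\<in>B. (h \<bullet> b) *\<^sub>R dirder b f x) (g x)" for h
        by (simp add: p.sum_right p.sum_left p.scaleR_right p.scaleR_left scaleR_add_right sum.distrib)
      then show ?thesis
        using p.FDERIV[OF smooth_within_dirder(2)[OF f F B that] smooth_within_dirder(2)[OF g F B that]] u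
        by simp
    qed
    ultimately show "\<exists>d. (\<forall>b\<in>B. d b \<in> lin_hull ?G) \<and>
        (\<forall>x\<in>S. (u has_derivative (\<lambda>h. \<Sum>b\<in>B. (h \<bullet> b) *\<^sub>R d b x)) (at x within S))"
      by (intro exI[of _ ?d] conjI ballI) simp_all
  qed (use fg in \<open>blast intro: lin_hull.base\<close>)
qed

lemma smooth_within_linear_comp:
  fixes f :: "'a::euclidean_space \<Rightarrow> 'b::real_normed_vector"
  assumes L: "bounded_linear L" and F: "subspace F" "openin (top_of_set F) S" and f: "smooth_within F S f"
  shows "smooth_within F S (\<lambda>x. L (f x))"
proof -
  have "bounded_bilinear (\<lambda>(r::real) v. r *\<^sub>R L v)"
    using bounded_bilinear.comp[OF bounded_bilinear_scaleR bounded_linear_ident L] by (simp add: o_def)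
  from smooth_within_bilinear[OF this F smooth_within_const[OF F(1), of S 1] f] show ?thesis by simp
qed

lemma smooth_within_add:
  fixes f :: "'a::euclidean_space \<Rightarrow> 'b::real_normed_vector"
  assumes F: "subspace F" "openin (top_of_set F) S" and f: "smooth_within F S f" and g: "smooth_within F S g"
  shows "smooth_within F S (\<lambda>x. f x + g x)"
proof -
  obtain B where B: "frame_of F B" using frame_exists F by blast
  then have BF: "B \<subseteq> F" by (simp add: frame_of_def)
  show ?thesis
  proof (rule smooth_withinI_hull[OF B, of "{f. smooth_within F S f}"])
    fix u :: "'a \<Rightarrow> 'b" assume "u \<in> {f. smooth_within F S f}"
    then show "\<exists>d. (\<forall>b\<in>B. d b \<in> lin_hull {f. smooth_within F S f}) \<and>
        (\<forall>x\<in>S. (u has_derivative (\<lambda>h. \<Sum>b\<in>B. (h \<bullet> b) *\<^sub>R d b x)) (at x within S))"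
      using smooth_within_dirder(1,2)[OF _ F, of u] B BF
      by (intro exI[of _ "\<lambda>b. dirder b u"]) (auto intro!: lin_hull.base)
  qed (use f g in \<open>blast intro: lin_hull.add lin_hull.base\<close>)
qed

lemma smooth_within_Pair:
  fixes f :: "'a::euclidean_space \<Rightarrow> 'b::real_normed_vector"
  assumes F: "subspace F" "openin (top_of_set F) S" and f: "smooth_within F S f" and g: "smooth_within F S g"
  shows "smooth_within F S (\<lambda>x. (f x, g x))"
proof -
  have "smooth_within F S (\<lambda>x. (f x, 0) + (0, g x))"
    by (intro smooth_within_add F smooth_within_linear_comp[OF _ F f] smooth_within_linear_comp[OF _ F g]
       bounded_linear_Pair bounded_linear_ident bounded_linear_zero)
  then show ?thesis by simp
qed

lemma smooth_within_sum:
  fixes f :: "'i \<Rightarrow> 'a::euclidean_space \<Rightarrow> 'b::real_normed_vector"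
  assumes F: "subspace F" "openin (top_of_set F) S" and "\<And>i. i \<in> J \<Longrightarrow> smooth_within F S (f i)"
  shows "smooth_within F S (\<lambda>x. \<Sum>i\<in>J. f i x)"
  using assms(3) by (induction J rule: infinite_finite_induct) (auto intro: smooth_within_const smooth_within_add F)

section \<open>Composition of smooth maps\<close>

text \<open>The bound \<open>K\<close> is a parameter because the Taylor estimate below must be uniform in the
  multilinear map and linear in its bound.\<close>

definition multibounded_on :: "'a::real_normed_vector set \<Rightarrow> nat \<Rightarrow> real \<Rightarrow> ('a list \<Rightarrow> 'b::real_normed_vector) \<Rightarrow> bool" where
  "multibounded_on F k K M \<longleftrightarrow>
     (\<forall>vs\<in>lists F. length vs = k \<longrightarrow> norm (M vs) \<le> K * prod_list (map norm vs))"

lemma multibounded_on_Cons: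
  assumes "multibounded_on F (Suc k) K M" "u \<in> F"
  shows "multibounded_on F k (K * norm u) (\<lambda>l. M (u # l))"
  unfolding multibounded_on_def
proof (intro ballI impI)
  fix vs assume "vs \<in> lists F" "length vs = k"
  then have "norm (M (u # vs)) \<le> K * prod_list (map norm (u # vs))"
    using assms unfolding multibounded_on_def by (intro assms(1)[unfolded multibounded_on_def, rule_format]) auto
  then show "norm (M (u # vs)) \<le> K * norm u * prod_list (map norm vs)" by simp
qed

text \<open>The Leibniz rule: \<open>leibniz M [(v\<^sub>1, v\<^sub>1'), \<dots>]\<close> is the derivative of \<open>M [v\<^sub>1, \<dots>]\<close> when the
  entry \<open>v\<^sub>i\<close> has derivative \<open>v\<^sub>i'\<close>.\<close>

fun leibniz :: "('b list \<Rightarrow> 'c::real_vector) \<Rightarrow> ('b \<times> 'b) list \<Rightarrow> 'c" where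
  "leibniz M [] = 0"
| "leibniz M ((v, v') # ps) = M (v' # map fst ps) + leibniz (\<lambda>l. M (v # l)) ps"

lemma leibniz_bound:
  fixes ws :: "('a \<Rightarrow> 'b::real_normed_vector) list"
  assumes "\<And>w. w \<in> set ws \<Longrightarrow> w x \<in> F"
    and "\<And>w h. w \<in> set ws \<Longrightarrow> w' w h \<in> F"
    and "\<And>w h. w \<in> set ws \<Longrightarrow> norm (w' w h) \<le> C w * r h"
    and "\<And>w. w \<in> set ws \<Longrightarrow> C w \<ge> 0"
  shows "\<exists>A\<ge>0. \<forall>h K (M :: 'b list \<Rightarrow> 'c::real_normed_vector). K \<ge> 0 \<longrightarrow> multibounded_on F (length ws) K M \<longrightarrow> r h \<ge> 0 \<longrightarrow>
     norm (leibniz M (map (\<lambda>w. (w x, w' w h)) ws)) \<le> A * K * r h"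
  using assms
proof (induction ws)
  case Nil
  then show ?case by (intro exI[of _ 0]) auto
next
  case (Cons w ws)
  have "\<exists>A\<ge>0. \<forall>h K (M :: 'b list \<Rightarrow> 'c). K \<ge> 0 \<longrightarrow> multibounded_on F (length ws) K M \<longrightarrow> r h \<ge> 0 \<longrightarrow>
     norm (leibniz M (map (\<lambda>w. (w x, w' w h)) ws)) \<le> A * K * r h"
    by (rule Cons.IH) (use Cons.prems in auto)
  then obtain A where A: "A \<ge> 0" "\<And>h K (M :: 'b list \<Rightarrow> 'c). K \<ge> 0 \<Longrightarrow> multibounded_on F (length ws) K M \<Longrightarrow> r h \<ge> 0 \<Longrightarrow>
     norm (leibniz M (map (\<lambda>w. (w x, w' w h)) ws)) \<le> A * K * r h" by blast
  let ?P = "prod_list (map norm (map (\<lambda>w. w x) ws))"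
  let ?A = "C w * ?P + A * norm (w x)"
  have "norm (leibniz M (map (\<lambda>w. (w x, w' w h)) (w # ws))) \<le> ?A * K * r h"
    if K: "K \<ge> 0" "multibounded_on F (length (w # ws)) K M" and r: "r h \<ge> 0" for h K and M :: "'b list \<Rightarrow> 'c"
  proof -
    have wx: "w x \<in> F" and w'h: "w' w h \<in> F" using Cons.prems by auto
    have "norm (leibniz (\<lambda>l. M (w x # l)) (map (\<lambda>w. (w x, w' w h)) ws)) \<le> A * (K * norm (w x)) * r h"
      using multibounded_on_Cons[OF _ wx] K r by (intro A(2)) auto
    moreover have "norm (M (w' w h # map (\<lambda>w. w x) ws)) \<le> K * (C w * r h) * ?P"
    proof -
      have "w' w h # map (\<lambda>w. w x) ws \<in> lists F"
        using w'h Cons.prems(1) by auto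
      then have "norm (M (w' w h # map (\<lambda>w. w x) ws)) \<le> K * prod_list (map norm (w' w h # map (\<lambda>w. w x) ws))"
        by (intro K(2)[unfolded multibounded_on_def, rule_format]) auto
      also have "\<dots> = K * norm (w' w h) * ?P" by simp
      also have "\<dots> \<le> K * (C w * r h) * ?P"
        using Cons.prems(3)[of w h] K by (intro mult_right_mono mult_left_mono) (auto simp del: map_map)
      finally show ?thesis .
    qed
    moreover have "norm (leibniz M (map (\<lambda>w. (w x, w' w h)) (w # ws)))
       \<le> norm (M (w' w h # map (\<lambda>w. w x) ws)) + norm (leibniz (\<lambda>l. M (w x # l)) (map (\<lambda>w. (w x, w' w h)) ws))"
      by (simp add: o_def norm_triangle_ineq)
    ultimately show ?thesis by (simp add: algebra_simps)
  qed
  moreover have "?A \<ge> 0" using A Cons.prems(4)[of w] by (intro add_nonneg_nonneg mult_nonneg_nonneg prod_list_norm_nonneg) auto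
  ultimately show ?case by (intro exI[of _ ?A]) auto
qed

lemma eventually_prod_norm_bounded:
  assumes "\<And>w. w \<in> set ws \<Longrightarrow> continuous (at x within S) w"
  shows "eventually (\<lambda>y. prod_list (map norm (map (\<lambda>w. w y) ws)) \<le> prod_list (map (\<lambda>w. norm (w x) + 1) ws)) (at x within S)"
  using assms
proof (induction ws)
  case (Cons w ws)
  have "((\<lambda>y. norm (w y)) \<longlongrightarrow> norm (w x)) (at x within S)"
    using Cons.prems[of w] by (intro tendsto_norm) (simp add: continuous_within)
  then have "eventually (\<lambda>y. norm (w y) < norm (w x) + 1) (at x within S)"
    by (rule order_tendstoD) simp
  moreover have "eventually (\<lambda>y. prod_list (map norm (map (\<lambda>w. w y) ws)) \<le> prod_list (map (\<lambda>w. norm (w x) + 1) ws)) (at x within S)"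
    using Cons by simp
  ultimately show ?case
    by eventually_elim (auto intro!: mult_mono simp del: map_map)
qed simp

text \<open>The product rule for a multilinear map in finitely many differentiable arguments.  In the induction
  the first argument is frozen, at a value that depends on the point \<open>y\<close>; this is why the estimate is stated
  uniformly for all \<open>M\<close>.\<close>

lemma multilinear_taylor:
  fixes ws :: "('a::real_normed_vector \<Rightarrow> 'b::real_normed_vector) list"
  assumes F: "subspace F"
    and "\<And>w y. w \<in> set ws \<Longrightarrow> y \<in> S \<Longrightarrow> w y \<in> F" and x: "x \<in> S"
    and "\<And>w h. w \<in> set ws \<Longrightarrow> w' w h \<in> F"
    and "\<And>w. w \<in> set ws \<Longrightarrow> (w has_derivative w' w) (at x within S)"
    and "e > 0"
  shows "eventually (\<lambda>y. \<forall>K (M :: 'b list \<Rightarrow> 'c::real_normed_vector). K \<ge> 0 \<longrightarrow> multilinear_on F M \<longrightarrow> multibounded_on F (length ws) K M \<longrightarrow>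
     norm (M (map (\<lambda>w. w y) ws) - M (map (\<lambda>w. w x) ws) - leibniz M (map (\<lambda>w. (w x, w' w (y - x))) ws))
       \<le> e * K * norm (y - x)) (at x within S)"
  using assms(2,4-6)
proof (induction ws arbitrary: e)
  case (Cons w ws)
  let ?lz = "\<lambda>M y. leibniz M (map (\<lambda>w. (w x, w' w (y - x))) ws)"
  let ?P = "\<lambda>y. map (\<lambda>w. w y) ws"
  have IH: "eventually (\<lambda>y. \<forall>K (M :: 'b list \<Rightarrow> 'c). K \<ge> 0 \<longrightarrow> multilinear_on F M \<longrightarrow> multibounded_on F (length ws) K M \<longrightarrow>
     norm (M (?P y) - M (?P x) - ?lz M y) \<le> e' * K * norm (y - x)) (at x within S)" if "e' > 0" for e'
    by (rule Cons.IH) (use Cons.prems that in auto)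
  have bl: "bounded_linear (w' v)" if "v \<in> set (w # ws)" for v
    using Cons.prems(3)[OF that] by (rule has_derivative_bounded_linear)
  have "\<exists>C. \<forall>v\<in>set (w # ws). 0 \<le> C v \<and> (\<forall>h. norm (w' v h) \<le> C v * norm h)"
  proof (rule bchoice, rule ballI)
    fix v assume "v \<in> set (w # ws)"
    from bounded_linear.nonneg_bounded[OF bl[OF this]]
    show "\<exists>C. 0 \<le> C \<and> (\<forall>h. norm (w' v h) \<le> C * norm h)" by (auto simp: mult.commute)
  qed
  then obtain C where C: "\<And>v h. v \<in> set (w # ws) \<Longrightarrow> 0 \<le> C v"
      "\<And>v h. v \<in> set (w # ws) \<Longrightarrow> norm (w' v h) \<le> C v * norm h" by blast
  have "\<exists>A\<ge>0. \<forall>h K (M :: 'b list \<Rightarrow> 'c). K \<ge> 0 \<longrightarrow> multibounded_on F (length ws) K M \<longrightarrow> norm h \<ge> 0 \<longrightarrow>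
     norm (leibniz M (map (\<lambda>w. (w x, w' w h)) ws)) \<le> A * K * norm h"
    by (rule leibniz_bound[where C = C]) (use Cons.prems x C in auto)
  then obtain A where A: "A \<ge> 0" "\<And>h K (M :: 'b list \<Rightarrow> 'c). K \<ge> 0 \<Longrightarrow> multibounded_on F (length ws) K M \<Longrightarrow>
     norm (leibniz M (map (\<lambda>w. (w x, w' w h)) ws)) \<le> A * K * norm h" by (auto simp: norm_ge_zero)
  define R where "R = prod_list (map (\<lambda>w. norm (w x) + 1) ws)"
  have R0: "R \<ge> 0" unfolding R_def by (induction ws) auto
  define a0 where "a0 = w x"
  \<comment> \<open>Each of the three terms of the splitting below gets a third of the error: the increment of
    the remaining arguments, the first-order error of \<open>w\<close>, and the mixed second-order term.\<close>
  define e1 where "e1 = e / (3 * (norm a0 + 1))"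
  define e2 where "e2 = e / (3 * (R + 1))"
  define e3 where "e3 = e / (3 * ((1 + A) * C w + 1))"
  have Cw: "C w \<ge> 0" using C by simp
  have pos: "norm a0 + 1 > 0" "R + 1 > 0" "(1 + A) * C w + 1 > 0"
    using R0 A(1) Cw by (auto intro: add_nonneg_pos mult_nonneg_nonneg)
  have e123: "e1 > 0" "e2 > 0" "e3 > 0"
    using pos \<open>e > 0\<close> by (simp_all add: e1_def e2_def e3_def)
  have ev1: "eventually (\<lambda>y. norm (w y - w x - w' w (y - x)) \<le> e2 * norm (y - x)) (at x within S)"
    using Cons.prems(3)[of w] e123(2) unfolding has_derivative_within_alt2 by simp
  have "((\<lambda>y. norm (y - x)) \<longlongrightarrow> norm (x - x)) (at x within S)" by (intro tendsto_intros)
  then have ev2: "eventually (\<lambda>y. norm (y - x) < e3) (at x within S)"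
    using e123(3) by (intro order_tendstoD(2)[of _ "norm (x - x)"]) auto
  have ev3: "eventually (\<lambda>y. prod_list (map norm (?P y)) \<le> R) (at x within S)"
    unfolding R_def using Cons.prems(3) by (intro eventually_prod_norm_bounded) (auto intro: has_derivative_continuous)
  have ev4: "eventually (\<lambda>y. y \<in> S) (at x within S)"
    by (simp add: eventually_at_filter)
  show ?case
    using IH[OF e123(1)] IH[OF zero_less_one] ev1 ev2 ev3 ev4
  proof eventually_elim
    case (elim y)
    let ?h = "y - x"
    let ?a = "w' w ?h"
    show ?case
    proof (intro allI impI)
      fix K and M :: "'b list \<Rightarrow> 'c"
      assume K: "K \<ge> 0" and M: "multilinear_on F M" and MK: "multibounded_on F (length (w # ws)) K M"
      have inF: "w y \<in> F" "a0 \<in> F" "?a \<in> F" using Cons.prems(1,2) elim(6) x by (auto simp: a0_def)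
      have PF: "?P y \<in> lists F" "?P x \<in> lists F" using Cons.prems(1) elim(6) x by auto
      have MK': "multibounded_on F (length ws) (K * norm u) (\<lambda>l. M (u # l))" if "u \<in> F" for u
        using multibounded_on_Cons[of F "length ws" K M u] MK that by simp
      have t1: "norm (M (a0 # ?P y) - M (a0 # ?P x) - ?lz (\<lambda>l. M (a0 # l)) y) \<le> e1 * (K * norm a0) * norm ?h"
        using elim(1)[rule_format, of "K * norm a0" "\<lambda>l. M (a0 # l)"] K MK'[OF inF(2)] multilinear_on_Cons[OF M inF(2)]
        by simp
      have t2: "norm (M ((w y - a0 - ?a) # ?P y)) \<le> K * (e2 * norm ?h) * R"
      proof -
        have "w y - a0 - ?a \<in> F" using inF F by (intro subspace_diff) auto
        then have "norm (M ((w y - a0 - ?a) # ?P y)) \<le> K * prod_list (map norm ((w y - a0 - ?a) # ?P y))"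
          using PF by (intro MK[unfolded multibounded_on_def, rule_format]) auto
        also have "\<dots> = K * norm (w y - a0 - ?a) * prod_list (map norm (?P y))" by simp
        also have "\<dots> \<le> K * (e2 * norm ?h) * R"
          using elim(3,5) K e123 by (intro mult_mono mult_left_mono mult_nonneg_nonneg) (auto simp: a0_def)
        finally show ?thesis .
      qed
      have t3: "norm (M (?a # ?P y) - M (?a # ?P x)) \<le> (1 + A) * (K * (C w * norm ?h)) * norm ?h"
      proof -
        let ?M = "\<lambda>l. M (?a # l)"
        have "norm (?M (?P y) - ?M (?P x)) \<le> norm (?M (?P y) - ?M (?P x) - ?lz ?M y) + norm (?lz ?M y)"
          using norm_triangle_ineq[of "?M (?P y) - ?M (?P x) - ?lz ?M y" "?lz ?M y"] by simp
        also have "\<dots> \<le> 1 * (K * norm ?a) * norm ?h + A * (K * norm ?a) * norm ?h"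
        proof (rule add_mono)
          show "norm (?M (?P y) - ?M (?P x) - ?lz ?M y) \<le> 1 * (K * norm ?a) * norm ?h"
            using elim(2)[rule_format, of "K * norm ?a" ?M] K MK'[OF inF(3)] multilinear_on_Cons[OF M inF(3)] by simp
          show "norm (?lz ?M y) \<le> A * (K * norm ?a) * norm ?h"
            using A(2)[of "K * norm ?a" ?M] K MK'[OF inF(3)] by simp
        qed
        also have "\<dots> = (1 + A) * (K * norm ?a) * norm ?h" by (simp add: algebra_simps)
        also have "\<dots> \<le> (1 + A) * (K * (C w * norm ?h)) * norm ?h"
          using C(2)[of w ?h] A(1) K by (intro mult_right_mono mult_left_mono) auto
        finally show ?thesis .
      qed
      have split: "M (map (\<lambda>w. w y) (w # ws)) - M (map (\<lambda>w. w x) (w # ws)) -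
          leibniz M (map (\<lambda>w. (w x, w' w ?h)) (w # ws)) =
          (M (a0 # ?P y) - M (a0 # ?P x) - ?lz (\<lambda>l. M (a0 # l)) y) + M ((w y - a0 - ?a) # ?P y)
          + (M (?a # ?P y) - M (?a # ?P x))"
      proof -
        have "M ((w y - a0 - ?a) # ?P y) = M (w y # ?P y) - M (a0 # ?P y) - M (?a # ?P y)"
          using multilinear_on_diff_Cons[OF M F _ inF(3) PF(1), of "w y - a0"]
            multilinear_on_diff_Cons[OF M F inF(1,2) PF(1)] inF F by (simp add: subspace_diff)
        then show ?thesis by (simp add: a0_def o_def)
      qed
      have b1: "e1 * (K * norm a0) * norm ?h \<le> e / 3 * K * norm ?h"
      proof -
        have "e1 * norm a0 \<le> e1 * (norm a0 + 1)" using e123 by (intro mult_left_mono) auto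
        also have "\<dots> = e / 3" using pos by (simp add: e1_def field_simps)
        finally have "(e1 * norm a0) * (K * norm ?h) \<le> e / 3 * (K * norm ?h)" using K by (intro mult_right_mono) auto
        then show ?thesis by (simp add: mult_ac)
      qed
      have b2: "K * (e2 * norm ?h) * R \<le> e / 3 * K * norm ?h"
      proof -
        have "e2 * R \<le> e2 * (R + 1)" using e123 by (intro mult_left_mono) auto
        also have "\<dots> = e / 3" using pos by (simp add: e2_def field_simps)
        finally have "(e2 * R) * (K * norm ?h) \<le> e / 3 * (K * norm ?h)" using K by (intro mult_right_mono) auto
        then show ?thesis by (simp add: mult_ac)
      qed
      have b3: "(1 + A) * (K * (C w * norm ?h)) * norm ?h \<le> e / 3 * K * norm ?h"
      proof -
        have "((1 + A) * C w) * norm ?h \<le> ((1 + A) * C w + 1) * e3"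
          using elim(4) A(1) Cw by (intro mult_mono) auto
        also have "\<dots> = e / 3" using pos by (simp add: e3_def field_simps)
        finally have "((1 + A) * C w * norm ?h) * (K * norm ?h) \<le> e / 3 * (K * norm ?h)" using K by (intro mult_right_mono) auto
        then show ?thesis by (simp add: mult_ac)
      qed
      have "norm (M (map (\<lambda>w. w y) (w # ws)) - M (map (\<lambda>w. w x) (w # ws)) -
          leibniz M (map (\<lambda>w. (w x, w' w ?h)) (w # ws))) \<le> e / 3 * K * norm ?h + e / 3 * K * norm ?h + e / 3 * K * norm ?h"
        unfolding split
        by (intro norm_triangle_le add_mono order_trans[OF t1 b1] order_trans[OF t2 b2] order_trans[OF t3 b3])
      also have "\<dots> = e * K * norm ?h" by (simp add: field_simps)
      finally show "norm (M (map (\<lambda>w. w y) (w # ws)) - M (map (\<lambda>w. w x) (w # ws)) -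
          leibniz M (map (\<lambda>w. (w x, w' w ?h)) (w # ws))) \<le> e * K * norm ?h" .
    qed
  qed
qed simp

lemma leibniz_eq_0:
  assumes "\<And>l. l \<in> lists F \<Longrightarrow> M l = 0" "\<And>p. p \<in> set ps \<Longrightarrow> fst p \<in> F \<and> snd p \<in> F"
  shows "leibniz M ps = 0"
  using assms
proof (induction M ps rule: leibniz.induct)
  case (2 M v v' ps)
  have vF: "v \<in> F" "v' \<in> F" using "2.prems"(2)[of "(v, v')"] by simp_all
  then have "leibniz (\<lambda>l. M (v # l)) ps = 0"
    using "2.prems"(2) by (intro "2.IH" "2.prems"(1)) simp_all
  moreover have "map fst ps \<in> lists F" using "2.prems"(2) by (force simp: in_lists_conv_set)
  then have "M (v' # map fst ps) = 0" using vF by (intro "2.prems"(1)) simp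
  ultimately show ?case by simp
qed simp

lemma leibniz_sum:
  assumes "multilinear_on F M" "subspace F" "finite B"
    and "\<And>w. w \<in> set ws \<Longrightarrow> w x \<in> F" "\<And>w b. w \<in> set ws \<Longrightarrow> b \<in> B \<Longrightarrow> d b w \<in> F"
  shows "leibniz M (map (\<lambda>w. (w x, \<Sum>b\<in>B. c b *\<^sub>R d b w)) ws) =
    (\<Sum>b\<in>B. c b *\<^sub>R leibniz M (map (\<lambda>w. (w x, d b w)) ws))"
  using assms(1,4,5)
proof (induction ws arbitrary: M)
  case (Cons w ws)
  have ws: "map (\<lambda>w. w x) ws \<in> lists F" using Cons.prems by auto
  have lin: "M ((\<Sum>b\<in>C. c b *\<^sub>R d b w) # l) = (\<Sum>b\<in>C. c b *\<^sub>R M (d b w # l))"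
    if "l \<in> lists F" "C \<subseteq> B" for l C
    using finite_subset[OF that(2) assms(3)] that
  proof (induction C rule: finite_induct)
    case empty
    then show ?case using multilinear_on_zero[OF Cons.prems(1), of "[]" l] subspace_0[OF assms(2)] by simp
  next
    case (insert b C)
    have "(\<Sum>b\<in>C. c b *\<^sub>R d b w) \<in> F" "d b w \<in> F"
      using insert.prems Cons.prems(3) by (auto intro!: subspace_sum subspace_scale assms(2))
    then have "M ([] @ (c b *\<^sub>R d b w + 1 *\<^sub>R (\<Sum>b\<in>C. c b *\<^sub>R d b w)) # l) =
      c b *\<^sub>R M ([] @ d b w # l) + 1 *\<^sub>R M ([] @ (\<Sum>b\<in>C. c b *\<^sub>R d b w) # l)"
      using Cons.prems(1)[unfolded multilinear_on_def, rule_format, of "[]" l "d b w" "\<Sum>b\<in>C. c b *\<^sub>R d b w" "c b" 1] insert.prems by simp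
    then show ?case using insert by simp
  qed
  have "leibniz (\<lambda>l. M (w x # l)) (map (\<lambda>w. (w x, \<Sum>b\<in>B. c b *\<^sub>R d b w)) ws) =
    (\<Sum>b\<in>B. c b *\<^sub>R leibniz (\<lambda>l. M (w x # l)) (map (\<lambda>w. (w x, d b w)) ws))"
    using Cons.prems by (intro Cons.IH multilinear_on_Cons) auto
  then show ?case using lin[OF ws order_refl] by (simp add: o_def scaleR_add_right sum.distrib)
qed simp

lemma multilinear_on_append:
  assumes "multilinear_on F M" "l \<in> lists F"
  shows "multilinear_on F (\<lambda>us. M (us @ l))"
  unfolding multilinear_on_def
proof (intro ballI allI)
  fix us ws v w and a b :: real
  assume "us \<in> lists F" "ws \<in> lists F" "v \<in> F" "w \<in> F"
  then show "M ((us @ (a *\<^sub>R v + b *\<^sub>R w) # ws) @ l) = a *\<^sub>R M ((us @ v # ws) @ l) + b *\<^sub>R M ((us @ w # ws) @ l)"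
    using assms(1)[unfolded multilinear_on_def, rule_format, of us "ws @ l" v w a b] assms(2) by simp
qed

lemma smooth_within_dirder_closed:
  fixes f :: "'a::euclidean_space \<Rightarrow> 'b::real_normed_vector"
  assumes f: "smooth_within F S f" and F: "subspace F" "openin (top_of_set F) S"
    and K: "closed K" "subspace K" "\<And>x. x \<in> S \<Longrightarrow> f x \<in> K" and "b \<in> F" "x \<in> S"
  shows "dirder b f x \<in> K"
proof (rule dirder_in_closed_subspace[OF smooth_within_dirder(3)[OF f F assms(7,8)] _ K(1,2)])
  show "eventually (\<lambda>t::real. f (x + t *\<^sub>R b) \<in> K) (nhds 0)"
    using eventually_line_in[OF F(2,1) assms(8,7)] by eventually_elim (rule K(3))
qed

text \<open>The chain rule.  The linear combinations of the functions \<open>x \<mapsto> D\<^sup>k g(f x)[w\<^sub>1 x, \<dots>, w\<^sub>k x]\<close>, with \<open>w\<^sub>1, \<dots>, w\<^sub>k\<close>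
  smooth maps into \<open>F'\<close>, are closed under partial derivatives: differentiating the base point inserts a
  partial derivative of \<open>f\<close> as a new argument, differentiating an argument replaces \<open>w\<^sub>i\<close> by its partial
  derivative.  For \<open>k = 0\<close> this is \<open>g \<circ> f\<close>.  The middle space may be infinite-dimensional.\<close>

theorem smooth_within_compose:
  fixes f :: "'a::euclidean_space \<Rightarrow> 'b::real_normed_vector" and g :: "'b \<Rightarrow> 'c::real_normed_vector"
  assumes F: "subspace F" "openin (top_of_set F) S" and f: "smooth_within F S f" "f ` S \<subseteq> S'"
    and g: "smooth_within F' S' g" and F': "subspace F'" "closed F'" "S' \<subseteq> F'"
  shows "smooth_within F S (\<lambda>x. g (f x))"
proof -
  obtain B where B: "frame_of F B" using frame_exists F by blast
  have finB: "finite B" and BF: "B \<subseteq> F" using B by (auto simp: frame_of_def)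
  obtain D where D: "jet F' S' g D" using g by (auto simp: smooth_within_jet)
  define W where "W = {w. smooth_within F S w \<and> w ` S \<subseteq> F'}"
  have fW: "f \<in> W" using f F' by (auto simp: W_def)
  have dW: "dirder b w \<in> W" if "w \<in> W" "b \<in> B" for w b
    using smooth_within_dirder(1)[of F S w, OF _ F] smooth_within_dirder_closed[of F S w, OF _ F F'(2,1)] that BF
    by (fastforce simp: W_def)
  define G where "G = {\<lambda>x. D (f x) (map (\<lambda>w. w x) ws) |ws. set ws \<subseteq> W}"
  define d where "d ws b = (\<lambda>x. D (f x) (dirder b f x # map (\<lambda>w. w x) ws) +
     leibniz (D (f x)) (map (\<lambda>w. (w x, dirder b w x)) ws))" for ws b
  have GI: "(\<lambda>x. D (f x) (map (\<lambda>w. w x) ws)) \<in> lin_hull G" if "set ws \<subseteq> W" for ws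
    by (rule lin_hull.base) (use that in \<open>auto simp: G_def\<close>)
  have "(\<lambda>x. leibniz (\<lambda>l. D (f x) (map (\<lambda>w. w x) us @ l)) (map (\<lambda>w. (w x, dirder b w x)) ws)) \<in> lin_hull G"
    if "set us \<subseteq> W" "set ws \<subseteq> W" "b \<in> B" for us ws b
    using that
  proof (induction ws arbitrary: us)
    case (Cons w ws)
    have "(\<lambda>x. D (f x) (map (\<lambda>w. w x) (us @ dirder b w # ws))) \<in> lin_hull G"
      using Cons.prems dW by (intro GI) auto
    moreover have "(\<lambda>x. leibniz (\<lambda>l. D (f x) (map (\<lambda>w. w x) (us @ [w]) @ l)) (map (\<lambda>w. (w x, dirder b w x)) ws)) \<in> lin_hull G"
      using Cons.prems by (intro Cons.IH) auto
    ultimately show ?case using lin_hull.add by (fastforce simp: o_def)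
  qed (simp add: lin_hull.zero)
  from this[of "[]"] GI[of "dirder b f # ws" for b ws]
  have dG: "d ws b \<in> lin_hull G" if "set ws \<subseteq> W" "b \<in> B" for ws b
    unfolding d_def using that dW[OF fW] by (intro lin_hull.add) auto
  have der: "((\<lambda>x. D (f x) (map (\<lambda>w. w x) ws)) has_derivative (\<lambda>h. \<Sum>b\<in>B. (h \<bullet> b) *\<^sub>R d ws b x)) (at x within S)"
    if ws: "set ws \<subseteq> W" and x: "x \<in> S" for ws x
    unfolding has_derivative_within_alt2
  proof (intro conjI allI impI frame_linear)
    fix e :: real assume e: "e > 0"
    let ?z = "f x"
    let ?M = "D ?z"
    have z: "?z \<in> S'" using f x by auto
    have M: "multilinear_on F' ?M" by (rule jet_multilinear[OF D z])
    define w' where "w' w h = (\<Sum>b\<in>B. (h \<bullet> b) *\<^sub>R dirder b w x)" for w :: "'a \<Rightarrow> 'b" and h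
    \<comment> \<open>The increment of the base point is treated as one more argument of \<open>?M\<close>, vanishing at \<open>x\<close>; then
      \<open>multilinear_taylor\<close> applies to it as well.\<close>
    let ?f0 = "\<lambda>y. f y - ?z"
    have f0W: "?f0 \<in> W"
    proof -
      have "smooth_within F S ?f0"
        using smooth_within_add[OF F f(1) smooth_within_const[OF F(1), of S "- ?z"]] by simp
      moreover have "f y - ?z \<in> F'" if "y \<in> S" for y
        using fW x that by (intro subspace_diff[OF F'(1)]) (auto simp: W_def)
      ultimately show ?thesis unfolding W_def by blast
    qed
    have df0: "dirder b ?f0 x = dirder b f x" if "b \<in> B" for b
    proof -
      have "((\<lambda>t::real. f (x + t *\<^sub>R b) - ?z) has_vector_derivative dirder b f x) (at 0)"
        using has_vector_derivative_diff[OF smooth_within_dirder(3)[OF f(1) F subsetD[OF BF that] x]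
            has_vector_derivative_const[of ?z]] by simp
      then show ?thesis unfolding dirder_def[of b ?f0] by (rule vector_derivative_at)
    qed
    have WF: "w y \<in> F'" if "w \<in> W" "y \<in> S" for w y using that by (auto simp: W_def)
    have w'F: "w' w h \<in> F'" if "w \<in> W" for w h
      unfolding w'_def using WF[OF dW[OF that]] x by (intro subspace_sum subspace_scale F'(1)) auto
    have w'der: "(w has_derivative w' w) (at x within S)" if "w \<in> W" for w
      unfolding w'_def using smooth_within_dirder(2)[of F S w, OF _ F B x] that by (simp add: W_def)
    obtain K1 where K1: "K1 \<ge> 0"
      "\<And>vs. vs \<in> lists F' \<Longrightarrow> length vs = length ws \<Longrightarrow> norm (?M vs) \<le> K1 * prod_list (map norm vs)"
      using jet_bound[OF D z] by blast
    obtain K2 where K2: "K2 \<ge> 0"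
      "\<And>vs. vs \<in> lists F' \<Longrightarrow> length vs = Suc (length ws) \<Longrightarrow> norm (?M vs) \<le> K2 * prod_list (map norm vs)"
      using jet_bound[OF D z] by blast
    define R where "R = prod_list (map (\<lambda>w. norm (w x) + 1) ws)"
    have R0: "R \<ge> 0" unfolding R_def by (induction ws) auto
    obtain C where C: "\<And>h. norm (w' f h) \<le> norm h * C" "C \<ge> 0"
      using bounded_linear.nonneg_bounded[OF has_derivative_bounded_linear[OF w'der[OF fW]]] by blast
    define e1 where "e1 = e / (3 * (K1 + 1))"
    define e2 where "e2 = e / (3 * (K2 + 1))"
    define e3 where "e3 = e / (3 * ((1 + C) * R + 1))"
    have pos: "K1 + 1 > 0" "K2 + 1 > 0" "(1 + C) * R + 1 > 0"
      using K1(1) K2(1) R0 C(2) by (auto intro: add_nonneg_pos mult_nonneg_nonneg)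
    have e123: "e1 > 0" "e2 > 0" "e3 > 0" using pos e by (simp_all add: e1_def e2_def e3_def)
    obtain \<delta> where \<delta>: "\<delta> > 0"
      "\<And>y vs. y \<in> S' \<Longrightarrow> norm (y - ?z) < \<delta> \<Longrightarrow> vs \<in> lists F' \<Longrightarrow> length vs = length ws \<Longrightarrow>
       norm (D y vs - ?M vs - ?M ((y - ?z) # vs)) \<le> e3 * norm (y - ?z) * prod_list (map norm vs)"
      using jet_diff[OF D z e123(3), of "length ws"] by blast
    have ev1: "eventually (\<lambda>y. \<forall>K (M :: 'b list \<Rightarrow> 'c). K \<ge> 0 \<longrightarrow> multilinear_on F' M \<longrightarrow> multibounded_on F' (length ws) K M \<longrightarrow>
     norm (M (map (\<lambda>w. w y) ws) - M (map (\<lambda>w. w x) ws) - leibniz M (map (\<lambda>w. (w x, w' w (y - x))) ws))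
       \<le> e1 * K * norm (y - x)) (at x within S)"
      by (rule multilinear_taylor[OF F'(1) _ x]) (use ws WF w'F w'der e123 in auto)
    have ev2: "eventually (\<lambda>y. \<forall>K (M :: 'b list \<Rightarrow> 'c). K \<ge> 0 \<longrightarrow> multilinear_on F' M \<longrightarrow> multibounded_on F' (length (?f0 # ws)) K M \<longrightarrow>
     norm (M (map (\<lambda>w. w y) (?f0 # ws)) - M (map (\<lambda>w. w x) (?f0 # ws)) - leibniz M (map (\<lambda>w. (w x, w' w (y - x))) (?f0 # ws)))
       \<le> e2 * K * norm (y - x)) (at x within S)"
    proof (rule multilinear_taylor[OF F'(1) _ x])
      have "set (?f0 # ws) \<subseteq> W" using f0W ws by simp
      then have *: "w \<in> W" if "w \<in> set (?f0 # ws)" for w using that by blast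
      show "w y \<in> F'" if "w \<in> set (?f0 # ws)" "y \<in> S" for w y using WF[OF *] that by blast
      show "w' w h \<in> F'" if "w \<in> set (?f0 # ws)" for w h using w'F[OF *] that by blast
      show "(w has_derivative w' w) (at x within S)" if "w \<in> set (?f0 # ws)" for w using w'der[OF *] that by blast
    qed (use e123 x in auto)
    have ev3: "eventually (\<lambda>y. norm (f y - ?z - w' f (y - x)) \<le> 1 * norm (y - x)) (at x within S)"
      using w'der[OF fW, unfolded has_derivative_within_alt2, THEN conjunct2, rule_format, of 1] by simp
    have ev4: "eventually (\<lambda>y. dist (f y) ?z < \<delta>) (at x within S)"
      using has_derivative_continuous[OF w'der[OF fW]] \<delta>(1) unfolding continuous_within by (rule tendstoD)
    have ev5: "eventually (\<lambda>y. prod_list (map norm (map (\<lambda>w. w y) ws)) \<le> R) (at x within S)"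
      unfolding R_def using w'der ws by (intro eventually_prod_norm_bounded) (auto intro: has_derivative_continuous)
    have ev6: "eventually (\<lambda>y. y \<in> S) (at x within S)" by (simp add: eventually_at_filter)
    show "eventually (\<lambda>y. norm (D (f y) (map (\<lambda>w. w y) ws) - D (f x) (map (\<lambda>w. w x) ws)
         - (\<Sum>b\<in>B. ((y - x) \<bullet> b) *\<^sub>R d ws b x)) \<le> e * norm (y - x)) (at x within S)"
      using ev1 ev2 ev3 ev4 ev5 ev6
    proof eventually_elim
      case (elim y)
      let ?h = "y - x"
      let ?P = "\<lambda>y. map (\<lambda>w. w y) ws"
      let ?lz = "leibniz ?M (map (\<lambda>w. (w x, w' w ?h)) ws)"
      have PF: "?P y \<in> lists F'" "?P x \<in> lists F'"
        using WF[OF subsetD[OF ws]] elim(6) x by auto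
      have 0: "0 \<in> F'" using F'(1) by (rule subspace_0)
      have t1: "norm (?M (?P y) - ?M (?P x) - ?lz) \<le> e1 * K1 * norm ?h"
        using elim(1)[rule_format, OF K1(1) M] K1(2) by (simp add: multibounded_on_def)
      have t2: "norm (?M (?f0 y # ?P y) - ?M (w' f ?h # ?P x)) \<le> e2 * K2 * norm ?h"
      proof -
        have "w' ?f0 ?h = w' f ?h" unfolding w'_def using df0 by (intro sum.cong) auto
        moreover have "leibniz (\<lambda>l. ?M (0 # l)) (map (\<lambda>w. (w x, w' w ?h)) ws) = 0"
        proof (rule leibniz_eq_0)
          show "?M (0 # l) = 0" if "l \<in> lists F'" for l
            using multilinear_on_zero[OF M _ that 0, of "[]"] by simp
        qed (use ws WF w'F x in auto)
        moreover have "?M (0 # ?P x) = 0" using multilinear_on_zero[OF M _ PF(2) 0, of "[]"] by simp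
        ultimately show ?thesis
          using elim(2)[rule_format, OF K2(1) M] K2(2) by (simp add: multibounded_on_def o_def)
      qed
      have t3: "norm (D (f y) (?P y) - ?M (?P y) - ?M (?f0 y # ?P y)) \<le> e / 3 * norm ?h"
      proof -
        have "norm (D (f y) (?P y) - ?M (?P y) - ?M (?f0 y # ?P y)) \<le> e3 * norm (?f0 y) * prod_list (map norm (?P y))"
          using f(2) elim(4,6) PF by (intro \<delta>(2)) (auto simp: dist_norm)
        also have "\<dots> \<le> e3 * ((1 + C) * norm ?h) * R"
        proof (intro mult_mono mult_left_mono elim(5) mult_nonneg_nonneg prod_list_norm_nonneg)
          have "norm (?f0 y) \<le> norm (?f0 y - w' f ?h) + norm (w' f ?h)"
            using norm_triangle_ineq[of "?f0 y - w' f ?h" "w' f ?h"] by simp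
          then show "norm (?f0 y) \<le> (1 + C) * norm ?h"
            using elim(3) C(1)[of ?h] by (simp add: algebra_simps)
        qed (use e123 C in auto)
        also have "\<dots> = (e3 * ((1 + C) * R)) * norm ?h" by (simp add: mult_ac)
        also have "\<dots> \<le> (e3 * ((1 + C) * R + 1)) * norm ?h"
          using e123 by (intro mult_right_mono mult_left_mono) auto
        also have "e3 * ((1 + C) * R + 1) = e / 3" using pos by (simp add: e3_def field_simps)
        finally show ?thesis .
      qed
      have b1: "e1 * K1 * norm ?h \<le> e / 3 * norm ?h"
      proof (rule mult_right_mono)
        have "e1 * K1 \<le> e1 * (K1 + 1)" using e123 by (intro mult_left_mono) auto
        also have "\<dots> = e / 3" using pos by (simp add: e1_def field_simps)
        finally show "e1 * K1 \<le> e / 3" .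
      qed simp
      have b2: "e2 * K2 * norm ?h \<le> e / 3 * norm ?h"
      proof (rule mult_right_mono)
        have "e2 * K2 \<le> e2 * (K2 + 1)" using e123 by (intro mult_left_mono) auto
        also have "\<dots> = e / 3" using pos by (simp add: e2_def field_simps)
        finally show "e2 * K2 \<le> e / 3" .
      qed simp
      have dsum: "(\<Sum>b\<in>B. (?h \<bullet> b) *\<^sub>R d ws b x) = ?M (w' f ?h # ?P x) + ?lz"
      proof -
        have "?lz = (\<Sum>b\<in>B. (?h \<bullet> b) *\<^sub>R leibniz ?M (map (\<lambda>w. (w x, dirder b w x)) ws))"
          unfolding w'_def using ws WF[OF _ x] WF[OF dW x]
          by (intro leibniz_sum[OF M F'(1) finB]) auto
        moreover have "?M (w' f ?h # ?P x) = (\<Sum>b\<in>B. (?h \<bullet> b) *\<^sub>R ?M (dirder b f x # ?P x))"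
          using leibniz_sum[OF multilinear_on_append[OF M PF(2)] F'(1) finB, of "[f]" x "\<lambda>b w. dirder b w x" "\<lambda>b. ?h \<bullet> b"]
             WF[OF fW x] WF[OF dW[OF fW] x] by (simp add: w'_def)
        ultimately show ?thesis by (simp add: d_def scaleR_add_right sum.distrib)
      qed
      have "norm (D (f y) (?P y) - ?M (?P x) - (\<Sum>b\<in>B. (?h \<bullet> b) *\<^sub>R d ws b x))
        = norm ((?M (?P y) - ?M (?P x) - ?lz) + (?M (?f0 y # ?P y) - ?M (w' f ?h # ?P x))
           + (D (f y) (?P y) - ?M (?P y) - ?M (?f0 y # ?P y)))"
        unfolding dsum by (simp add: algebra_simps)
      also have "\<dots> \<le> e / 3 * norm ?h + e / 3 * norm ?h + e / 3 * norm ?h"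
        by (intro norm_triangle_le add_mono order_trans[OF t1 b1] order_trans[OF t2 b2] t3)
      also have "\<dots> = e * norm ?h" by (simp add: field_simps)
      finally show ?case .
    qed
  qed
  have "smooth_within F S (\<lambda>x. D (f x) (map (\<lambda>w. w x) []))"
  proof (rule smooth_withinI_hull[OF B])
    show "(\<lambda>x. D (f x) (map (\<lambda>w. w x) [])) \<in> lin_hull G" by (rule GI) simp
    fix u assume "u \<in> G"
    then obtain ws where "u = (\<lambda>x. D (f x) (map (\<lambda>w. w x) ws))" "set ws \<subseteq> W" by (auto simp: G_def)
    then show "\<exists>d. (\<forall>b\<in>B. d b \<in> lin_hull G) \<and>
        (\<forall>x\<in>S. (u has_derivative (\<lambda>h. \<Sum>b\<in>B. (h \<bullet> b) *\<^sub>R d b x)) (at x within S))"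
      using dG der by (intro exI[of _ "d ws"]) simp
  qed
  moreover have "D (f x) (map (\<lambda>w. w x) []) = g (f x)" if "x \<in> S" for x
    using jet_0[OF D, of "f x"] f that by auto
  ultimately show ?thesis using smooth_within_cong[of S "\<lambda>x. D (f x) (map (\<lambda>w. w x) [])" "\<lambda>x. g (f x)" F] by blast
qed

section \<open>Smooth functions on a manifold\<close>

definition smooth_fun ::
  "('m, 'e::real_normed_vector) chart set \<Rightarrow> 'm set \<Rightarrow> ('m \<Rightarrow> 'k::real_normed_vector) \<Rightarrow> bool" where
  "smooth_fun A U f \<longleftrightarrow> (\<forall>c\<in>A. smooth_within (cmodel c) (cmap c ` (U \<inter> cdom c)) (f \<circ> chart_inv c))"

text \<open>The curve through \<open>x\<close> along which \<open>rvact\<close> differentiates.\<close>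

definition vcurve :: "('m, 'e::real_normed_vector) chart set \<Rightarrow> ('m, 'e) rvfield \<Rightarrow> 'm \<Rightarrow> real \<Rightarrow> 'm" where
  "vcurve A X x t = (let c = (SOME c. c \<in> A \<and> x \<in> cdom c) in chart_inv c (cmap c x + t *\<^sub>R X c x))"

lemma rvact_vcurve: "rvact A X f x = vector_derivative (\<lambda>t. f (vcurve A X x t)) (at 0)"
  by (simp add: rvact_def vcurve_def Let_def)

lemma dirder_sum:
  fixes f :: "'a::euclidean_space \<Rightarrow> 'b::real_normed_vector"
  assumes f: "smooth_within F S f" and F: "subspace F" "openin (top_of_set F) S"
    and B: "frame_of F B" and "v \<in> F" "x \<in> S"
  shows "dirder v f x = (\<Sum>b\<in>B. (v \<bullet> b) *\<^sub>R dirder b f x)"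
  unfolding dirder_def[of v]
  by (intro vector_derivative_at has_derivative_along_line[OF F(2,1) assms(6,5)] smooth_within_dirder(2)[OF f F B assms(6)])

lemma dirder_linear:
  fixes f :: "'a::euclidean_space \<Rightarrow> 'b::real_normed_vector"
  assumes f: "smooth_within F S f" and F: "subspace F" "openin (top_of_set F) S"
    and "v \<in> F" "w \<in> F" "x \<in> S"
  shows "dirder (a *\<^sub>R v + b *\<^sub>R w) f x = a *\<^sub>R dirder v f x + b *\<^sub>R dirder w f x"
proof -
  obtain B where B: "frame_of F B" using frame_exists F by blast
  have "a *\<^sub>R v + b *\<^sub>R w \<in> F" using assms by (intro subspace_add subspace_scale) auto
  then show ?thesis
    using dirder_sum[OF f F B _ assms(6)] assms(4,5)
    by (simp add: inner_add_left scaleR_add_left sum.distrib scaleR_sum_right)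
qed

text \<open>The chain rule for directional derivatives, in the form in which tangent vectors are transported by
  a change of charts.\<close>

lemma dirder_compose:
  fixes h :: "'a::euclidean_space \<Rightarrow> 'b::euclidean_space" and g :: "'b \<Rightarrow> 'c::real_normed_vector"
  assumes h: "smooth_within F S h" and F: "subspace F" "openin (top_of_set F) S"
    and g: "smooth_within F' S' g" and F': "subspace F'" "openin (top_of_set F') S'"
    and hS: "h ` S \<subseteq> S'" and vx: "v \<in> F" "x \<in> S"
  shows "dirder v (\<lambda>y. g (h y)) x = dirder (dirder v h x) g (h x)"
proof -
  obtain B where B: "frame_of F' B" using frame_exists F' by blast
  have hx: "h x \<in> S'" using hS vx by auto
  have "dirder v h x \<in> F'"
    using openin_imp_subset[OF F'(2)] hS
    by (intro smooth_within_dirder_closed[OF h F closed_subspace[OF F'(1)] F'(1) _ vx]) auto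
  then have eq: "dirder (dirder v h x) g (h x) = (\<Sum>b\<in>B. (dirder v h x \<bullet> b) *\<^sub>R dirder b g (h x))"
    by (rule dirder_sum[OF g F' B _ hx])
  have "((\<lambda>t. g (h (x + t *\<^sub>R v))) has_vector_derivative (\<Sum>b\<in>B. (dirder v h x \<bullet> b) *\<^sub>R dirder b g (h x))) (at 0)"
  proof (rule has_derivative_along_curve[OF smooth_within_dirder(3)[OF h F vx]])
    show "eventually (\<lambda>t. h (x + t *\<^sub>R v) \<in> S') (nhds 0)"
      using eventually_line_in[OF F(2,1) vx(2,1)] by eventually_elim (use hS in auto)
    show "(g has_derivative (\<lambda>k. \<Sum>b\<in>B. (k \<bullet> b) *\<^sub>R dirder b g (h x))) (at (h (x + 0 *\<^sub>R v)) within S')"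
      using smooth_within_dirder(2)[OF g F' B hx] by simp
  qed
  then show ?thesis unfolding eq by (simp add: dirder_def vector_derivative_at)
qed

locale manifold =
  fixes A :: "('m::{t2_space, second_countable_topology}, 'e::euclidean_space) chart set"
  assumes mfd: "smooth_manifold A"
begin

lemma chart_exists: obtains c where "c \<in> A" "x \<in> cdom c"
proof -
  have "(\<Union>c\<in>A. cdom c) = UNIV" using mfd by (simp add: smooth_manifold_def smooth_atlas_def)
  then have "x \<in> (\<Union>c\<in>A. cdom c)" by simp
  then show thesis using that by blast
qed

definition some_chart :: "'m \<Rightarrow> ('m, 'e) chart" where
  "some_chart x = (SOME c. c \<in> A \<and> x \<in> cdom c)"

lemma some_chart: "some_chart x \<in> A" "x \<in> cdom (some_chart x)"
proof -
  have "\<exists>c. c \<in> A \<and> x \<in> cdom c" using chart_exists by blast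
  from someI_ex[OF this] show "some_chart x \<in> A" "x \<in> cdom (some_chart x)"
    by (simp_all add: some_chart_def)
qed

lemma chart_facts:
  assumes "c \<in> A"
  shows "subspace (cmodel c)" "closed (cmodel c)" "open (cdom c)" "inj_on (cmap c) (cdom c)"
    "openin (top_of_set (cmodel c)) (cmap c ` cdom c)"
    "homeomorphism (cdom c) (cmap c ` cdom c) (cmap c) (chart_inv c)"
  using mfd assms by (auto simp: smooth_manifold_def smooth_atlas_def is_chart_def)

lemma chart_inv_cmap [simp]: "c \<in> A \<Longrightarrow> x \<in> cdom c \<Longrightarrow> chart_inv c (cmap c x) = x"
  using chart_facts(4) by (simp add: chart_inv_def)

lemma chart_image_open:
  assumes "c \<in> A" "open W" "W \<subseteq> cdom c"
  shows "openin (top_of_set (cmodel c)) (cmap c ` W)"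
proof -
  have "openin (top_of_set (cdom c)) W" using assms by (simp add: openin_open_eq chart_facts(3))
  then have "openin (top_of_set (cmap c ` cdom c)) (cmap c ` W)"
    by (rule homeomorphism_imp_open_map[OF chart_facts(6)[OF assms(1)]])
  then show ?thesis using chart_facts(5)[OF assms(1)] by (rule openin_trans)
qed

lemma chart_image_open_Int:
  "c \<in> A \<Longrightarrow> open W \<Longrightarrow> openin (top_of_set (cmodel c)) (cmap c ` (W \<inter> cdom c))"
  by (rule chart_image_open) (auto simp: chart_facts(3))

lemma chart_preimage_open:
  assumes "c \<in> A" "openin (top_of_set (cmodel c)) S"
  shows "open {x \<in> cdom c. cmap c x \<in> S}"
proof -
  have cont: "continuous_on (cdom c) (cmap c)" using chart_facts(6)[OF assms(1)] by (simp add: homeomorphism_def)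
  obtain T where T: "open T" "S = cmodel c \<inter> T" using assms(2) by (auto simp: openin_open)
  have "open (cdom c \<inter> cmap c -` T)"
    using continuous_on_open_vimage[OF chart_facts(3)[OF assms(1)]] cont T(1) by (metis Int_commute)
  moreover have "{x \<in> cdom c. cmap c x \<in> S} = cdom c \<inter> cmap c -` T"
    using openin_imp_subset[OF chart_facts(5)[OF assms(1)]] T by auto
  ultimately show ?thesis by simp
qed

lemma transition_smooth:
  assumes "c \<in> A" "d \<in> A"
  shows "smooth_within (cmodel c) (cmap c ` (cdom c \<inter> cdom d)) (cmap d \<circ> chart_inv c)"
  using mfd assms by (auto simp: smooth_manifold_def smooth_atlas_def)

subsection \<open>Calculus of smooth functions\<close>

lemma smooth_fun_subset: "smooth_fun A U f \<Longrightarrow> V \<subseteq> U \<Longrightarrow> smooth_fun A V f"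
  unfolding smooth_fun_def by (meson smooth_within_subset image_mono Int_mono order_refl)

lemma smooth_fun_cong:
  assumes "\<And>x. x \<in> U \<Longrightarrow> f x = g x"
  shows "smooth_fun A U f \<longleftrightarrow> smooth_fun A U g"
proof -
  have "smooth_within (cmodel c) (cmap c ` (U \<inter> cdom c)) (f \<circ> chart_inv c) \<longleftrightarrow>
      smooth_within (cmodel c) (cmap c ` (U \<inter> cdom c)) (g \<circ> chart_inv c)" if "c \<in> A" for c
    using assms that by (intro smooth_within_cong) auto
  then show ?thesis by (simp add: smooth_fun_def)
qed

text \<open>One chart suffices: in any other chart the function is composed with a smooth change of charts.\<close>

lemma smooth_fun_chart:
  assumes c: "c \<in> A" and W: "open W" "W \<subseteq> cdom c"
    and f: "smooth_within (cmodel c) (cmap c ` W) (f \<circ> chart_inv c)"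
  shows "smooth_fun A W f"
  unfolding smooth_fun_def
proof
  fix d assume d: "d \<in> A"
  let ?S = "cmap d ` (W \<inter> cdom d)"
  have "smooth_within (cmodel d) ?S (\<lambda>z. (f \<circ> chart_inv c) ((cmap c \<circ> chart_inv d) z))"
  proof (rule smooth_within_compose[OF chart_facts(1)[OF d] chart_image_open_Int[OF d W(1)] _ _ f
        chart_facts(1,2)[OF c]])
    show "smooth_within (cmodel d) ?S (cmap c \<circ> chart_inv d)"
      by (rule smooth_within_subset[OF transition_smooth[OF d c]]) (use W in auto)
    show "(cmap c \<circ> chart_inv d) ` ?S \<subseteq> cmap c ` W" using d by auto
    show "cmap c ` W \<subseteq> cmodel c" using openin_imp_subset[OF chart_image_open[OF c W]] .
  qed
  then show "smooth_within (cmodel d) ?S (f \<circ> chart_inv d)"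
    by (rule smooth_within_cong[THEN iffD1, rotated]) (use c d W in auto)
qed

lemma smooth_fun_local:
  assumes "\<And>x. x \<in> U \<Longrightarrow> \<exists>W. open W \<and> x \<in> W \<and> smooth_fun A W f"
  shows "smooth_fun A U f"
  unfolding smooth_fun_def
proof
  fix c assume c: "c \<in> A"
  show "smooth_within (cmodel c) (cmap c ` (U \<inter> cdom c)) (f \<circ> chart_inv c)"
  proof (rule smooth_within_local[OF chart_facts(1)[OF c]])
    fix z assume "z \<in> cmap c ` (U \<inter> cdom c)"
    then obtain x where x: "x \<in> U" "x \<in> cdom c" "z = cmap c x" by auto
    obtain W where W: "open W" "x \<in> W" "smooth_fun A W f" using assms x by blast
    then show "\<exists>O'. openin (top_of_set (cmodel c)) O' \<and> z \<in> O' \<and> smooth_within (cmodel c) O' (f \<circ> chart_inv c)"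
      using chart_image_open_Int[OF c W(1)] c x
      by (intro exI[of _ "cmap c ` (W \<inter> cdom c)"]) (auto simp: smooth_fun_def)
  qed
qed

lemma smooth_fun_const: "smooth_fun A U (\<lambda>x. c)"
  unfolding smooth_fun_def o_def by (intro ballI smooth_within_const chart_facts)

lemma smooth_fun_bilinear:
  assumes "bounded_bilinear p" "open U" "smooth_fun A U f" "smooth_fun A U g"
  shows "smooth_fun A U (\<lambda>x. p (f x) (g x))"
  unfolding smooth_fun_def
proof
  fix c assume c: "c \<in> A"
  have "smooth_within (cmodel c) (cmap c ` (U \<inter> cdom c)) (\<lambda>z. p ((f \<circ> chart_inv c) z) ((g \<circ> chart_inv c) z))"
    by (rule smooth_within_bilinear[OF assms(1) chart_facts(1)[OF c] chart_image_open_Int[OF c assms(2)]])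
      (use assms(3,4) c in \<open>auto simp: smooth_fun_def o_def\<close>)
  then show "smooth_within (cmodel c) (cmap c ` (U \<inter> cdom c)) ((\<lambda>x. p (f x) (g x)) \<circ> chart_inv c)"
    by (simp add: o_def)
qed

lemma smooth_fun_add:
  assumes "open U" "smooth_fun A U f" "smooth_fun A U g"
  shows "smooth_fun A U (\<lambda>x. f x + g x)"
  unfolding smooth_fun_def
proof
  fix c assume c: "c \<in> A"
  have "smooth_within (cmodel c) (cmap c ` (U \<inter> cdom c)) (\<lambda>z. (f \<circ> chart_inv c) z + (g \<circ> chart_inv c) z)"
    by (rule smooth_within_add[OF chart_facts(1)[OF c] chart_image_open_Int[OF c assms(1)]])
      (use assms(2,3) c in \<open>auto simp: smooth_fun_def o_def\<close>)
  then show "smooth_within (cmodel c) (cmap c ` (U \<inter> cdom c)) ((\<lambda>x. f x + g x) \<circ> chart_inv c)"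
    by (simp add: o_def)
qed

lemma smooth_fun_compose:
  fixes f :: "'m \<Rightarrow> 'b::real_normed_vector"
  assumes "open U" "smooth_fun A U f" "f ` U \<subseteq> S'"
    and g: "smooth_within F' S' g" "subspace F'" "closed F'" "S' \<subseteq> F'"
  shows "smooth_fun A U (\<lambda>x. g (f x))"
  unfolding smooth_fun_def
proof
  fix c assume c: "c \<in> A"
  have "smooth_within (cmodel c) (cmap c ` (U \<inter> cdom c)) (\<lambda>z. g ((f \<circ> chart_inv c) z))"
    by (rule smooth_within_compose[OF chart_facts(1)[OF c] chart_image_open_Int[OF c assms(1)] _ _ g])
      (use assms(2,3) c in \<open>auto simp: smooth_fun_def o_def\<close>)
  then show "smooth_within (cmodel c) (cmap c ` (U \<inter> cdom c)) ((\<lambda>x. g (f x)) \<circ> chart_inv c)"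
    by (simp add: o_def)
qed

lemma smooth_fun_linear:
  assumes L: "bounded_linear L" and "open U" "smooth_fun A U f"
  shows "smooth_fun A U (\<lambda>x. L (f x))"
proof -
  have "bounded_bilinear (\<lambda>(r::real) v. r *\<^sub>R L v)"
    using bounded_bilinear.comp[OF bounded_bilinear_scaleR bounded_linear_ident L] by simp
  from smooth_fun_bilinear[OF this assms(2) smooth_fun_const[of U 1] assms(3)] show ?thesis by simp
qed

lemma smooth_fun_diff:
  assumes "open U" "smooth_fun A U f" "smooth_fun A U g"
  shows "smooth_fun A U (\<lambda>x. f x - g x)"
  using smooth_fun_add[OF assms(1,2) smooth_fun_linear[OF bounded_linear_minus[OF bounded_linear_ident] assms(1,3)]] by simp

lemma smooth_fun_cmap:
  assumes "c \<in> A" shows "smooth_fun A (cdom c) (cmap c)"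
  unfolding smooth_fun_def using transition_smooth[OF _ assms] by (simp add: Int_commute)

lemma smooth_fun_continuous:
  assumes "open U" "smooth_fun A U f"
  shows "continuous_on U f"
proof (rule continuous_at_imp_continuous_on, rule ballI)
  fix x assume x: "x \<in> U"
  obtain c where c: "c \<in> A" "x \<in> cdom c" by (rule chart_exists)
  have "continuous_on (cmap c ` (U \<inter> cdom c)) (f \<circ> chart_inv c)"
    using assms c by (intro smooth_within_continuous[OF _ chart_facts(1)[OF c(1)] chart_image_open_Int])
      (auto simp: smooth_fun_def)
  moreover have "continuous_on (U \<inter> cdom c) (cmap c)"
    using chart_facts(6)[OF c(1)] by (auto simp: homeomorphism_def intro: continuous_on_subset)
  ultimately have "continuous_on (U \<inter> cdom c) ((f \<circ> chart_inv c) \<circ> cmap c)"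
    by (rule continuous_on_compose[rotated])
  then have "continuous_on (U \<inter> cdom c) f"
    by (rule continuous_on_cong[THEN iffD1, rotated 2]) (use c in auto)
  then show "isCont f x"
    using assms(1) chart_facts(3)[OF c(1)] x c by (simp add: continuous_on_eq_continuous_at open_Int)
qed

subsection \<open>Vector fields\<close>

lemma chart_dirder:
  assumes "open V" "x \<in> V" "smooth_fun A V f" "c \<in> A" "x \<in> cdom c" "v \<in> cmodel c"
  shows "((\<lambda>t. f (chart_inv c (cmap c x + t *\<^sub>R v))) has_vector_derivative dirder v (f \<circ> chart_inv c) (cmap c x)) (at 0)"
  using smooth_within_dirder(3)[OF _ chart_facts(1)[OF assms(4)] chart_image_open_Int[OF assms(4,1)],
      of "f \<circ> chart_inv c" v "cmap c x"] assms
  by (simp add: smooth_fun_def)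

lemma dirder_chart_linear:
  assumes "open V" "x \<in> V" "smooth_fun A V f" "c \<in> A" "x \<in> cdom c" "v \<in> cmodel c" "w \<in> cmodel c"
  shows "dirder (a *\<^sub>R v + b *\<^sub>R w) (f \<circ> chart_inv c) (cmap c x) =
    a *\<^sub>R dirder v (f \<circ> chart_inv c) (cmap c x) + b *\<^sub>R dirder w (f \<circ> chart_inv c) (cmap c x)"
  by (rule dirder_linear[OF _ chart_facts(1)[OF assms(4)] chart_image_open_Int[OF assms(4,1)]])
    (use assms in \<open>auto simp: smooth_fun_def\<close>)

lemma rVectD:
  assumes "X \<in> rVect A U"
  shows "\<And>c x. c \<notin> A \<or> x \<notin> U \<inter> cdom c \<Longrightarrow> X c x = 0"
    and "\<And>c x. c \<in> A \<Longrightarrow> x \<in> cdom c \<Longrightarrow> X c x \<in> cmodel c"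
    and "\<And>c. c \<in> A \<Longrightarrow> smooth_within (cmodel c) (cmap c ` (U \<inter> cdom c)) (X c \<circ> chart_inv c)"
    and "\<And>c d x. c \<in> A \<Longrightarrow> d \<in> A \<Longrightarrow> x \<in> U \<Longrightarrow> x \<in> cdom c \<Longrightarrow> x \<in> cdom d \<Longrightarrow>
       X d x = dirder (X c x) (cmap d \<circ> chart_inv c) (cmap c x)"
proof -
  note X = assms[unfolded rVect_def mem_Collect_eq]
  show 1: "X c x = 0" if "c \<notin> A \<or> x \<notin> U \<inter> cdom c" for c x
    by (rule X[THEN conjunct1, rule_format, OF that])
  show "X c x \<in> cmodel c" if "c \<in> A" "x \<in> cdom c" for c x
  proof (cases "x \<in> U")
    case True
    then show ?thesis using X[THEN conjunct2, THEN conjunct1] that by blast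
  next
    case False
    then show ?thesis using 1[of c x] subspace_0[OF chart_facts(1)[OF that(1)]] by simp
  qed
  show "smooth_within (cmodel c) (cmap c ` (U \<inter> cdom c)) (X c \<circ> chart_inv c)" if "c \<in> A" for c
    by (rule X[THEN conjunct2, THEN conjunct2, THEN conjunct1, rule_format, OF that])
  show "X d x = dirder (X c x) (cmap d \<circ> chart_inv c) (cmap c x)"
    if "c \<in> A" "d \<in> A" "x \<in> U" "x \<in> cdom c" "x \<in> cdom d" for c d x
    unfolding dirder_def o_def
    by (rule X[THEN conjunct2, THEN conjunct2, THEN conjunct2, rule_format, OF that(1,2)]) (use that in blast)
qed

text \<open>The chart chosen in the definition of \<open>rvact\<close> is immaterial, because a vector field transforms with
  the derivative of the change of charts.\<close>

lemma rvact_chart: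
  assumes X: "X \<in> rVect A U" and x: "x \<in> U" and V: "open V" "x \<in> V" "smooth_fun A V f"
    and c: "c \<in> A" "x \<in> cdom c"
  shows "rvact A X f x = dirder (X c x) (f \<circ> chart_inv c) (cmap c x)"
proof -
  define c0 where "c0 = some_chart x"
  have c0: "c0 \<in> A" "x \<in> cdom c0" by (simp_all add: c0_def some_chart)
  let ?W = "V \<inter> cdom c"
  let ?h = "cmap c \<circ> chart_inv c0"
  have W: "open ?W" using V chart_facts(3)[OF c(1)] by auto
  have "dirder (X c0 x) (\<lambda>z. (f \<circ> chart_inv c) (?h z)) (cmap c0 x) =
      dirder (dirder (X c0 x) ?h (cmap c0 x)) (f \<circ> chart_inv c) (?h (cmap c0 x))"
  proof (rule dirder_compose[OF _ chart_facts(1)[OF c0(1)] chart_image_open_Int[OF c0(1) W] _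
        chart_facts(1)[OF c(1)] chart_image_open_Int[OF c(1) W]])
    show "smooth_within (cmodel c0) (cmap c0 ` (?W \<inter> cdom c0)) ?h"
      by (rule smooth_within_subset[OF transition_smooth[OF c0(1) c(1)]]) auto
    show "smooth_within (cmodel c) (cmap c ` (?W \<inter> cdom c)) (f \<circ> chart_inv c)"
      by (rule smooth_within_subset[of _ "cmap c ` (V \<inter> cdom c)"]) (use V c in \<open>auto simp: smooth_fun_def\<close>)
    show "?h ` cmap c0 ` (?W \<inter> cdom c0) \<subseteq> cmap c ` (?W \<inter> cdom c)" using c0 by auto
    show "X c0 x \<in> cmodel c0" by (rule rVectD(2)[OF X c0])
    show "cmap c0 x \<in> cmap c0 ` (?W \<inter> cdom c0)" using c c0 V by auto
  qed
  also have "dirder (X c0 x) ?h (cmap c0 x) = X c x" using rVectD(4)[OF X c0(1) c(1) x c0(2) c(2)] by simp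
  also have "?h (cmap c0 x) = cmap c x" using c0 by simp
  finally have 1: "dirder (X c0 x) (\<lambda>z. (f \<circ> chart_inv c) (?h z)) (cmap c0 x) = dirder (X c x) (f \<circ> chart_inv c) (cmap c x)" .
  have "dirder (X c0 x) (\<lambda>z. (f \<circ> chart_inv c) (?h z)) (cmap c0 x) = dirder (X c0 x) (f \<circ> chart_inv c0) (cmap c0 x)"
  proof -
    have "eventually (\<lambda>t. cmap c0 x + t *\<^sub>R X c0 x \<in> cmap c0 ` (?W \<inter> cdom c0)) (nhds 0)"
      by (rule eventually_line_in[OF chart_image_open_Int[OF c0(1) W] chart_facts(1)[OF c0(1)] _ rVectD(2)[OF X c0]])
        (use c c0 V in auto)
    then have "eventually (\<lambda>t. (f \<circ> chart_inv c) (?h (cmap c0 x + t *\<^sub>R X c0 x)) = (f \<circ> chart_inv c0) (cmap c0 x + t *\<^sub>R X c0 x)) (nhds 0)"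
      by eventually_elim (use c c0 in auto)
    then show ?thesis unfolding dirder_def by (intro vector_derivative_cong_eq) (auto simp: eventually_nhds_x_imp_x)
  qed
  moreover have "rvact A X f x = dirder (X c0 x) (f \<circ> chart_inv c0) (cmap c0 x)"
    by (simp add: rvact_def dirder_def c0_def some_chart_def Let_def)
  ultimately show ?thesis using 1 by simp
qed

text \<open>One curve serves all smooth functions, with values in any space; so the rules for \<open>rvact\<close> below are
  those for derivatives of functions of one real variable.\<close>

lemma vcurve:
  assumes X: "X \<in> rVect A U" and x: "x \<in> U"
  shows "vcurve A X x 0 = x"
    and "\<And>V. open V \<Longrightarrow> x \<in> V \<Longrightarrow> eventually (\<lambda>t. vcurve A X x t \<in> V) (nhds 0)"
    and "\<And>V f. open V \<Longrightarrow> x \<in> V \<Longrightarrow> smooth_fun A V f \<Longrightarrow>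
       ((\<lambda>t. f (vcurve A X x t)) has_vector_derivative rvact A X f x) (at 0)"
proof -
  define c0 where "c0 = some_chart x"
  have c0: "c0 \<in> A" "x \<in> cdom c0" by (simp_all add: c0_def some_chart)
  have vc: "vcurve A X x t = chart_inv c0 (cmap c0 x + t *\<^sub>R X c0 x)" for t
    by (simp add: vcurve_def c0_def some_chart_def Let_def)
  show "vcurve A X x 0 = x" using c0 by (simp add: vc)
  show "eventually (\<lambda>t. vcurve A X x t \<in> V) (nhds 0)" if "open V" "x \<in> V" for V
  proof -
    have "eventually (\<lambda>t. cmap c0 x + t *\<^sub>R X c0 x \<in> cmap c0 ` (V \<inter> cdom c0)) (nhds 0)"
      by (rule eventually_line_in[OF chart_image_open_Int[OF c0(1) that(1)] chart_facts(1)[OF c0(1)] _ rVectD(2)[OF X c0]])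
        (use c0 that in auto)
    then show ?thesis by eventually_elim (use c0 in \<open>auto simp: vc\<close>)
  qed
  show "((\<lambda>t. f (vcurve A X x t)) has_vector_derivative rvact A X f x) (at 0)"
    if "open V" "x \<in> V" "smooth_fun A V f" for V and f :: "'m \<Rightarrow> 'z::real_normed_vector"
    unfolding vc rvact_chart[OF X x that c0]
    by (rule chart_dirder[OF that c0 rVectD(2)[OF X c0]])
qed

end

section \<open>Complex Hilbert spaces\<close>

lemma cinner_add_right: "cinner x (y + z) = cinner x y + cinner x (z :: 'a::complex_hilbert)"
  using cinner_add_left[of y z x] by (metis cinner_commute complex_cnj_add)

lemma cinner_scaleC_right: "cinner x (a *\<^sub>C y) = cnj a * cinner x (y :: 'a::complex_hilbert)"
  using cinner_scaleC_left[of a y x] by (metis cinner_commute complex_cnj_mult)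

lemma cinner_scaleR_left: "cinner (r *\<^sub>R x) y = r *\<^sub>R cinner x (y :: 'a::complex_hilbert)"
  using cinner_scaleC_left[of "complex_of_real r" x y] by (simp add: scaleC_of_real scaleR_conv_of_real)

lemma cinner_scaleR_right: "cinner x (r *\<^sub>R y) = r *\<^sub>R cinner x (y :: 'a::complex_hilbert)"
  using cinner_scaleC_right[of x "complex_of_real r" y] by (simp add: scaleC_of_real scaleR_conv_of_real)

lemma scaleC_minus_one: "(-1) *\<^sub>C x = - (x :: 'a::complex_hilbert)"
  using scaleC_of_real[of "-1" x] by simp

lemma scaleC_one [simp]: "1 *\<^sub>C x = (x :: 'a::complex_hilbert)"
  using scaleC_of_real[of 1 x] by simp

lemma scaleC_zero_left [simp]: "0 *\<^sub>C x = (0 :: 'a::complex_hilbert)"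
  using scaleC_of_real[of 0 x] by simp

lemma scaleC_zero_right [simp]: "a *\<^sub>C 0 = (0 :: 'a::complex_hilbert)"
  using scaleC_add_right[of a 0 "0 :: 'a"] by simp

lemma cinner_minus_left: "cinner (- x) y = - cinner x (y :: 'a::complex_hilbert)"
  using cinner_scaleC_left[of "-1" x y] by (simp add: scaleC_minus_one)

lemma cinner_minus_right: "cinner x (- y) = - cinner x (y :: 'a::complex_hilbert)"
  using cinner_scaleC_right[of x "-1" y] by (simp add: scaleC_minus_one)

lemma cinner_diff_left: "cinner (x - y) z = cinner x z - cinner y (z :: 'a::complex_hilbert)"
  using cinner_add_left[of x "-y" z] by (simp add: cinner_minus_left)

lemma cinner_diff_right: "cinner x (y - z) = cinner x y - cinner x (z :: 'a::complex_hilbert)"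
  using cinner_add_right[of x y "-z"] by (simp add: cinner_minus_right)

lemma cinner_zero [simp]: "cinner 0 x = 0" "cinner x (0 :: 'a::complex_hilbert) = 0"
  using cinner_scaleC_left[of 0 x x] cinner_scaleC_right[of x 0 x] by simp_all

lemma norm_scaleC: "norm (a *\<^sub>C x) = cmod a * norm (x :: 'a::complex_hilbert)"
proof -
  have "complex_of_real ((norm (a *\<^sub>C x))\<^sup>2) = complex_of_real ((cmod a * norm x)\<^sup>2)"
    unfolding cinner_self[symmetric] cinner_scaleC_left cinner_scaleC_right
    by (simp add: cinner_self power_mult_distrib complex_norm_square mult.assoc[symmetric] del: of_real_power)
  then have "(norm (a *\<^sub>C x))\<^sup>2 = (cmod a * norm x)\<^sup>2" by (simp only: of_real_eq_iff)
  then show ?thesis by (simp add: power2_eq_iff_nonneg)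
qed

lemma Cauchy_Schwarz_cinner: "cmod (cinner x y) \<le> norm x * norm (y :: 'a::complex_hilbert)"
proof (cases "y = 0")
  case False
  define n where "n = (norm y)\<^sup>2"
  have n: "n > 0" using False by (simp add: n_def)
  define c where "c = cinner x y"
  define a where "a = c / complex_of_real n"
  have yx: "cinner y x = cnj c" unfolding c_def by (rule cinner_commute)
  have "complex_of_real ((norm (x - a *\<^sub>C y))\<^sup>2) = cinner x x - a * cinner y x - cnj a * cinner x y + a * cnj a * cinner y y"
    unfolding cinner_self[symmetric]
    by (simp add: cinner_diff_left cinner_diff_right cinner_scaleC_left cinner_scaleC_right algebra_simps)
  also have "\<dots> = complex_of_real ((norm x)\<^sup>2) - c * cnj c / complex_of_real n"
    using n by (simp add: yx c_def[symmetric] cinner_self n_def[symmetric] a_def field_simps del: of_real_power)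
  also have "\<dots> = complex_of_real ((norm x)\<^sup>2 - (cmod c)\<^sup>2 / n)"
    by (simp add: complex_norm_square[symmetric] del: of_real_power)
  finally have "(norm x)\<^sup>2 - (cmod c)\<^sup>2 / n = (norm (x - a *\<^sub>C y))\<^sup>2" by (simp only: of_real_eq_iff)
  then have "(cmod c)\<^sup>2 / n \<le> (norm x)\<^sup>2" by (metis diff_ge_0_iff_ge zero_le_power2)
  then have "(cmod c)\<^sup>2 \<le> (norm x * norm y)\<^sup>2"
    using n by (simp add: divide_le_eq n_def[symmetric] power_mult_distrib)
  then show ?thesis unfolding c_def by (rule power2_le_imp_le) simp
qed simp

lemma bounded_bilinear_scaleC: "bounded_bilinear (\<lambda>(a::complex) (x::'a::complex_hilbert). a *\<^sub>C x)"
proof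
  fix r :: real and a b :: complex and x y :: 'a
  show "(a + b) *\<^sub>C x = a *\<^sub>C x + b *\<^sub>C x" by (rule scaleC_add_left)
  show "a *\<^sub>C (x + y) = a *\<^sub>C x + a *\<^sub>C y" by (rule scaleC_add_right)
  show "(r *\<^sub>R a) *\<^sub>C x = r *\<^sub>R a *\<^sub>C x"
    using scaleC_scaleC[of "complex_of_real r" a x] by (simp add: scaleC_of_real scaleR_conv_of_real)
  show "a *\<^sub>C r *\<^sub>R x = r *\<^sub>R a *\<^sub>C x"
    using scaleC_scaleC[of "complex_of_real r" a x] scaleC_scaleC[of a "complex_of_real r" x]
    by (simp add: scaleC_of_real mult.commute)
  show "\<exists>K. \<forall>(a::complex) (x::'a). norm (a *\<^sub>C x) \<le> norm a * norm x * K"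
    by (intro exI[of _ 1]) (simp add: norm_scaleC)
qed

lemma bounded_bilinear_cinner: "bounded_bilinear (cinner :: 'a::complex_hilbert \<Rightarrow> 'a \<Rightarrow> complex)"
proof
  show "\<exists>K. \<forall>x y :: 'a. norm (cinner x y) \<le> norm x * norm y * K"
    by (intro exI[of _ 1]) (simp add: Cauchy_Schwarz_cinner)
qed (simp_all add: cinner_add_left cinner_add_right cinner_scaleR_left cinner_scaleR_right)

lemmas bounded_linear_scaleC = bounded_bilinear.bounded_linear_right[OF bounded_bilinear_scaleC]

lemma closed_csubspace_facts:
  assumes "closed_csubspace K"
  shows "closed K" "subspace K" "0 \<in> K" "\<And>x y. x \<in> K \<Longrightarrow> y \<in> K \<Longrightarrow> x + y \<in> K"
    "\<And>a x. x \<in> K \<Longrightarrow> a *\<^sub>C x \<in> K"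
proof -
  show K: "closed K" "0 \<in> K" "\<And>x y. x \<in> K \<Longrightarrow> y \<in> K \<Longrightarrow> x + y \<in> K" "\<And>a x. x \<in> K \<Longrightarrow> a *\<^sub>C x \<in> K"
    using assms by (auto simp: closed_csubspace_def)
  have "r *\<^sub>R x \<in> K" if "x \<in> K" for r :: real and x
    using K(4)[OF that, of "complex_of_real r"] by (simp add: scaleC_of_real)
  then show "subspace K" using K by (simp add: subspace_def)
qed

text \<open>The Hellinger-Toeplitz theorem, by the Baire category theorem: the sets of all \<open>y\<close> with
  \<open>\<bar>\<langle>y, L x\<rangle>\<bar> \<le> n\<close> for all \<open>x\<close> in the unit ball of \<open>K\<close> are closed and exhaust \<open>K\<close>, because
  \<open>\<langle>y, L x\<rangle> = \<langle>M y, x\<rangle>\<close>; so one of them contains a ball.\<close>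

lemma Hellinger_Toeplitz:
  fixes L M :: "'a::complex_hilbert \<Rightarrow> 'a"
  assumes K: "closed_csubspace K" and L: "\<And>x. x \<in> K \<Longrightarrow> L x \<in> K" and M: "\<And>x. x \<in> K \<Longrightarrow> M x \<in> K"
    and add: "\<And>x y. x \<in> K \<Longrightarrow> y \<in> K \<Longrightarrow> L (x + y) = L x + L y"
    and scale: "\<And>a x. x \<in> K \<Longrightarrow> L (a *\<^sub>C x) = a *\<^sub>C L x"
    and adj: "\<And>x y. x \<in> K \<Longrightarrow> y \<in> K \<Longrightarrow> cinner y (L x) = cinner (M y) x"
  shows "\<exists>C. \<forall>x\<in>K. norm (L x) \<le> C * norm x"
proof -
  note Kf = closed_csubspace_facts[OF K]
  define E where "E n = {y \<in> K. \<forall>x\<in>K. norm x \<le> 1 \<longrightarrow> cmod (cinner y (L x)) \<le> real n}" for n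
  have cl: "closed (E n)" for n
  proof -
    have "closed {y. cmod (cinner y (L x)) \<le> real n}" for x
    proof (rule closed_Collect_le[OF continuous_on_norm continuous_on_const])
      show "continuous_on UNIV (\<lambda>y. cinner y (L x))"
        by (rule linear_continuous_on[OF bounded_bilinear.bounded_linear_left[OF bounded_bilinear_cinner]])
    qed
    moreover have "E n = K \<inter> (\<Inter>x\<in>{x\<in>K. norm x \<le> 1}. {y. cmod (cinner y (L x)) \<le> real n})"
      by (auto simp: E_def)
    ultimately show ?thesis using Kf(1) by (auto intro: closed_Int closed_INT)
  qed
  have cover: "K \<subseteq> (\<Union>n. E n)"
  proof
    fix y assume y: "y \<in> K"
    obtain n :: nat where n: "norm (M y) \<le> real n" using real_arch_simple by blast
    have "cmod (cinner y (L x)) \<le> real n" if "x \<in> K" "norm x \<le> 1" for x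
    proof -
      have "cmod (cinner y (L x)) \<le> norm (M y) * norm x"
        unfolding adj[OF that(1) y] by (rule Cauchy_Schwarz_cinner)
      also have "\<dots> \<le> norm (M y) * 1" using that by (intro mult_left_mono) auto
      finally show ?thesis using n by simp
    qed
    then show "y \<in> (\<Union>n. E n)" using y by (auto simp: E_def)
  qed
  have "\<exists>n y r. r > 0 \<and> y \<in> K \<and> ball y r \<inter> K \<subseteq> E n"
  proof (rule ccontr)
    assume no: "\<not> ?thesis"
    have "top_of_set K interior_of \<Union>(range E) = {}"
    proof (rule Baire_category_alt)
      show "completely_metrizable_space (top_of_set K) \<or> locally_compact_space (top_of_set K) \<and> regular_space (top_of_set K)"
        using Kf(1) completely_metrizable_space_closedin completely_metrizable_space_euclidean closed_closedin by blast
      fix T assume "T \<in> range E"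
      then obtain n where T: "T = E n" by auto
      have "y \<notin> top_of_set K interior_of E n" for y
      proof
        assume "y \<in> top_of_set K interior_of E n"
        then obtain S where S: "openin (top_of_set K) S" "y \<in> S" "S \<subseteq> E n" by (auto simp: interior_of_def)
        then obtain O' where O: "open O'" "S = K \<inter> O'" by (auto simp: openin_open)
        then obtain r where "r > 0" "ball y r \<subseteq> O'" using S(2) by (auto simp: open_contains_ball)
        then have "r > 0 \<and> y \<in> K \<and> ball y r \<inter> K \<subseteq> E n" using S O by auto
        then show False using no by blast
      qed
      moreover have "closedin (top_of_set K) (E n)"
        using cl[of n] by (rule closed_subset[rotated]) (auto simp: E_def)
      ultimately show "closedin (top_of_set K) T \<and> top_of_set K interior_of T = {}" using T by auto
    qed simp
    moreover have "\<Union>(range E) = K" using cover by (auto simp: E_def)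
    ultimately show False using Kf(3) interior_of_topspace[of "top_of_set K"] by simp
  qed
  then obtain n y r where r: "r > 0" "y \<in> K" "ball y r \<inter> K \<subseteq> E n" by blast
  have unit: "norm (L x) \<le> 4 * real n / r" if x: "x \<in> K" "norm x \<le> 1" for x
  proof (cases "L x = 0")
    case False
    define z where "z = (r / (2 * norm (L x))) *\<^sub>R L x"
    have zK: "z \<in> K" using L[OF x(1)] Kf(2) by (simp add: z_def subspace_scale)
    have nz: "norm z = r / 2" using False r by (simp add: z_def)
    have "y + z \<in> E n" "y \<in> E n"
      using r nz zK Kf(4) by (auto intro!: subsetD[OF r(3)] simp: dist_norm)
    then have "cmod (cinner (y + z) (L x)) \<le> real n" "cmod (cinner y (L x)) \<le> real n"
      using x by (auto simp: E_def)
    then have "cmod (cinner z (L x)) \<le> 2 * real n"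
      using norm_triangle_ineq4[of "cinner (y + z) (L x)" "cinner y (L x)"] by (simp add: cinner_add_left)
    moreover have "cmod (cinner z (L x)) = r / 2 * norm (L x)"
      using r False by (simp add: z_def cinner_scaleR_left cinner_self power2_eq_square norm_mult del: of_real_mult)
    ultimately show ?thesis using r by (simp add: field_simps)
  qed (use r in simp)
  have "norm (L x) \<le> 4 * real n / r * norm x" if "x \<in> K" for x
  proof (cases "x = 0")
    case True
    have "L 0 = 0" using scale[OF Kf(3), of 0] by simp
    then show ?thesis using True by simp
  next
    case False
    let ?a = "complex_of_real (1 / norm x)"
    have "norm (L (?a *\<^sub>C x)) \<le> 4 * real n / r"
      using False by (intro unit Kf(5) that) (simp add: norm_scaleC norm_divide)
    then have "norm (L x) / norm x \<le> 4 * real n / r" by (simp add: scale[OF that] norm_scaleC norm_divide)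
    then show ?thesis using False by (simp add: divide_le_eq)
  qed
  then show ?thesis by blast
qed

section \<open>Real vector fields as derivations\<close>

context manifold
begin

lemma rVectI:
  assumes "\<And>c x. c \<notin> A \<or> x \<notin> U \<inter> cdom c \<Longrightarrow> X c x = 0"
    and "\<And>c x. c \<in> A \<Longrightarrow> x \<in> U \<Longrightarrow> x \<in> cdom c \<Longrightarrow> X c x \<in> cmodel c"
    and "\<And>c. c \<in> A \<Longrightarrow> smooth_within (cmodel c) (cmap c ` (U \<inter> cdom c)) (X c \<circ> chart_inv c)"
    and "\<And>c d x. c \<in> A \<Longrightarrow> d \<in> A \<Longrightarrow> x \<in> U \<Longrightarrow> x \<in> cdom c \<Longrightarrow> x \<in> cdom d \<Longrightarrow>
       X d x = dirder (X c x) (cmap d \<circ> chart_inv c) (cmap c x)"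
  shows "X \<in> rVect A U"
  unfolding rVect_def mem_Collect_eq
  apply (intro conjI ballI allI impI)
     apply (rule assms(1), assumption)
    apply (rule assms(2); blast)
   apply (rule assms(3), assumption)
  apply (rule assms(4)[unfolded dirder_def o_def]; blast)
  done

text \<open>The transformation law of tangent vectors is linear.\<close>

lemma rVect_comb:
  assumes U: "open U" and X: "X \<in> rVect A U" "Y \<in> rVect A U" and ab: "smooth_fun A U a" "smooth_fun A U b"
  shows "(\<lambda>c x. a x *\<^sub>R X c x + b x *\<^sub>R Y c x) \<in> rVect A U"
proof (rule rVectI)
  show "a x *\<^sub>R X c x + b x *\<^sub>R Y c x = 0" if "c \<notin> A \<or> x \<notin> U \<inter> cdom c" for c x
    using rVectD(1)[OF X(1) that] rVectD(1)[OF X(2) that] by simp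
  show "a x *\<^sub>R X c x + b x *\<^sub>R Y c x \<in> cmodel c" if "c \<in> A" "x \<in> cdom c" for c x
    using rVectD(2)[OF X(1) that] rVectD(2)[OF X(2) that] chart_facts(1)[OF that(1)]
    by (simp add: subspace_add subspace_scale)
  show "smooth_within (cmodel c) (cmap c ` (U \<inter> cdom c)) ((\<lambda>x. a x *\<^sub>R X c x + b x *\<^sub>R Y c x) \<circ> chart_inv c)"
    if c: "c \<in> A" for c
  proof -
    note F = chart_facts(1)[OF c] chart_image_open_Int[OF c U]
    have s: "smooth_within (cmodel c) (cmap c ` (U \<inter> cdom c)) (a \<circ> chart_inv c)"
        "smooth_within (cmodel c) (cmap c ` (U \<inter> cdom c)) (b \<circ> chart_inv c)"
      using ab c by (simp_all add: smooth_fun_def)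
    show ?thesis
      using smooth_within_add[OF F smooth_within_bilinear[OF bounded_bilinear_scaleR F s(1) rVectD(3)[OF X(1) c]]
          smooth_within_bilinear[OF bounded_bilinear_scaleR F s(2) rVectD(3)[OF X(2) c]]]
      by (simp add: o_def)
  qed
  show "a x *\<^sub>R X d x + b x *\<^sub>R Y d x =
      dirder (a x *\<^sub>R X c x + b x *\<^sub>R Y c x) (cmap d \<circ> chart_inv c) (cmap c x)"
    if c: "c \<in> A" "d \<in> A" "x \<in> U" "x \<in> cdom c" "x \<in> cdom d" for c d x
    using dirder_chart_linear[OF chart_facts(3)[OF c(2)] c(5) smooth_fun_cmap[OF c(2)] c(1,4)
        rVectD(2)[OF X(1) c(1,4)] rVectD(2)[OF X(2) c(1,4)]]
      rVectD(4)[OF X(1) c] rVectD(4)[OF X(2) c] by simp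
qed

lemma rVect_local:
  assumes zero: "\<And>c x. c \<notin> A \<or> x \<notin> U \<inter> cdom c \<Longrightarrow> X c x = 0"
    and loc: "\<And>x. x \<in> U \<Longrightarrow> \<exists>W Y. open W \<and> x \<in> W \<and> Y \<in> rVect A W \<and> (\<forall>c. \<forall>y\<in>W. X c y = Y c y)"
  shows "X \<in> rVect A U"
proof (rule rVectI[OF zero])
  show "X c x \<in> cmodel c" if "c \<in> A" "x \<in> U" "x \<in> cdom c" for c x
    using loc[OF that(2)] rVectD(2) that by metis
  show "X d x = dirder (X c x) (cmap d \<circ> chart_inv c) (cmap c x)"
    if c: "c \<in> A" "d \<in> A" "x \<in> U" "x \<in> cdom c" "x \<in> cdom d" for c d x
  proof -
    obtain W Y where "x \<in> W" "Y \<in> rVect A W" "\<forall>c. \<forall>y\<in>W. X c y = Y c y" using loc[OF c(3)] by blast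
    then show ?thesis using rVectD(4)[of Y W c d x] c by simp
  qed
  show "smooth_within (cmodel c) (cmap c ` (U \<inter> cdom c)) (X c \<circ> chart_inv c)" if c: "c \<in> A" for c
  proof (rule smooth_within_local[OF chart_facts(1)[OF c]])
    fix z assume "z \<in> cmap c ` (U \<inter> cdom c)"
    then obtain x where x: "x \<in> U" "x \<in> cdom c" "z = cmap c x" by auto
    obtain W Y where W: "open W" "x \<in> W" "Y \<in> rVect A W" "\<forall>c. \<forall>y\<in>W. X c y = Y c y" using loc[OF x(1)] by blast
    have "smooth_within (cmodel c) (cmap c ` (W \<inter> cdom c)) (X c \<circ> chart_inv c)"
      by (rule smooth_within_cong[THEN iffD1, OF _ rVectD(3)[OF W(3) c]]) (use W c in auto)
    then show "\<exists>O'. openin (top_of_set (cmodel c)) O' \<and> z \<in> O' \<and> smooth_within (cmodel c) O' (X c \<circ> chart_inv c)"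
      using chart_image_open_Int[OF c W(1)] x W by blast
  qed
qed

lemma rVect_zero: "(\<lambda>c x. 0) \<in> rVect A U"
proof (rule rVectI)
  show "0 \<in> cmodel c" if "c \<in> A" for c using subspace_0[OF chart_facts(1)[OF that]] .
  show "smooth_within (cmodel c) (cmap c ` (U \<inter> cdom c)) ((\<lambda>x. 0) \<circ> chart_inv c)" if "c \<in> A" for c
    unfolding o_def by (intro smooth_within_const chart_facts that)
qed (simp_all add: dirder_def)

lemma rVect_restrict:
  assumes X: "X \<in> rVect A U" and V: "open V" "V \<subseteq> U"
  shows "(\<lambda>c x. if x \<in> V then X c x else 0) \<in> rVect A V"
proof (rule rVectI)
  show "(if x \<in> V then X c x else 0) = 0" if "c \<notin> A \<or> x \<notin> V \<inter> cdom c" for c x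
    using rVectD(1)[OF X, of c x] that V by auto
  show "(if x \<in> V then X c x else 0) \<in> cmodel c" if "c \<in> A" "x \<in> V" "x \<in> cdom c" for c x
    using rVectD(2)[OF X that(1,3)] that by simp
  show "smooth_within (cmodel c) (cmap c ` (V \<inter> cdom c)) ((\<lambda>x. if x \<in> V then X c x else 0) \<circ> chart_inv c)"
    if c: "c \<in> A" for c
  proof -
    have "smooth_within (cmodel c) (cmap c ` (V \<inter> cdom c)) (X c \<circ> chart_inv c)"
      by (rule smooth_within_subset[OF rVectD(3)[OF X c]]) (use V in auto)
    then show ?thesis by (rule smooth_within_cong[THEN iffD1, rotated]) (use c in auto)
  qed
  show "(if x \<in> V then X d x else 0) = dirder (if x \<in> V then X c x else 0) (cmap d \<circ> chart_inv c) (cmap c x)"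
    if "c \<in> A" "d \<in> A" "x \<in> V" "x \<in> cdom c" "x \<in> cdom d" for c d x
    using rVectD(4)[OF X that(1,2) _ that(4,5)] that V by auto
qed

lemma rVect_extend:
  assumes X: "X \<in> rVect A U" and U: "open U" and \<theta>: "smooth_fun A UNIV \<theta>"
    and C: "closed C" "C \<subseteq> U" "\<And>x. x \<notin> C \<Longrightarrow> \<theta> x = 0"
  shows "(\<lambda>c x. \<theta> x *\<^sub>R X c x) \<in> rVect A UNIV"
proof (rule rVect_local)
  show "\<theta> x *\<^sub>R X c x = 0" if "c \<notin> A \<or> x \<notin> UNIV \<inter> cdom c" for c x
    using rVectD(1)[OF X, of c x] that by auto
  fix x
  show "\<exists>W Y. open W \<and> x \<in> W \<and> Y \<in> rVect A W \<and> (\<forall>c. \<forall>y\<in>W. \<theta> y *\<^sub>R X c y = Y c y)"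
  proof (cases "x \<in> U")
    case True
    have "(\<lambda>c x. \<theta> x *\<^sub>R X c x + 0 *\<^sub>R X c x) \<in> rVect A U"
      by (rule rVect_comb[OF U X X smooth_fun_subset[OF \<theta>] smooth_fun_const]) simp
    then show ?thesis using True U by (intro exI[of _ U] exI) auto
  next
    case False
    then show ?thesis using C rVect_zero[of "- C"] by (intro exI[of _ "- C"] exI[of _ "\<lambda>c x. 0"]) auto
  qed
qed

lemma rvact_some_chart: "rvact A X f x = dirder (X (some_chart x) x) (f \<circ> chart_inv (some_chart x)) (cmap (some_chart x) x)"
  by (simp add: rvact_def dirder_def some_chart_def Let_def)

lemma rvact_pointwise: "(\<And>c. X c x = Y c x) \<Longrightarrow> rvact A X f x = rvact A Y f x"
  by (simp add: rvact_some_chart)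

lemma rvact_comb:
  assumes X: "X \<in> rVect A U" "Y \<in> rVect A U'" and V: "open V" "x \<in> V" "smooth_fun A V f"
    and Z: "\<And>c. Z c x = a *\<^sub>R X c x + b *\<^sub>R Y c x"
  shows "rvact A Z f x = a *\<^sub>R rvact A X f x + b *\<^sub>R rvact A Y f x"
  unfolding rvact_some_chart Z
  by (rule dirder_chart_linear[OF V some_chart rVectD(2)[OF X(1) some_chart] rVectD(2)[OF X(2) some_chart]])

lemma rvact_zero: "(\<And>c. X c x = 0) \<Longrightarrow> rvact A X f x = 0"
  by (simp add: rvact_some_chart dirder_def)

lemma rvact_eqI:
  assumes "((\<lambda>t. f (vcurve A X x t)) has_vector_derivative l) (at 0)"
  shows "rvact A X f x = l"
  unfolding rvact_vcurve using assms by (rule vector_derivative_at)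

lemma rvact_cong:
  assumes X: "X \<in> rVect A U" "x \<in> U" and V: "open V" "x \<in> V" "\<And>y. y \<in> V \<Longrightarrow> f y = g y"
  shows "rvact A X f x = rvact A X g x"
proof -
  have "eventually (\<lambda>t. f (vcurve A X x t) = g (vcurve A X x t)) (nhds 0)"
    using vcurve(2)[OF X V(1,2)] by eventually_elim (rule V(3))
  then show ?thesis unfolding rvact_vcurve by (intro vector_derivative_cong_eq) (auto simp: eventually_nhds_x_imp_x)
qed

lemma rvact_const: "rvact A X (\<lambda>x. c) x = 0"
  by (simp add: rvact_vcurve)

lemma rvact_add:
  assumes X: "X \<in> rVect A U" "x \<in> U" and V: "open V" "x \<in> V" "smooth_fun A V f" "smooth_fun A V g"
  shows "rvact A X (\<lambda>y. f y + g y) x = rvact A X f x + rvact A X g x"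
  by (intro rvact_eqI has_vector_derivative_add vcurve(3)[OF X V(1,2)] V)

lemma rvact_bilinear:
  assumes p: "bounded_bilinear p" and X: "X \<in> rVect A U" "x \<in> U"
    and V: "open V" "x \<in> V" "smooth_fun A V f" "smooth_fun A V g"
  shows "rvact A X (\<lambda>y. p (f y) (g y)) x = p (f x) (rvact A X g x) + p (rvact A X f x) (g x)"
proof (rule rvact_eqI)
  show "((\<lambda>t. p (f (vcurve A X x t)) (g (vcurve A X x t))) has_vector_derivative
      p (f x) (rvact A X g x) + p (rvact A X f x) (g x)) (at 0)"
    using bounded_bilinear.has_vector_derivative[OF p vcurve(3)[OF X V(1-3)] vcurve(3)[OF X V(1,2,4)]] vcurve(1)[OF X]
    by simp
qed

lemma rvact_linear:
  assumes L: "bounded_linear L" and X: "X \<in> rVect A U" "x \<in> U"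
    and V: "open V" "x \<in> V" "smooth_fun A V f"
  shows "rvact A X (\<lambda>y. L (f y)) x = L (rvact A X f x)"
  by (intro rvact_eqI bounded_linear.has_vector_derivative[OF L] vcurve(3)[OF X V(1,2)] V)

lemma rvact_closed:
  assumes X: "X \<in> rVect A U" "x \<in> U" and V: "open V" "x \<in> V" "smooth_fun A V f"
    and K: "closed K" "subspace K" "\<And>y. y \<in> V \<Longrightarrow> f y \<in> K"
  shows "rvact A X f x \<in> K"
proof -
  let ?c = "some_chart x"
  show ?thesis unfolding rvact_some_chart
    by (rule smooth_within_dirder_closed[OF _ chart_facts(1) chart_image_open_Int[OF _ V(1), of ?c] K(1,2)])
      (use V K some_chart rVectD(2)[OF X(1)] in \<open>auto simp: smooth_fun_def\<close>)
qed

text \<open>In a chart the derivative along \<open>X\<close> is the sum of the components of \<open>X\<close> times partial derivatives.\<close>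

lemma rvact_smooth:
  assumes U: "open U" and X: "X \<in> rVect A U" and f: "smooth_fun A U f"
  shows "smooth_fun A U (rvact A X f)"
  unfolding smooth_fun_def
proof
  fix c assume c: "c \<in> A"
  note F = chart_facts(1)[OF c] chart_image_open_Int[OF c U]
  let ?S = "cmap c ` (U \<inter> cdom c)"
  obtain B where B: "frame_of (cmodel c) B" using frame_exists F by blast
  have fc: "smooth_within (cmodel c) ?S (f \<circ> chart_inv c)" using f c by (simp add: smooth_fun_def)
  have "smooth_within (cmodel c) ?S (\<lambda>z. \<Sum>b\<in>B. ((X c \<circ> chart_inv c) z \<bullet> b) *\<^sub>R dirder b (f \<circ> chart_inv c) z)"
  proof (intro smooth_within_sum F)
    fix b assume "b \<in> B"
    then have "b \<in> cmodel c" using B by (auto simp: frame_of_def)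
    then show "smooth_within (cmodel c) ?S (\<lambda>z. ((X c \<circ> chart_inv c) z \<bullet> b) *\<^sub>R dirder b (f \<circ> chart_inv c) z)"
      by (intro smooth_within_bilinear[OF bounded_bilinear_scaleR F]
          smooth_within_linear_comp[OF bounded_linear_inner_left F rVectD(3)[OF X c]] smooth_within_dirder(1)[OF fc F])
  qed
  moreover have "(\<Sum>b\<in>B. ((X c \<circ> chart_inv c) z \<bullet> b) *\<^sub>R dirder b (f \<circ> chart_inv c) z) = (rvact A X f \<circ> chart_inv c) z"
    if "z \<in> ?S" for z
  proof -
    obtain x where x: "x \<in> U" "x \<in> cdom c" "z = cmap c x" using \<open>z \<in> ?S\<close> by auto
    have "dirder (X c x) (f \<circ> chart_inv c) z = (\<Sum>b\<in>B. (X c x \<bullet> b) *\<^sub>R dirder b (f \<circ> chart_inv c) z)"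
      by (rule dirder_sum[OF fc F B rVectD(2)[OF X c x(2)]]) (use that in auto)
    moreover have "rvact A X f x = dirder (X c x) (f \<circ> chart_inv c) z"
      using rvact_chart[OF X x(1) U x(1) f c x(2)] x by simp
    ultimately show ?thesis using c x by simp
  qed
  ultimately show "smooth_within (cmodel c) ?S (rvact A X f \<circ> chart_inv c)"
    by (rule smooth_within_cong[THEN iffD1, rotated])
qed

end

section \<open>Cutoff functions\<close>

text \<open>The functions \<open>t\<^sup>-\<^sup>n exp(-1/t)\<close>, extended by zero to \<open>t \<le> 0\<close>: the derivative of one is a linear
  combination of two others.\<close>

definition flat_exp :: "nat \<Rightarrow> real \<Rightarrow> real" where
  "flat_exp n t = (if t > 0 then exp (- inverse t) * inverse t ^ n else 0)"

lemma power_le_fact_exp: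
  fixes x :: real
  assumes "0 \<le> x"
  shows "x ^ k \<le> fact k * exp x"
proof -
  have "(\<Sum>n\<in>{k}. inverse (fact n) * x ^ n) \<le> (\<Sum>n. inverse (fact n) * x ^ n)"
    using assms summable_exp[of x] by (intro sum_le_suminf) auto
  then have "inverse (fact k) * x ^ k \<le> exp x" by (simp add: exp_def)
  then show ?thesis by (simp add: field_simps)
qed

text \<open>A quadratic bound, which makes the derivative at \<open>0\<close> vanish.\<close>

lemma flat_exp_le: "\<bar>flat_exp n t\<bar> \<le> fact (n + 2) * t\<^sup>2"
proof (cases "t > 0")
  case True
  have "inverse t ^ (n + 2) \<le> fact (n + 2) * exp (inverse t)"
    using True by (intro power_le_fact_exp) simp
  then have "exp (- inverse t) * inverse t ^ (n + 2) \<le> exp (- inverse t) * (fact (n + 2) * exp (inverse t))"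
    by (intro mult_left_mono) auto
  also have "\<dots> = fact (n + 2)" by (simp add: exp_minus field_simps)
  finally have "t\<^sup>2 * (exp (- inverse t) * inverse t ^ (n + 2)) \<le> t\<^sup>2 * fact (n + 2)"
    by (intro mult_left_mono) auto
  moreover have "t\<^sup>2 * (exp (- inverse t) * inverse t ^ (n + 2)) = flat_exp n t"
    using True by (simp add: flat_exp_def power_add power2_eq_square field_simps)
  moreover have "flat_exp n t \<ge> 0" using True by (simp add: flat_exp_def)
  ultimately show ?thesis by (simp add: mult.commute)
qed (simp add: flat_exp_def)

lemma flat_exp_has_derivative:
  "(flat_exp n has_real_derivative (- real n) * flat_exp (n + 1) t + flat_exp (n + 2) t) (at t)"
proof -
  consider "t > 0" | "t < 0" | "t = 0" by linarith
  then show ?thesis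
  proof cases
    case 1
    have "((\<lambda>t. exp (- inverse t) * inverse t ^ n) has_real_derivative (- real n) * flat_exp (n + 1) t + flat_exp (n + 2) t) (at t)"
    proof -
      have "real n * inverse t ^ (n - 1) * (inverse t * inverse t) = real n * inverse t ^ (n + 1)"
        by (cases n) (auto simp: mult_ac)
      then show ?thesis
        using 1 by (auto intro!: derivative_eq_intros simp: flat_exp_def power2_eq_square algebra_simps)
    qed
    then show ?thesis
      by (rule has_field_derivative_transform_within_open[of _ _ _ "{0<..}"]) (use 1 in \<open>auto simp: flat_exp_def\<close>)
  next
    case 2
    have "((\<lambda>t. 0) has_real_derivative 0) (at t)" by simp
    then have "(flat_exp n has_real_derivative 0) (at t)"
      by (rule has_field_derivative_transform_within_open[of _ _ _ "{..<0}"]) (use 2 in \<open>auto simp: flat_exp_def\<close>)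
    then show ?thesis using 2 by (simp add: flat_exp_def)
  next
    case 3
    have "(flat_exp n has_derivative (\<lambda>h. 0)) (at 0)"
      unfolding has_derivative_within_alt
    proof (intro conjI allI impI bounded_linear_zero)
      fix e :: real assume e: "e > 0"
      define C where "C = (fact (n + 2) :: real)"
      have C: "C > 0" by (simp add: C_def)
      have "norm (flat_exp n y - flat_exp n 0 - 0) \<le> e * norm (y - 0)" if y: "norm (y - 0) < e / C" for y
      proof -
        have "\<bar>flat_exp n y\<bar> \<le> (C * \<bar>y\<bar>) * \<bar>y\<bar>" using flat_exp_le[of n y, folded C_def] by (simp add: power2_eq_square)
        also have "\<dots> \<le> e * \<bar>y\<bar>" using y C by (intro mult_right_mono) (simp_all add: field_simps)
        finally show ?thesis by (simp add: flat_exp_def)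
      qed
      then show "\<exists>d>0. \<forall>y\<in>UNIV. norm (y - 0) < d \<longrightarrow> norm (flat_exp n y - flat_exp n 0 - 0) \<le> e * norm (y - 0)"
        using e C by (intro exI[of _ "e / C"]) auto
    qed
    then show ?thesis using 3 by (simp add: has_field_derivative_def flat_exp_def lambda_zero)
  qed
qed

lemma frame_of_real: "frame_of (UNIV :: real set) {1}"
  by (simp add: frame_of_def)

lemma smooth_within_real_hull:
  fixes G :: "(real \<Rightarrow> real) set"
  assumes "\<And>u. u \<in> G \<Longrightarrow> \<exists>d\<in>lin_hull G. \<forall>t\<in>S. (u has_real_derivative d t) (at t)" "u \<in> G"
  shows "smooth_within UNIV S u"
proof (rule smooth_withinI_hull[OF frame_of_real, of G])
  fix u assume "u \<in> G"
  then obtain d where d: "d \<in> lin_hull G" "\<And>t. t \<in> S \<Longrightarrow> (u has_real_derivative d t) (at t)" using assms(1) by blast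
  have "(u has_derivative (\<lambda>h. \<Sum>b\<in>{1}. (h \<bullet> b) *\<^sub>R d t)) (at t within S)" if "t \<in> S" for t
  proof -
    have "(u has_derivative (\<lambda>h. h * d t)) (at t)"
      using d(2)[OF that] by (simp add: has_field_derivative_def mult_commute_abs)
    then show ?thesis by (auto intro: has_derivative_at_withinI)
  qed
  then show "\<exists>d. (\<forall>b\<in>{1}. d b \<in> lin_hull G) \<and>
      (\<forall>x\<in>S. (u has_derivative (\<lambda>h. \<Sum>b\<in>{1}. (h \<bullet> b) *\<^sub>R d b x)) (at x within S))"
    using d(1) by (intro exI[of _ "\<lambda>_. d"]) auto
qed (rule lin_hull.base[OF assms(2)])

lemma smooth_flat_exp: "smooth_within UNIV UNIV (flat_exp 0)"
proof (rule smooth_within_real_hull[of "range flat_exp"])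
  fix u assume "u \<in> range flat_exp"
  then obtain n where u: "u = flat_exp n" by auto
  have "(\<lambda>t. (- real n) *\<^sub>R flat_exp (n + 1) t + flat_exp (n + 2) t) \<in> lin_hull (range flat_exp)"
    by (intro lin_hull.add lin_hull.scale lin_hull.base) auto
  then show "\<exists>d\<in>lin_hull (range flat_exp). \<forall>t\<in>UNIV. (u has_real_derivative d t) (at t)"
    using flat_exp_has_derivative[of n] u by (intro bexI) auto
qed simp

lemma smooth_inverse: "smooth_within UNIV {0<..} (inverse :: real \<Rightarrow> real)"
proof (rule smooth_within_real_hull[of "range (\<lambda>n t. inverse t ^ Suc n)"])
  fix u :: "real \<Rightarrow> real" assume "u \<in> range (\<lambda>n t. inverse t ^ Suc n)"
  then obtain n where u: "u = (\<lambda>t. inverse t ^ Suc n)" by auto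
  have "(\<lambda>t. (- real (Suc n)) *\<^sub>R inverse t ^ Suc (Suc n)) \<in> lin_hull (range (\<lambda>n t. inverse t ^ Suc n))"
    by (intro lin_hull.scale lin_hull.base range_eqI[of _ _ "Suc n"]) simp
  moreover have "(u has_real_derivative (- real (Suc n)) *\<^sub>R inverse t ^ Suc (Suc n)) (at t)" if "t > 0" for t
    unfolding u using DERIV_power[OF DERIV_inverse[of t UNIV], of "Suc n"] that by (simp add: algebra_simps)
  ultimately show "\<exists>d\<in>lin_hull (range (\<lambda>n t. inverse t ^ Suc n)). \<forall>t\<in>{0<..}. (u has_real_derivative d t) (at t)"
    by (intro bexI) auto
next
  show "inverse \<in> range (\<lambda>n (t::real). inverse t ^ Suc n)" by (rule range_eqI[of _ _ 0]) auto
qed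

context manifold
begin

text \<open>With \<open>q\<close> the squared distance from \<open>x\<close> in a chart, scaled by the radius \<open>r\<close> of a ball inside the chart,
  and \<open>e(t) = exp(-1/t)\<close>, the function \<open>e(1 - q) / (e(1 - q) + e(q - 1/4))\<close> is \<open>1\<close> for \<open>q \<le> 1/4\<close> and \<open>0\<close> for \<open>q \<ge> 1\<close>.
  The preimage of the closed ball is compact, hence closed in \<open>N\<close>, so the extension by zero is smooth.\<close>

lemma bump_exists:
  assumes W: "open W" "x \<in> W"
  obtains \<theta> C V where "smooth_fun A UNIV (\<theta> :: 'm \<Rightarrow> real)" "closed C" "C \<subseteq> W" "\<And>y. y \<notin> C \<Longrightarrow> \<theta> y = 0"
    "open V" "x \<in> V" "V \<subseteq> C" "\<And>y. y \<in> V \<Longrightarrow> \<theta> y = 1"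
proof -
  obtain c where c: "c \<in> A" "x \<in> cdom c" by (rule chart_exists)
  let ?z0 = "cmap c x"
  let ?S = "cmap c ` (W \<inter> cdom c)"
  note hom = chart_facts(6)[OF c(1)]
  obtain r where r: "r > 0" "cball ?z0 r \<inter> cmodel c \<subseteq> ?S"
    using chart_image_open_Int[OF c(1) W(1)] c W unfolding openin_contains_cball by blast
  define C where "C = chart_inv c ` (cball ?z0 r \<inter> cmodel c)"
  have Csub: "C \<subseteq> W \<inter> cdom c" using r(2) c by (auto simp: C_def)
  have "compact (cball ?z0 r \<inter> cmodel c)" by (intro compact_Int_closed compact_cball chart_facts(2) c)
  moreover have "continuous_on (cball ?z0 r \<inter> cmodel c) (chart_inv c)"
    using hom r(2) by (auto simp: homeomorphism_def intro: continuous_on_subset)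
  ultimately have "closed C" unfolding C_def by (intro compact_imp_closed compact_continuous_image)
  define q where "q y = (cmap c y - ?z0) \<bullet> (cmap c y - ?z0) / r\<^sup>2" for y
  have q: "q y = (norm (cmap c y - ?z0) / r)\<^sup>2" for y by (simp add: q_def power_divide power2_norm_eq_inner)
  have smq: "smooth_fun A (cdom c) q"
  proof -
    have "smooth_fun A (cdom c) (\<lambda>y. cmap c y - ?z0)"
      by (intro smooth_fun_diff chart_facts(3) smooth_fun_cmap smooth_fun_const c)
    then have "smooth_fun A (cdom c) (\<lambda>y. (1 / r\<^sup>2) *\<^sub>R ((cmap c y - ?z0) \<bullet> (cmap c y - ?z0)))"
      by (intro smooth_fun_bilinear[OF bounded_bilinear_scaleR] smooth_fun_bilinear[OF bounded_bilinear_inner]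
          chart_facts(3) smooth_fun_const c)
    then show ?thesis by (simp add: q_def[abs_def])
  qed
  let ?N = "\<lambda>y. flat_exp 0 (1 - q y)" and ?M = "\<lambda>y. flat_exp 0 (q y - 1 / 4)"
  have pos: "?N y + ?M y > 0" for y by (auto simp: flat_exp_def add_pos_pos)
  define \<theta> where "\<theta> y = (if y \<in> cdom c then ?N y * inverse (?N y + ?M y) else 0)" for y
  have smN: "smooth_fun A (cdom c) ?N" "smooth_fun A (cdom c) ?M"
    by (intro smooth_fun_compose[OF _ _ _ smooth_flat_exp] smooth_fun_diff chart_facts(3) smooth_fun_const smq c; simp)+
  have sm1: "smooth_fun A (cdom c) \<theta>"
  proof -
    have "smooth_fun A (cdom c) (\<lambda>y. ?N y * inverse (?N y + ?M y))"
      by (intro smooth_fun_bilinear[OF bounded_bilinear_mult] smooth_fun_compose[OF _ _ _ smooth_inverse]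
          smooth_fun_add chart_facts(3) smN c) (use pos in auto)
    then show ?thesis by (rule smooth_fun_cong[THEN iffD1, rotated]) (simp add: \<theta>_def)
  qed
  have zero: "\<theta> y = 0" if "y \<notin> C" for y
  proof (cases "y \<in> cdom c")
    case True
    have "cmap c y \<in> cmodel c" using openin_imp_subset[OF chart_facts(5)[OF c(1)]] True by auto
    then have "cmap c y \<notin> cball ?z0 r" using that True c(1) unfolding C_def
      by (metis IntI chart_inv_cmap image_eqI)
    then have "norm (cmap c y - ?z0) / r > 1" using r(1) by (simp add: dist_norm norm_minus_commute)
    then have "q y > 1" unfolding q by (rule one_less_power) simp
    then show ?thesis by (simp add: \<theta>_def flat_exp_def)
  qed (simp add: \<theta>_def)
  have "smooth_fun A UNIV \<theta>"
  proof (rule smooth_fun_local)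
    fix y :: 'm
    show "\<exists>W. open W \<and> y \<in> W \<and> smooth_fun A W \<theta>"
    proof (cases "y \<in> C")
      case True
      then show ?thesis using sm1 Csub chart_facts(3)[OF c(1)] by blast
    next
      case False
      have "smooth_fun A (- C) \<theta>"
        by (rule smooth_fun_cong[THEN iffD1, OF _ smooth_fun_const[of "- C" 0]]) (simp add: zero)
      then show ?thesis using False \<open>closed C\<close> by blast
    qed
  qed
  moreover define V where "V = {y \<in> cdom c. cmap c y \<in> cmodel c \<inter> ball ?z0 (r / 2)}"
  have "open V" unfolding V_def by (intro chart_preimage_open c openin_open_Int open_ball)
  moreover have "cmap c x \<in> cmodel c" using openin_imp_subset[OF chart_facts(5)[OF c(1)]] c by auto
  then have "x \<in> V" using c r by (simp add: V_def)
  moreover have "V \<subseteq> C"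
  proof
    fix y assume y: "y \<in> V"
    then have "cmap c y \<in> cball ?z0 r \<inter> cmodel c" using r by (auto simp: V_def)
    then have "chart_inv c (cmap c y) \<in> C" unfolding C_def by blast
    then show "y \<in> C" using y c by (simp add: V_def)
  qed
  moreover have "\<theta> y = 1" if "y \<in> V" for y
  proof -
    have "norm (cmap c y - ?z0) / r < 1 / 2" using that r(1) by (simp add: V_def dist_norm norm_minus_commute field_simps)
    then have "q y < (1 / 2)\<^sup>2" unfolding q using r(1) by (intro power_strict_mono) auto
    then show ?thesis using that by (simp add: \<theta>_def V_def flat_exp_def power2_eq_square)
  qed
  ultimately show thesis using that \<open>closed C\<close> Csub zero by blast
qed

lemma VectD: "X \<in> Vect A U \<Longrightarrow> fst X \<in> rVect A U \<and> snd X \<in> rVect A U"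
  by (auto simp: Vect_def)

lemma Vect_extension:
  assumes "X \<in> Vect A U" "open U" "x \<in> U"
  obtains Y W where "Y \<in> Vect A UNIV" "open W" "x \<in> W" "W \<subseteq> U" "vagree W Y X"
proof -
  obtain \<theta> C V where t: "smooth_fun A UNIV (\<theta> :: 'm \<Rightarrow> real)" "closed C" "C \<subseteq> U" "\<And>y. y \<notin> C \<Longrightarrow> \<theta> y = 0"
    "open V" "x \<in> V" "V \<subseteq> C" "\<And>y. y \<in> V \<Longrightarrow> \<theta> y = 1"
    using bump_exists[OF assms(2,3)] by blast
  let ?Y = "((\<lambda>c x. \<theta> x *\<^sub>R fst X c x), (\<lambda>c x. \<theta> x *\<^sub>R snd X c x))"
  have "?Y \<in> Vect A UNIV"
    using VectD[OF assms(1)] rVect_extend[OF _ assms(2) t(1-4)] by (auto simp: Vect_def)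
  then show thesis using t by (intro that[of ?Y V]) (auto simp: vagree_def)
qed

section \<open>Derivatives of locally uniform limits\<close>

text \<open>A maximum principle.  If \<open>w x > 0\<close>, then for large \<open>j\<close> the derivative of \<open>u\<^sub>j\<close> along \<open>R\<close> is at least some
  \<open>\<delta> / 2 > 0\<close> near \<open>x\<close>.  Let \<open>z\<close> be the coordinate and \<open>z\<^sub>0\<close> that of \<open>x\<close>.  As \<open>u\<^sub>j\<close> is uniformly small, \<open>u\<^sub>j - \<bar>z - z\<^sub>0\<bar>\<^sup>2\<close>
  has a maximum in the interior of a small ball around \<open>z\<^sub>0\<close>.  There the derivatives of \<open>u\<^sub>j\<close> and of
  \<open>\<bar>z - z\<^sub>0\<bar>\<^sup>2\<close> along \<open>R\<close> coincide, but the latter is small.\<close>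

lemma rvact_limit_nonpos:
  assumes W: "open W" "x \<in> W" and R: "R \<in> rVect A U" "W \<subseteq> U"
    and u: "\<And>j. smooth_fun A W (u j)" "uniform_limit W u (\<lambda>y. 0 :: real) sequentially"
    and w: "uniform_limit W (\<lambda>j. rvact A R (u j)) w sequentially"
  shows "w x \<le> 0"
proof (rule ccontr)
  assume "\<not> w x \<le> 0"
  then have wx: "w x > 0" by simp
  define \<delta> where "\<delta> = w x / 2"
  have \<delta>: "\<delta> > 0" using wx by (simp add: \<delta>_def)
  obtain c where c: "c \<in> A" "x \<in> cdom c" by (rule chart_exists)
  let ?z0 = "cmap c x"
  let ?i = "chart_inv c"
  note F = chart_facts(1)[OF c(1)]
  define M where "M = norm (R c x) + 1"
  have M: "M > 0" by (simp add: M_def add_nonneg_pos)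
  have smR: "smooth_fun A (W \<inter> cdom c) (R c)"
  proof (rule smooth_fun_chart[OF c(1)])
    show "smooth_within (cmodel c) (cmap c ` (W \<inter> cdom c)) (R c \<circ> ?i)"
      by (rule smooth_within_subset[OF rVectD(3)[OF R(1) c(1)]]) (use R in auto)
  qed (use W chart_facts(3)[OF c(1)] in auto)
  have contw: "continuous_on W w"
  proof (rule uniform_limit_theorem[OF _ w])
    have "smooth_fun A W (rvact A R (u j))" for j
    proof -
      have "smooth_fun A W (rvact A (\<lambda>c y. if y \<in> W then R c y else 0) (u j))"
        by (intro rvact_smooth W u(1) rVect_restrict[OF R(1)] R(2))
      then show ?thesis by (rule smooth_fun_cong[THEN iffD1, rotated]) (rule rvact_pointwise, simp)
    qed
    then show "\<forall>\<^sub>F j in sequentially. continuous_on W (rvact A R (u j))"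
      using W by (intro always_eventually allI smooth_fun_continuous)
  qed simp
  define W1 where "W1 = {y \<in> W \<inter> cdom c. \<delta> < w y \<and> norm (R c y) < M}"
  have "open W1"
  proof -
    have Wc: "open (W \<inter> cdom c)" using W chart_facts(3)[OF c(1)] by auto
    have "open ((W \<inter> cdom c) \<inter> (\<lambda>y. (w y, norm (R c y))) -` ({\<delta><..} \<times> {..<M}))"
    proof (rule continuous_open_preimage[OF _ Wc])
      show "continuous_on (W \<inter> cdom c) (\<lambda>y. (w y, norm (R c y)))"
        using continuous_on_subset[OF contw] smooth_fun_continuous[OF Wc smR]
        by (intro continuous_on_Pair continuous_on_norm) auto
    qed (simp add: open_Times)
    moreover have "W1 = (W \<inter> cdom c) \<inter> (\<lambda>y. (w y, norm (R c y))) -` ({\<delta><..} \<times> {..<M})" by (auto simp: W1_def)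
    ultimately show ?thesis by simp
  qed
  moreover have xW1: "x \<in> W1" using W c wx by (simp add: W1_def \<delta>_def M_def)
  moreover have W1c: "W1 \<subseteq> cdom c" by (auto simp: W1_def)
  ultimately obtain r0 where r0: "r0 > 0" "cball ?z0 r0 \<inter> cmodel c \<subseteq> cmap c ` W1"
    using chart_image_open[OF c(1)] unfolding openin_contains_cball by blast
  \<comment> \<open>The derivative of \<open>\<bar>z - z\<^sub>0\<bar>\<^sup>2\<close> along \<open>R\<close> is at most \<open>2 r M\<close> on the ball of radius \<open>r\<close>; it has to stay
    below \<open>\<delta> / 2\<close>.\<close>
  define r where "r = min r0 (\<delta> / (8 * M))"
  have r: "r > 0" "r \<le> r0" "2 * r * M < \<delta> / 2" using r0 \<delta> M by (auto simp: r_def min_def field_simps)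
  have ball: "cball ?z0 r \<inter> cmodel c \<subseteq> cmap c ` W1" using r0 r by fastforce
  have "\<forall>\<^sub>F j in sequentially. \<forall>y\<in>W. dist (u j y) 0 < r\<^sup>2 / 2"
    by (rule uniform_limitD[OF u(2)]) (use r in simp)
  moreover have "\<forall>\<^sub>F j in sequentially. \<forall>y\<in>W. dist (rvact A R (u j) y) (w y) < \<delta> / 2"
    by (rule uniform_limitD[OF w]) (use \<delta> in simp)
  ultimately have "\<forall>\<^sub>F j in sequentially. (\<forall>y\<in>W. dist (u j y) 0 < r\<^sup>2 / 2) \<and> (\<forall>y\<in>W. dist (rvact A R (u j) y) (w y) < \<delta> / 2)"
    by (rule eventually_conj)
  then obtain j where j: "\<And>y. y \<in> W \<Longrightarrow> \<bar>u j y\<bar> < r\<^sup>2 / 2" "\<And>y. y \<in> W \<Longrightarrow> \<bar>rvact A R (u j) y - w y\<bar> < \<delta> / 2"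
    unfolding eventually_sequentially by (auto simp: dist_real_def)
  let ?g = "u j \<circ> ?i"
  let ?m = "\<lambda>z. ?g z - (z - ?z0) \<bullet> (z - ?z0)"
  let ?B = "cball ?z0 r \<inter> cmodel c"
  have z0B: "?z0 \<in> ?B" using r openin_imp_subset[OF chart_facts(5)[OF c(1)]] c by auto
  have "continuous_on (cmap c ` (W \<inter> cdom c)) ?g"
    using u(1)[of j] c by (intro smooth_within_continuous[OF _ F chart_image_open_Int[OF c(1) W(1)]]) (simp add: smooth_fun_def)
  then have "continuous_on ?B ?g" by (rule continuous_on_subset) (use ball in \<open>auto simp: W1_def\<close>)
  moreover have "continuous_on ?B (\<lambda>z. (z - ?z0) \<bullet> (z - ?z0))" by (intro continuous_intros)
  ultimately have "continuous_on ?B ?m" by (rule continuous_on_diff)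
  moreover have "compact ?B" by (intro compact_Int_closed compact_cball chart_facts(2) c)
  ultimately obtain z where z: "z \<in> ?B" "\<And>z'. z' \<in> ?B \<Longrightarrow> ?m z' \<le> ?m z"
    using continuous_attains_sup[of ?B ?m] z0B by blast
  then obtain y where y: "y \<in> W1" "z = cmap c y" using ball by auto
  have yc: "y \<in> cdom c" "y \<in> W" "y \<in> U" using y R by (auto simp: W1_def)
  let ?v = "R c y"
  have v: "?v \<in> cmodel c" by (rule rVectD(2)[OF R(1) c(1) yc(1)])
  have inner: "norm (z - ?z0) < r"
  proof (rule ccontr)
    assume "\<not> norm (z - ?z0) < r"
    then have "(z - ?z0) \<bullet> (z - ?z0) \<ge> r\<^sup>2"
      using r(1) by (simp add: power2_norm_eq_inner[symmetric] power_mono)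
    moreover have "?g ?z0 \<le> ?m z" using z(2)[OF z0B] by simp
    moreover have "?g ?z0 = u j x" "?g z = u j y" using c yc y by simp_all
    ultimately show False using j(1)[OF W(2)] j(1)[OF yc(2)] by linarith
  qed
  have der: "((\<lambda>t. ?m (z + t *\<^sub>R ?v)) has_real_derivative rvact A R (u j) y - 2 * ((z - ?z0) \<bullet> ?v)) (at 0)"
  proof -
    have "((\<lambda>t. ?g (z + t *\<^sub>R ?v)) has_vector_derivative rvact A R (u j) y) (at 0)"
      using chart_dirder[OF W(1) yc(2) u(1) c(1) yc(1) v, of j] rvact_chart[OF R(1) yc(3) W(1) yc(2) u(1) c(1) yc(1), of j] y
      by simp
    then have 1: "((\<lambda>t. ?g (z + t *\<^sub>R ?v)) has_real_derivative rvact A R (u j) y) (at 0)"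
      by (simp add: has_real_derivative_iff_has_vector_derivative)
    have "(z + t *\<^sub>R ?v - ?z0) \<bullet> (z + t *\<^sub>R ?v - ?z0) =
       (z - ?z0) \<bullet> (z - ?z0) + t * (2 * ((z - ?z0) \<bullet> ?v)) + t * t * (?v \<bullet> ?v)" for t
      by (simp add: inner_add_left inner_add_right inner_diff_left inner_diff_right inner_commute algebra_simps)
    moreover have "((\<lambda>t. (z - ?z0) \<bullet> (z - ?z0) + t * (2 * ((z - ?z0) \<bullet> ?v)) + t * t * (?v \<bullet> ?v)) has_real_derivative 2 * ((z - ?z0) \<bullet> ?v)) (at 0)"
      by (auto intro!: derivative_eq_intros)
    ultimately have "((\<lambda>t. (z + t *\<^sub>R ?v - ?z0) \<bullet> (z + t *\<^sub>R ?v - ?z0)) has_real_derivative 2 * ((z - ?z0) \<bullet> ?v)) (at 0)"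
      by simp
    from DERIV_diff[OF 1 this] show ?thesis .
  qed
  have "openin (top_of_set (cmodel c)) (cmodel c \<inter> ball ?z0 r)" by (simp add: openin_open_Int)
  then have "eventually (\<lambda>t. z + t *\<^sub>R ?v \<in> cmodel c \<inter> ball ?z0 r) (nhds 0)"
    by (rule eventually_line_in[OF _ F _ v]) (use inner z in \<open>auto simp: dist_norm norm_minus_commute\<close>)
  then have "eventually (\<lambda>t. ?m (z + t *\<^sub>R ?v) \<le> ?m (z + 0 *\<^sub>R ?v)) (nhds 0)"
    by eventually_elim (use z(2) in auto)
  then obtain \<epsilon> where e: "\<epsilon> > 0" "\<And>t. \<bar>0 - t\<bar> < \<epsilon> \<Longrightarrow> ?m (z + t *\<^sub>R ?v) \<le> ?m (z + 0 *\<^sub>R ?v)"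
    unfolding eventually_nhds_metric by (auto simp: dist_real_def)
  then have "rvact A R (u j) y - 2 * ((z - ?z0) \<bullet> ?v) = 0"
    by (intro DERIV_local_max[OF der e(1)]) blast
  moreover have "(z - ?z0) \<bullet> ?v \<le> r * M"
  proof -
    have "(z - ?z0) \<bullet> ?v \<le> norm (z - ?z0) * norm ?v" by (rule norm_cauchy_schwarz)
    also have "\<dots> \<le> r * M" using inner y r by (intro mult_mono) (auto simp: W1_def)
    finally show ?thesis .
  qed
  moreover have "w y > \<delta>" using y by (simp add: W1_def)
  moreover have "\<bar>rvact A R (u j) y - w y\<bar> < \<delta> / 2" by (rule j(2)[OF yc(2)])
  ultimately show False using r(3) by linarith
qed

lemma rvact_limit_real:
  assumes W: "open W" "x \<in> W" and R: "R \<in> rVect A U" "W \<subseteq> U"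
    and u: "\<And>j. smooth_fun A W (u j)" "uniform_limit W u (\<lambda>y. 0 :: real) sequentially"
    and w: "uniform_limit W (\<lambda>j. rvact A R (u j)) w sequentially"
  shows "w x = 0"
proof -
  have "w x \<le> 0" by (rule rvact_limit_nonpos[OF assms])
  moreover have "- w x \<le> 0"
  proof (rule rvact_limit_nonpos[OF W R, of "\<lambda>j y. - u j y" "\<lambda>y. - w y"])
    show "smooth_fun A W (\<lambda>y. - u j y)" for j
      by (rule smooth_fun_linear[OF bounded_linear_minus[OF bounded_linear_ident] W(1) u(1)])
    show "uniform_limit W (\<lambda>j y. - u j y) (\<lambda>y. 0) sequentially"
      using uniform_limit_uminus[OF u(2)] by simp
    have "rvact A R (\<lambda>y. - u j y) y = - rvact A R (u j) y" if "y \<in> W" for j y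
      by (rule rvact_linear[OF bounded_linear_minus[OF bounded_linear_ident] R(1) _ W(1) that u(1)]) (use that R in auto)
    then show "uniform_limit W (\<lambda>j. rvact A R (\<lambda>y. - u j y)) (\<lambda>y. - w y) sequentially"
      using uniform_limit_uminus[OF w] by (simp cong: uniform_limit_cong')
  qed
  ultimately show ?thesis by simp
qed

lemma rvact_limit:
  fixes u :: "nat \<Rightarrow> 'm \<Rightarrow> complex"
  assumes W: "open W" "x \<in> W" and R: "R \<in> rVect A U" "W \<subseteq> U"
    and u: "\<And>j. smooth_fun A W (u j)" "smooth_fun A W u'" "uniform_limit W u u' sequentially"
    and w: "uniform_limit W (\<lambda>j. rvact A R (u j)) w sequentially"
  shows "rvact A R u' x = w x"
proof -
  \<comment> \<open>Applied to real and imaginary parts of \<open>u j - u'\<close>.\<close>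
  have *: "L (w x) - L (rvact A R u' x) = 0" if L: "bounded_linear L" for L :: "complex \<Rightarrow> real"
  proof (rule rvact_limit_real[OF W R, of "\<lambda>j y. L (u j y - u' y)"])
    have sm: "smooth_fun A W (\<lambda>y. u j y - u' y)" for j by (rule smooth_fun_diff[OF W(1) u(1,2)])
    show "smooth_fun A W (\<lambda>y. L (u j y - u' y))" for j by (rule smooth_fun_linear[OF L W(1) sm])
    have "uniform_limit W (\<lambda>j y. u j y - u' y) (\<lambda>y. u' y - u' y) sequentially"
      by (intro uniform_limit_intros u)
    from bounded_linear.uniform_limit[OF L this]
    show "uniform_limit W (\<lambda>j y. L (u j y - u' y)) (\<lambda>y. 0) sequentially"
      using bounded_linear.linear[OF L] by (simp add: linear_0)
    have "rvact A R (\<lambda>y. L (u j y - u' y)) y = L (rvact A R (u j) y - rvact A R u' y)" if y: "y \<in> W" for j y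
    proof -
      have yU: "y \<in> U" using y R by auto
      have "rvact A R (\<lambda>y. u j y + (- u' y)) y = rvact A R (u j) y + rvact A R (\<lambda>y. - u' y) y"
        by (rule rvact_add[OF R(1) yU W(1) y u(1)])
          (rule smooth_fun_linear[OF bounded_linear_minus[OF bounded_linear_ident] W(1) u(2)])
      also have "rvact A R (\<lambda>y. - u' y) y = - rvact A R u' y"
        by (rule rvact_linear[OF bounded_linear_minus[OF bounded_linear_ident] R(1) yU W(1) y u(2)])
      finally show ?thesis using rvact_linear[OF L R(1) yU W(1) y sm] by simp
    qed
    moreover have "uniform_limit W (\<lambda>j y. L (rvact A R (u j) y - rvact A R u' y)) (\<lambda>y. L (w y - rvact A R u' y)) sequentially"
      by (intro bounded_linear.uniform_limit[OF L] uniform_limit_intros w)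
    ultimately show "uniform_limit W (\<lambda>j. rvact A R (\<lambda>y. L (u j y - u' y))) (\<lambda>y. L (w y) - L (rvact A R u' y)) sequentially"
      using bounded_linear.linear[OF L] by (simp add: linear_diff cong: uniform_limit_cong')
  qed
  show ?thesis using *[OF bounded_linear_Re] *[OF bounded_linear_Im] by (simp add: complex_eq_iff)
qed

end

section \<open>Complex vector fields as derivations\<close>

context manifold
begin

lemma Cinf_iff:
  "f \<in> Cinf A U K \<longleftrightarrow> (\<forall>x\<in>U. f x \<in> K) \<and> (\<forall>x. x \<notin> U \<longrightarrow> f x = 0) \<and> smooth_fun A U f"
  by (simp add: Cinf_def smooth_fun_def)

lemma vact_pointwise:
  assumes "\<And>c. fst X c x = fst Y c x" "\<And>c. snd X c x = snd Y c x"
  shows "vact A X f x = vact A Y f x"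
  using rvact_pointwise[of "fst X" x "fst Y" f, OF assms(1)] rvact_pointwise[of "snd X" x "snd Y" f, OF assms(2)]
  by (simp add: vact_def)

lemma vact_vagree: "vagree W X Y \<Longrightarrow> x \<in> W \<Longrightarrow> vact A X f x = vact A Y f x"
  by (rule vact_pointwise) (auto simp: vagree_def)

lemma vact_const: "vact A X (\<lambda>x. c) x = 0"
  by (simp add: vact_def rvact_const)

lemma vact_cong:
  assumes "X \<in> Vect A U" "x \<in> U" and V: "open V" "x \<in> V" "\<And>y. y \<in> V \<Longrightarrow> f y = g y"
  shows "vact A X f x = vact A X g x"
  using rvact_cong[OF _ assms(2) V] VectD[OF assms(1)] by (simp add: vact_def)

lemma vact_mem:
  assumes "X \<in> Vect A U" "x \<in> U" and V: "open V" "x \<in> V" "smooth_fun A V f"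
    and K: "closed_csubspace K" "\<And>y. y \<in> V \<Longrightarrow> f y \<in> K"
  shows "vact A X f x \<in> K"
proof -
  note Kf = closed_csubspace_facts[OF K(1)]
  have "rvact A (fst X) f x \<in> K" "rvact A (snd X) f x \<in> K"
    using rvact_closed[OF _ assms(2) V Kf(1,2) K(2)] VectD[OF assms(1)] by auto
  then show ?thesis using Kf(4,5) by (simp add: vact_def)
qed

lemma vact_scaleC:
  assumes "X \<in> Vect A U" "x \<in> U" and V: "open V" "x \<in> V" "smooth_fun A V a" "smooth_fun A V f"
  shows "vact A X (\<lambda>y. a y *\<^sub>C f y) x = vact A X a x *\<^sub>C f x + a x *\<^sub>C vact A X f x"
  using rvact_bilinear[OF bounded_bilinear_scaleC _ assms(2) V] VectD[OF assms(1)]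
  by (simp add: vact_def scaleC_add_right scaleC_add_left scaleC_scaleC mult_ac scaleC_complex_def)

lemma rvact_uminus:
  assumes "X \<in> rVect A U" "open V" "x \<in> V" "smooth_fun A V f"
  shows "rvact A (\<lambda>c x. - X c x) f x = - rvact A X f x"
  using rvact_comb[OF assms(1,1,2-4), of "\<lambda>c x. - X c x" "-1" 0] by simp

lemma vact_cinner:
  assumes "X \<in> Vect A U" "x \<in> U" and V: "open V" "x \<in> V" "smooth_fun A V f" "smooth_fun A V g"
  shows "vact A X (\<lambda>y. cinner (f y) (g y)) x = cinner (vact A X f x) (g x) + cinner (f x) (vact A (vconj X) g x)"
  using rvact_bilinear[OF bounded_bilinear_cinner _ assms(2) V] VectD[OF assms(1)]
    rvact_uminus[of "snd X" U V x g] V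
  by (simp add: vact_def vconj_def cinner_add_left cinner_add_right cinner_scaleC_left cinner_scaleC_right
      scaleC_complex_def cinner_minus_right algebra_simps)

lemma vact_vadd:
  assumes "X \<in> Vect A U" "Y \<in> Vect A U'" and V: "open V" "x \<in> V" "smooth_fun A V f"
  shows "vact A (vadd X Y) f x = vact A X f x + vact A Y f x"
  using rvact_comb[OF _ _ V, of "fst X" U "fst Y" U' "fst (vadd X Y)" 1 1]
    rvact_comb[OF _ _ V, of "snd X" U "snd Y" U' "snd (vadd X Y)" 1 1]
    VectD[OF assms(1)] VectD[OF assms(2)]
  by (simp add: vact_def vadd_def scaleC_add_right)

lemma scaleC_eq_Re_Im: "a *\<^sub>C v = Re a *\<^sub>R v + Im a *\<^sub>R (\<i> *\<^sub>C (v :: 'k::complex_hilbert))"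
proof -
  have "a = complex_of_real (Re a) + complex_of_real (Im a) * \<i>"
    by (simp add: complex_eq_iff)
  then have "a *\<^sub>C v = (complex_of_real (Re a) + complex_of_real (Im a) * \<i>) *\<^sub>C v"
    by (rule arg_cong)
  then show ?thesis by (simp only: scaleC_add_left scaleC_scaleC[symmetric] scaleC_of_real)
qed

lemma vact_vscale:
  fixes f :: "'m \<Rightarrow> 'k::complex_hilbert"
  assumes "X \<in> Vect A U" and V: "open V" "x \<in> V" "smooth_fun A V f"
  shows "vact A (vscale a X) f x = a x *\<^sub>C vact A X f x"
proof -
  have 1: "rvact A (fst (vscale a X)) f x = Re (a x) *\<^sub>R rvact A (fst X) f x + (- Im (a x)) *\<^sub>R rvact A (snd X) f x"
    by (rule rvact_comb[of _ U _ U, OF _ _ V]) (use VectD[OF assms(1)] in \<open>auto simp: vscale_def\<close>)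
  have 2: "rvact A (snd (vscale a X)) f x = Im (a x) *\<^sub>R rvact A (fst X) f x + Re (a x) *\<^sub>R rvact A (snd X) f x"
    by (rule rvact_comb[of _ U _ U, OF _ _ V]) (use VectD[OF assms(1)] in \<open>auto simp: vscale_def\<close>)
  have i: "\<i> *\<^sub>C (r *\<^sub>R v) = r *\<^sub>R (\<i> *\<^sub>C v)" for r and v :: 'k
    using bounded_bilinear.scaleR_right[OF bounded_bilinear_scaleC] .
  have ii: "\<i> *\<^sub>C \<i> *\<^sub>C v = - v" for v :: 'k by (simp add: scaleC_scaleC scaleC_minus_one)
  show ?thesis
    unfolding vact_def 1 2 scaleC_eq_Re_Im[of "a x"] by (simp add: scaleC_add_right i ii algebra_simps)
qed

lemma Vect_vadd: "open U \<Longrightarrow> X \<in> Vect A U \<Longrightarrow> Y \<in> Vect A U \<Longrightarrow> vadd X Y \<in> Vect A U"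
  using rVect_comb[of U "fst X" "fst Y" "\<lambda>_. 1" "\<lambda>_. 1"] rVect_comb[of U "snd X" "snd Y" "\<lambda>_. 1" "\<lambda>_. 1"]
  by (auto simp: Vect_def vadd_def smooth_fun_const)

lemma Vect_vscale:
  assumes "open U" "X \<in> Vect A U" "smooth_fun A U a"
  shows "vscale a X \<in> Vect A U"
proof -
  have a: "smooth_fun A U (\<lambda>x. Re (a x))" "smooth_fun A U (\<lambda>x. Im (a x))" "smooth_fun A U (\<lambda>x. - Im (a x))"
    using smooth_fun_linear[OF _ assms(1,3)] bounded_linear_Re bounded_linear_Im bounded_linear_minus[OF bounded_linear_Im]
    by blast+
  show ?thesis
    using rVect_comb[OF assms(1) _ _ a(1,3), of "fst X" "snd X"] rVect_comb[OF assms(1) _ _ a(2,1), of "fst X" "snd X"]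
      VectD[OF assms(2)] by (simp add: Vect_def vscale_def)
qed

lemma Vect_vconj: "open U \<Longrightarrow> X \<in> Vect A U \<Longrightarrow> vconj X \<in> Vect A U"
  using rVect_comb[of U "snd X" "snd X" "\<lambda>_. - 1" "\<lambda>_. 0"]
  by (auto simp: Vect_def vconj_def smooth_fun_const)

definition vrestr :: "'m set \<Rightarrow> ('m, 'e) vfield \<Rightarrow> ('m, 'e) vfield" where
  "vrestr V X = ((\<lambda>c x. if x \<in> V then fst X c x else 0), (\<lambda>c x. if x \<in> V then snd X c x else 0))"

lemma Vect_vrestr: "X \<in> Vect A U \<Longrightarrow> open V \<Longrightarrow> V \<subseteq> U \<Longrightarrow> vrestr V X \<in> Vect A V"
  using rVect_restrict[of "fst X" U V] rVect_restrict[of "snd X" U V] by (simp add: Vect_def vrestr_def mem_Times_iff)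

lemma vagree_vrestr: "W \<subseteq> V \<Longrightarrow> vagree W (vrestr V X) X"
  by (auto simp: vagree_def vrestr_def)

lemma vact_vrestr: "x \<in> V \<Longrightarrow> vact A (vrestr V X) f x = vact A X f x"
  by (rule vact_pointwise) (simp_all add: vrestr_def)

lemma vact_Cinf:
  assumes U: "open U" and X: "X \<in> Vect A U" and K: "closed_csubspace K" and f: "f \<in> Cinf A U K"
  shows "vact A X f \<in> Cinf A U K"
  unfolding Cinf_iff
proof (intro conjI ballI allI impI)
  have fs: "smooth_fun A U f" "\<And>x. x \<in> U \<Longrightarrow> f x \<in> K" using f by (auto simp: Cinf_iff)
  show "vact A X f x \<in> K" if "x \<in> U" for x
    by (rule vact_mem[OF X that U that fs(1) K fs(2)])
  show "vact A X f x = 0" if "x \<notin> U" for x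
  proof -
    have "fst X c x = 0" "snd X c x = 0" for c using rVectD(1)[of _ U c x] VectD[OF X] that by auto
    then show ?thesis using rvact_zero[of "fst X" x f] rvact_zero[of "snd X" x f] by (simp add: vact_def)
  qed
  show "smooth_fun A U (vact A X f)"
    unfolding vact_def
    by (intro smooth_fun_add[OF U] smooth_fun_linear[OF bounded_linear_scaleC U] rvact_smooth[OF U _ fs(1)])
      (use VectD[OF X] in auto)
qed

end

section \<open>Trivializations of a Hilbert bundle\<close>

locale hilbert_bundle = manifold A
  for A :: "('m::{t2_space, second_countable_topology}, 'e::euclidean_space) chart set" +
  fixes F :: "('m, 'h) hfield" and B :: "('h, 'b::banach) chart set" and I :: "'i set" and U :: "'i \<Rightarrow> 'm set"
    and K :: "'i \<Rightarrow> 'k::complex_hilbert set" and T :: "'i \<Rightarrow> 'm \<Rightarrow> 'h \<Rightarrow> 'k"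
  assumes field: "field_of_hilbert_spaces F"
    and hb: "hilbert_bundle_structure A F B I U K T"
begin

lemma U_open: "i \<in> I \<Longrightarrow> open (U i)"
  using hb by (simp add: hilbert_bundle_structure_def)

lemma K_closed: "i \<in> I \<Longrightarrow> closed_csubspace (K i)"
  using hb by (simp add: hilbert_bundle_structure_def)

lemma cover: obtains i where "i \<in> I" "x \<in> U i"
proof -
  have "(\<Union>i\<in>I. U i) = UNIV" using hb by (simp add: hilbert_bundle_structure_def)
  then have "x \<in> (\<Union>i\<in>I. U i)" by simp
  then show thesis using that by blast
qed

sublocale fib: hilbert_on "fiber F x" "fadd F" "fzero F x" "fscale F" "finner F" for x
  using field by (simp add: field_of_hilbert_spaces_def)

lemma T_unitary: "i \<in> I \<Longrightarrow> x \<in> U i \<Longrightarrow> unitary_from_fiber F x (K i) (T i x)"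
  using hb by (simp add: hilbert_bundle_structure_def)

context
  fixes i x
  assumes i: "i \<in> I" "x \<in> U i"
begin

lemma T_mem: "v \<in> fiber F x \<Longrightarrow> T i x v \<in> K i"
  using T_unitary[OF i] by (auto simp: unitary_from_fiber_def)

lemma T_add: "v \<in> fiber F x \<Longrightarrow> w \<in> fiber F x \<Longrightarrow> T i x (fadd F v w) = T i x v + T i x w"
  using T_unitary[OF i] by (simp add: unitary_from_fiber_def)

lemma T_scale: "v \<in> fiber F x \<Longrightarrow> T i x (fscale F a v) = a *\<^sub>C T i x v"
  using T_unitary[OF i] by (simp add: unitary_from_fiber_def)

lemma T_inner: "v \<in> fiber F x \<Longrightarrow> w \<in> fiber F x \<Longrightarrow> cinner (T i x v) (T i x w) = finner F v w"
  using T_unitary[OF i] by (simp add: unitary_from_fiber_def)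

lemma T_zero: "T i x (fzero F x) = 0"
  using T_add[OF fib.zero_closed fib.zero_closed] fib.add_zero[OF fib.zero_closed] by simp

lemma T_sub: "v \<in> fiber F x \<Longrightarrow> w \<in> fiber F x \<Longrightarrow> T i x (fadd F v (fscale F (-1) w)) = T i x v - T i x w"
  by (simp add: T_add T_scale fib.scale_closed scaleC_minus_one)

lemma T_inj:
  assumes v: "v \<in> fiber F x" and w: "w \<in> fiber F x" and eq: "T i x v = T i x w"
  shows "v = w"
proof -
  let ?w' = "fscale F (-1) w"
  have w': "?w' \<in> fiber F x" by (rule fib.scale_closed[OF w])
  let ?d = "fadd F v ?w'"
  have d: "?d \<in> fiber F x" by (rule fib.add_closed[OF v w'])
  have "finner F ?d ?d = 0" using T_inner[OF d d] T_sub[OF v w] eq by simp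
  then have d0: "?d = fzero F x" using fib.inner_pos[OF d] by fastforce
  have "v = fadd F (fzero F x) v" using fib.add_zero[OF v] by simp
  also have "\<dots> = fadd F v (fadd F ?w' w)"
    using fib.add_commute fib.add_uminus[OF w] v w w' fib.zero_closed by metis
  also have "\<dots> = fadd F ?d w" using fib.add_assoc[OF v w' w] by simp
  also have "\<dots> = w" using d0 fib.add_zero[OF w] by simp
  finally show ?thesis .
qed

lemma adj_T: assumes "v \<in> fiber F x" shows "adj F (T i) x (T i x v) = v"
  unfolding adj_def
proof (rule the_equality)
  show "v \<in> fiber F x \<and> (\<forall>u\<in>fiber F x. cinner (T i x u) (T i x v) = finner F u v)"
    using assms T_inner by auto
  fix w assume w: "w \<in> fiber F x \<and> (\<forall>u\<in>fiber F x. cinner (T i x u) (T i x v) = finner F u w)"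
  let ?d = "fadd F v (fscale F (-1) w)"
  have d: "?d \<in> fiber F x" using assms w by (intro fib.add_closed fib.scale_closed) auto
  have "cinner (T i x ?d) (T i x v) = cinner (T i x ?d) (T i x w)" using w d T_inner[OF d, of w] by simp
  then have "cinner (T i x v - T i x w) (T i x v - T i x w) = 0"
    using T_sub[OF assms, of w] w by (simp add: cinner_diff_right)
  then have "T i x v = T i x w" by (simp add: cinner_self)
  then show "w = v" using T_inj assms w by metis
qed

lemma adj_mem: assumes "w \<in> K i" shows "adj F (T i) x w \<in> fiber F x"
  and "T i x (adj F (T i) x w) = w"
proof -
  have "T i x ` fiber F x = K i" using T_unitary[OF i] by (simp add: unitary_from_fiber_def)
  then obtain v where "v \<in> fiber F x" "w = T i x v" using assms by blast
  then show "adj F (T i) x w \<in> fiber F x" "T i x (adj F (T i) x w) = w" by (simp_all add: adj_T)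
qed

lemma fdist_T: "v \<in> fiber F x \<Longrightarrow> w \<in> fiber F x \<Longrightarrow> fdist F v w = norm (T i x v - T i x w)"
proof -
  assume v: "v \<in> fiber F x" and w: "w \<in> fiber F x"
  let ?d = "fadd F v (fscale F (-1) w)"
  have d: "?d \<in> fiber F x" using v w by (intro fib.add_closed fib.scale_closed)
  have "finner F ?d ?d = complex_of_real ((norm (T i x v - T i x w))\<^sup>2)"
    using T_inner[OF d d] T_sub[OF v w] by (simp add: cinner_self)
  then show ?thesis by (simp add: fdist_def)
qed

end

subsection \<open>Smooth sections in a trivialization\<close>

lemma B_chart:
  assumes "d \<in> B"
  shows "subspace (cmodel d)" "closed (cmodel d)" "inj_on (cmap d) (cdom d)" "cmap d ` cdom d \<subseteq> cmodel d"
proof -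
  have "is_chart d" using hb assms by (simp add: hilbert_bundle_structure_def smooth_atlas_def)
  then show "subspace (cmodel d)" "closed (cmodel d)" "inj_on (cmap d) (cdom d)" "cmap d ` cdom d \<subseteq> cmodel d"
    using openin_imp_subset[of euclidean "cmodel d" "cmap d ` cdom d"] by (auto simp: is_chart_def)
qed

lemma B_cover: obtains d where "d \<in> B" "v \<in> cdom d"
proof -
  have "(\<Union>c\<in>B. cdom c) = UNIV" using hb by (simp add: hilbert_bundle_structure_def smooth_atlas_def)
  then have "v \<in> (\<Union>c\<in>B. cdom c)" by simp
  then show thesis using that by blast
qed

definition triv :: "'i \<Rightarrow> 'h \<Rightarrow> 'm \<times> 'k" where
  "triv i v = (proj F v, T i (proj F v) v)"

text \<open>The member of \<open>prod_atlas\<close> that belongs to \<open>c\<close>.\<close>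

definition prod_chart :: "('m, 'e) chart \<Rightarrow> 'i \<Rightarrow> ('m \<times> 'k, 'e \<times> 'k) chart" where
  "prod_chart c i = \<lparr>cdom = (cdom c \<inter> U i) \<times> K i, cmap = (\<lambda>(x, v). (cmap c x, v)), cmodel = cmodel c \<times> K i\<rparr>"

lemma prod_chart_inv:
  assumes "c \<in> A" "x \<in> cdom c" "x \<in> U i" "v \<in> K i"
  shows "chart_inv (prod_chart c i) (cmap c x, v) = (x, v)"
proof -
  have "inj_on (cmap (prod_chart c i)) (cdom (prod_chart c i))"
    using chart_facts(4)[OF assms(1)] by (auto simp: prod_chart_def inj_on_def)
  moreover have "(x, v) \<in> cdom (prod_chart c i)" using assms by (simp add: prod_chart_def)
  ultimately have "inv_into (cdom (prod_chart c i)) (cmap (prod_chart c i)) (cmap (prod_chart c i) (x, v)) = (x, v)"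
    by (rule inv_into_f_f)
  then show ?thesis by (simp add: chart_inv_def prod_chart_def)
qed

lemma triv_diffeo:
  assumes "i \<in> I"
  shows "mfd_diffeo B (prod_atlas A (U i) (K i)) (proj F -` U i) (U i \<times> K i) (triv i)"
  using hb assms by (simp add: hilbert_bundle_structure_def triv_def[abs_def])

lemma inv_triv:
  assumes "i \<in> I" "x \<in> U i" "v \<in> fiber F x"
  shows "inv_into (proj F -` U i) (triv i) (x, T i x v) = v"
proof -
  have "inj_on (triv i) (proj F -` U i)"
    using triv_diffeo[OF assms(1)] by (simp add: mfd_diffeo_def bij_betw_def)
  moreover have "v \<in> proj F -` U i" "triv i v = (x, T i x v)" using assms by (auto simp: fiber_def triv_def)
  ultimately show ?thesis by (metis inv_into_f_f)
qed

text \<open>A section that is smooth in charts of the base and of the total space is composed with the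
  trivialization, read in the same chart of the total space.\<close>

lemma section_to_trivialization:
  assumes i: "i \<in> I" and c: "c \<in> A" and d: "d \<in> B" and W: "open W" "W \<subseteq> cdom c \<inter> U i"
    and \<phi>: "\<And>x. x \<in> W \<Longrightarrow> \<phi> x \<in> fiber F x" "\<phi> ` W \<subseteq> cdom d"
    and sm: "smooth_within (cmodel c) (cmap c ` W) (cmap d \<circ> \<phi> \<circ> chart_inv c)"
  shows "smooth_fun A W (\<lambda>x. T i x (\<phi> x))"
proof (rule smooth_fun_chart[OF c W(1)])
  let ?p = "prod_chart c i"
  let ?S' = "cmap d ` (proj F -` U i \<inter> cdom d \<inter> triv i -` cdom ?p)"
  note F = chart_facts(1)[OF c] chart_image_open[OF c W(1)]
  show Wc: "W \<subseteq> cdom c" using W by auto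
  have "mfd_smooth B (prod_atlas A (U i) (K i)) (proj F -` U i) (triv i)"
    using triv_diffeo[OF i] by (simp add: mfd_diffeo_def)
  moreover have "?p \<in> prod_atlas A (U i) (K i)" using c by (auto simp: prod_atlas_def prod_chart_def)
  ultimately have g: "smooth_within (cmodel d) ?S' (cmap ?p \<circ> triv i \<circ> chart_inv d)"
    using d unfolding mfd_smooth_def Let_def by blast
  have "smooth_within (cmodel c) (cmap c ` W) (\<lambda>z. (cmap ?p \<circ> triv i \<circ> chart_inv d) ((cmap d \<circ> \<phi> \<circ> chart_inv c) z))"
  proof (rule smooth_within_compose[OF F(1) F(2)[OF Wc] sm _ g B_chart(1,2)[OF d]])
    show "(cmap d \<circ> \<phi> \<circ> chart_inv c) ` cmap c ` W \<subseteq> ?S'"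
    proof (clarsimp)
      fix x assume x: "x \<in> W"
      then have "\<phi> x \<in> proj F -` U i \<inter> cdom d \<inter> triv i -` cdom ?p"
        using \<phi>(1)[OF x] \<phi>(2) W T_mem[OF i, of x "\<phi> x"]
        by (auto simp: fiber_def triv_def prod_chart_def)
      then show "cmap d (\<phi> (chart_inv c (cmap c x))) \<in> cmap d ` (proj F -` U i \<inter> cdom d \<inter> triv i -` cdom ?p)"
        using x Wc c by auto
    qed
    show "?S' \<subseteq> cmodel d" using B_chart(4)[OF d] by auto
  qed
  then have "smooth_within (cmodel c) (cmap c ` W) (\<lambda>z. snd ((cmap ?p \<circ> triv i \<circ> chart_inv d) ((cmap d \<circ> \<phi> \<circ> chart_inv c) z)))"
    by (rule smooth_within_linear_comp[OF bounded_linear_snd F(1) F(2)[OF Wc]])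
  then show "smooth_within (cmodel c) (cmap c ` W) ((\<lambda>x. T i x (\<phi> x)) \<circ> chart_inv c)"
  proof (rule smooth_within_cong[THEN iffD1, rotated])
    fix z assume "z \<in> cmap c ` W"
    then obtain x where x: "x \<in> W" "z = cmap c x" by auto
    have "chart_inv d (cmap d (\<phi> x)) = \<phi> x"
      using B_chart(3)[OF d] \<phi>(2) x by (auto simp: chart_inv_def)
    moreover have "proj F (\<phi> x) = x" using \<phi>(1)[OF x(1)] by (simp add: fiber_def)
    ultimately show "snd ((cmap ?p \<circ> triv i \<circ> chart_inv d) ((cmap d \<circ> \<phi> \<circ> chart_inv c) z)) = ((\<lambda>x. T i x (\<phi> x)) \<circ> chart_inv c) z"
      using x Wc c by (auto simp: triv_def prod_chart_def)
  qed
qed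

text \<open>The converse: \<open>\<phi>\<close> is \<open>y \<mapsto> (y, T\<^sub>i \<phi>(y))\<close> followed by the inverse trivialization.  Besides smoothness this
  shows that \<open>\<phi>\<close> is continuous for the topology induced by the atlas of the total space.\<close>

lemma trivialization_to_section:
  assumes i: "i \<in> I" and c: "c \<in> A" and d: "d \<in> B" and W: "open W" "W \<subseteq> cdom c \<inter> U i"
    and \<phi>: "\<And>x. x \<in> W \<Longrightarrow> \<phi> x \<in> fiber F x"
    and sm: "smooth_fun A W (\<lambda>x. T i x (\<phi> x))"
  defines "W' \<equiv> {y \<in> W. \<phi> y \<in> cdom d}"
  shows "open W'" "smooth_within (cmodel c) (cmap c ` W') (cmap d \<circ> \<phi> \<circ> chart_inv c)"
proof -
  let ?p = "prod_chart c i"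
  let ?g = "inv_into (proj F -` U i) (triv i)"
  let ?S = "cmap ?p ` (U i \<times> K i \<inter> cdom ?p \<inter> ?g -` cdom d)"
  note Kf = closed_csubspace_facts[OF K_closed[OF i]]
  have W'W: "W' \<subseteq> W" by (auto simp: W'_def)
  then have W'c: "W' \<subseteq> cdom c" using W by auto
  have "mfd_smooth (prod_atlas A (U i) (K i)) B (U i \<times> K i) ?g"
    using triv_diffeo[OF i] by (simp add: mfd_diffeo_def)
  moreover have "?p \<in> prod_atlas A (U i) (K i)" using c by (auto simp: prod_atlas_def prod_chart_def)
  ultimately have g: "openin (top_of_set (cmodel ?p)) ?S" "smooth_within (cmodel ?p) ?S (cmap d \<circ> ?g \<circ> chart_inv ?p)"
    using d unfolding mfd_smooth_def Let_def by blast+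
  have model: "cmodel ?p = cmodel c \<times> K i" by (simp add: prod_chart_def)
  have hS: "(cmap c y, T i y (\<phi> y)) \<in> ?S \<longleftrightarrow> \<phi> y \<in> cdom d" if y: "y \<in> W" for y
  proof -
    have yy: "y \<in> cdom c" "y \<in> U i" "T i y (\<phi> y) \<in> K i" using y W T_mem[OF i] \<phi> by auto
    have gy: "?g (y, T i y (\<phi> y)) = \<phi> y" using inv_triv[OF i yy(2) \<phi>[OF y]] .
    show ?thesis
    proof
      assume "\<phi> y \<in> cdom d"
      then have "(y, T i y (\<phi> y)) \<in> U i \<times> K i \<inter> cdom ?p \<inter> ?g -` cdom d" using yy gy by (simp add: prod_chart_def)
      then have "cmap ?p (y, T i y (\<phi> y)) \<in> ?S" by blast
      then show "(cmap c y, T i y (\<phi> y)) \<in> ?S" by (simp add: prod_chart_def)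
    next
      assume "(cmap c y, T i y (\<phi> y)) \<in> ?S"
      then obtain y' v where y': "(cmap c y, T i y (\<phi> y)) = (cmap c y', v)" "y' \<in> cdom c" "?g (y', v) \<in> cdom d"
        by (auto simp: prod_chart_def)
      then have "y' = y" "v = T i y (\<phi> y)" using chart_facts(4)[OF c] yy by (auto simp: inj_on_def)
      then show "\<phi> y \<in> cdom d" using y' gy by simp
    qed
  qed
  have smh: "smooth_fun A W (\<lambda>y. (cmap c y, T i y (\<phi> y)))"
  proof (rule smooth_fun_chart[OF c W(1)])
    note F = chart_facts(1)[OF c] chart_image_open[OF c W(1)]
    have Wc: "W \<subseteq> cdom c" using W by auto
    have "W \<inter> cdom c = W" using Wc by auto
    then have "smooth_within (cmodel c) (cmap c ` W) ((\<lambda>x. T i x (\<phi> x)) \<circ> chart_inv c)"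
      using sm c by (auto simp: smooth_fun_def)
    from smooth_within_Pair[OF F(1) F(2)[OF Wc] smooth_within_linear[OF F(1) bounded_linear_ident] this]
    show "smooth_within (cmodel c) (cmap c ` W) ((\<lambda>y. (cmap c y, T i y (\<phi> y))) \<circ> chart_inv c)"
      by (rule smooth_within_cong[THEN iffD1, rotated]) (use c Wc in auto)
  qed (use W in auto)
  obtain O' where O: "open O'" "?S = cmodel ?p \<inter> O'" using g(1) by (auto simp: openin_open)
  have "open (W \<inter> (\<lambda>y. (cmap c y, T i y (\<phi> y))) -` O')"
    by (rule continuous_open_preimage[OF smooth_fun_continuous[OF W(1) smh] W(1) O(1)])
  moreover have "W' = W \<inter> (\<lambda>y. (cmap c y, T i y (\<phi> y))) -` O'"
  proof -
    have "(cmap c y, T i y (\<phi> y)) \<in> cmodel ?p" if y: "y \<in> W" for y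
      using y W T_mem[OF i, of y "\<phi> y"] \<phi>[OF y] openin_imp_subset[OF chart_facts(5)[OF c]] by (auto simp: model)
    then show ?thesis using hS O(2) by (auto simp: W'_def)
  qed
  ultimately show oW': "open W'" by simp
  have "smooth_fun A W' (\<lambda>y. (cmap d \<circ> ?g \<circ> chart_inv ?p) (cmap c y, T i y (\<phi> y)))"
  proof (rule smooth_fun_compose[OF oW' smooth_fun_subset[OF smh W'W] _ g(2)])
    show "(\<lambda>y. (cmap c y, T i y (\<phi> y))) ` W' \<subseteq> ?S" using hS by (auto simp: W'_def)
    show "subspace (cmodel ?p)" "closed (cmodel ?p)"
      unfolding model by (intro subspace_Times closed_Times chart_facts c Kf)+
    show "?S \<subseteq> cmodel ?p" using openin_imp_subset[OF g(1)] .
  qed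
  then have "smooth_fun A W' (\<lambda>y. cmap d (\<phi> y))"
  proof (rule smooth_fun_cong[THEN iffD1, rotated])
    fix y assume "y \<in> W'"
    then have y: "y \<in> W" using W'W by auto
    then have yy: "y \<in> cdom c" "y \<in> U i" "T i y (\<phi> y) \<in> K i" using W T_mem[OF i] \<phi> by auto
    show "(cmap d \<circ> ?g \<circ> chart_inv ?p) (cmap c y, T i y (\<phi> y)) = cmap d (\<phi> y)"
      using prod_chart_inv[OF c yy] inv_triv[OF i yy(2) \<phi>[OF y]] by simp
  qed
  moreover have "W' \<inter> cdom c = W'" using W'c by auto
  ultimately show "smooth_within (cmodel c) (cmap c ` W') (cmap d \<circ> \<phi> \<circ> chart_inv c)"
    using c by (auto simp: smooth_fun_def o_def)
qed

text \<open>Smoothness of \<open>\<tau>\<^sub>i\<^sub>j\<close> on smooth functions, through a chart of the total space.\<close>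

lemma change_trivialization:
  assumes ij: "i \<in> I" "j \<in> I" and W: "open W" "W \<subseteq> U i \<inter> U j" and \<phi>: "\<And>x. x \<in> W \<Longrightarrow> \<phi> x \<in> fiber F x"
    and sm: "smooth_fun A W (\<lambda>x. T i x (\<phi> x))"
  shows "smooth_fun A W (\<lambda>x. T j x (\<phi> x))"
proof (rule smooth_fun_local)
  fix x assume x: "x \<in> W"
  obtain c where c: "c \<in> A" "x \<in> cdom c" by (rule chart_exists)
  obtain d where d: "d \<in> B" "\<phi> x \<in> cdom d" by (rule B_cover)
  let ?W = "W \<inter> cdom c"
  let ?W' = "{y \<in> ?W. \<phi> y \<in> cdom d}"
  have W0: "open ?W" "?W \<subseteq> cdom c \<inter> U i" using W chart_facts(3)[OF c(1)] by auto
  note 1 = trivialization_to_section[OF ij(1) c(1) d(1) W0 \<phi> smooth_fun_subset[OF sm]]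
  have "smooth_fun A ?W' (\<lambda>x. T j x (\<phi> x))"
    by (rule section_to_trivialization[OF ij(2) c(1) d(1) 1(1) _ _ _ 1(2)]) (use W \<phi> in auto)
  then show "\<exists>W'. open W' \<and> x \<in> W' \<and> smooth_fun A W' (\<lambda>x. T j x (\<phi> x))"
    using 1(1) x c d by (intro exI[of _ ?W']) auto
qed

lemma smooth_sections_iff:
  assumes \<phi>: "\<phi> \<in> sections F UNIV"
  shows "\<phi> \<in> smooth_sections A F B UNIV \<longleftrightarrow> (\<forall>i\<in>I. op_app (U i) (T i) \<phi> \<in> Cinf A (U i) (K i))"
proof -
  have \<phi>f: "\<phi> x \<in> fiber F x" for x using \<phi> by (simp add: sections_def)
  have C: "op_app (U i) (T i) \<phi> \<in> Cinf A (U i) (K i) \<longleftrightarrow> smooth_fun A (U i) (\<lambda>x. T i x (\<phi> x))" if "i \<in> I" for i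
    using smooth_fun_cong[of "U i" "op_app (U i) (T i) \<phi>" "\<lambda>x. T i x (\<phi> x)"] T_mem[OF that _ \<phi>f]
    by (auto simp: Cinf_iff op_app_def)
  show ?thesis
  proof
    assume "\<phi> \<in> smooth_sections A F B UNIV"
    then have sm: "openin (top_of_set (cmodel c)) (cmap c ` (cdom c \<inter> \<phi> -` cdom d))"
      "smooth_within (cmodel c) (cmap c ` (cdom c \<inter> \<phi> -` cdom d)) (cmap d \<circ> \<phi> \<circ> chart_inv c)"
      if "c \<in> A" "d \<in> B" for c d
      using that by (simp_all add: smooth_sections_def mfd_smooth_def Let_def)
    show "\<forall>i\<in>I. op_app (U i) (T i) \<phi> \<in> Cinf A (U i) (K i)"
    proof
      fix i assume i: "i \<in> I"
      have "smooth_fun A (U i) (\<lambda>x. T i x (\<phi> x))"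
      proof (rule smooth_fun_local)
        fix x assume x: "x \<in> U i"
        obtain c where c: "c \<in> A" "x \<in> cdom c" by (rule chart_exists)
        obtain d where d: "d \<in> B" "\<phi> x \<in> cdom d" by (rule B_cover)
        have "{y \<in> cdom c. cmap c y \<in> cmap c ` (cdom c \<inter> \<phi> -` cdom d)} = cdom c \<inter> \<phi> -` cdom d"
          using chart_facts(4)[OF c(1)] by (auto simp: inj_on_def)
        then have o: "open (cdom c \<inter> \<phi> -` cdom d)"
          using chart_preimage_open[OF c(1) sm(1)[OF c(1) d(1)]] by simp
        let ?W = "cdom c \<inter> \<phi> -` cdom d \<inter> U i"
        have "smooth_fun A ?W (\<lambda>x. T i x (\<phi> x))"
        proof (rule section_to_trivialization[OF i c(1) d(1)])
          show "open ?W" using o U_open[OF i] by auto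
          show "smooth_within (cmodel c) (cmap c ` ?W) (cmap d \<circ> \<phi> \<circ> chart_inv c)"
            by (rule smooth_within_subset[OF sm(2)[OF c(1) d(1)]]) auto
        qed (use \<phi>f in auto)
        then show "\<exists>W. open W \<and> x \<in> W \<and> smooth_fun A W (\<lambda>x. T i x (\<phi> x))"
          using o U_open[OF i] x c d by (intro exI[of _ ?W]) auto
      qed
      then show "op_app (U i) (T i) \<phi> \<in> Cinf A (U i) (K i)" using C[OF i] by simp
    qed
  next
    assume R: "\<forall>i\<in>I. op_app (U i) (T i) \<phi> \<in> Cinf A (U i) (K i)"
    have "openin (top_of_set (cmodel c)) (cmap c ` (cdom c \<inter> \<phi> -` cdom d)) \<and>
        smooth_within (cmodel c) (cmap c ` (cdom c \<inter> \<phi> -` cdom d)) (cmap d \<circ> \<phi> \<circ> chart_inv c)"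
      if c: "c \<in> A" and d: "d \<in> B" for c d
    proof
      let ?W = "\<lambda>i. {y \<in> cdom c \<inter> U i. \<phi> y \<in> cdom d}"
      have W: "open (?W i)" "smooth_within (cmodel c) (cmap c ` ?W i) (cmap d \<circ> \<phi> \<circ> chart_inv c)"
        if i: "i \<in> I" for i
      proof -
        have s: "smooth_fun A (cdom c \<inter> U i) (\<lambda>x. T i x (\<phi> x))"
          by (rule smooth_fun_subset[of "U i"]) (use R C[OF i] i in auto)
        have o: "open (cdom c \<inter> U i)" using chart_facts(3)[OF c] U_open[OF i] by auto
        show "open (?W i)" "smooth_within (cmodel c) (cmap c ` ?W i) (cmap d \<circ> \<phi> \<circ> chart_inv c)"
          using trivialization_to_section[OF i c d o order_refl \<phi>f s] by auto
      qed
      have eq: "cdom c \<inter> \<phi> -` cdom d = (\<Union>i\<in>I. ?W i)"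
      proof -
        have "\<exists>i\<in>I. x \<in> U i" for x using cover[of x] by metis
        then show ?thesis by auto
      qed
      have "open (\<Union>i\<in>I. ?W i)" using W(1) by (intro open_UN ballI)
      then show "openin (top_of_set (cmodel c)) (cmap c ` (cdom c \<inter> \<phi> -` cdom d))"
        unfolding eq by (intro chart_image_open[OF c]) auto
      show "smooth_within (cmodel c) (cmap c ` (cdom c \<inter> \<phi> -` cdom d)) (cmap d \<circ> \<phi> \<circ> chart_inv c)"
      proof (rule smooth_within_local[OF chart_facts(1)[OF c]])
        fix z assume "z \<in> cmap c ` (cdom c \<inter> \<phi> -` cdom d)"
        then obtain i where i: "i \<in> I" "z \<in> cmap c ` ?W i" unfolding eq by auto
        then show "\<exists>O'. openin (top_of_set (cmodel c)) O' \<and> z \<in> O' \<and> smooth_within (cmodel c) O' (cmap d \<circ> \<phi> \<circ> chart_inv c)"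
          using chart_image_open[OF c W(1)[OF i(1)]] W(2)[OF i(1)] by (intro exI[of _ "cmap c ` ?W i"]) auto
      qed
    qed
    then show "\<phi> \<in> smooth_sections A F B UNIV"
      using \<phi> by (simp add: smooth_sections_def mfd_smooth_def Let_def)
  qed
qed

text \<open>Cut \<open>f\<close> off near \<open>x\<close>, apply \<open>T\<^sub>i\<^sup>*\<close> and extend by zero; \<open>change_trivialization\<close> takes care of the other
  trivializations.\<close>

lemma section_extension:
  assumes i: "i \<in> I" and f: "f \<in> Cinf A (U i) (K i)" and x: "x \<in> U i"
  obtains \<phi> W where "\<phi> \<in> smooth_sections A F B UNIV" "open W" "x \<in> W" "W \<subseteq> U i"
    "\<And>y. y \<in> W \<Longrightarrow> T i y (\<phi> y) = f y"
proof -
  obtain \<theta> C V where t: "smooth_fun A UNIV (\<theta> :: 'm \<Rightarrow> real)" "closed C" "C \<subseteq> U i" "\<And>y. y \<notin> C \<Longrightarrow> \<theta> y = 0"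
    "open V" "x \<in> V" "V \<subseteq> C" "\<And>y. y \<in> V \<Longrightarrow> \<theta> y = 1"
    using bump_exists[OF U_open[OF i] x] by blast
  note Kf = closed_csubspace_facts[OF K_closed[OF i]]
  have fs: "smooth_fun A (U i) f" "\<And>y. y \<in> U i \<Longrightarrow> f y \<in> K i" using f by (auto simp: Cinf_iff)
  define \<phi> where "\<phi> y = (if y \<in> U i then adj F (T i) y (\<theta> y *\<^sub>R f y) else fzero F y)" for y
  have tK: "\<theta> y *\<^sub>R f y \<in> K i" if "y \<in> U i" for y using fs(2)[OF that] Kf(2) by (simp add: subspace_scale)
  have \<phi>f: "\<phi> y \<in> fiber F y" for y using adj_mem(1)[OF i _ tK] fib.zero_closed by (simp add: \<phi>_def)
  have T\<phi>: "T i y (\<phi> y) = \<theta> y *\<^sub>R f y" if "y \<in> U i" for y using adj_mem(2)[OF i that tK[OF that]] that by (simp add: \<phi>_def)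
  have "\<phi> y = fzero F y" if "y \<notin> C" for y
  proof (cases "y \<in> U i")
    case True
    then show ?thesis using t(4)[OF that] adj_T[OF i True fib.zero_closed] T_zero[OF i True] by (simp add: \<phi>_def)
  qed (simp add: \<phi>_def)
  then have out: "T j y (\<phi> y) = 0" if "j \<in> I" "y \<in> U j" "y \<notin> C" for j y using T_zero that by simp
  have sec: "\<phi> \<in> sections F UNIV" using \<phi>f by (simp add: sections_def)
  have smi: "smooth_fun A (U i) (\<lambda>y. T i y (\<phi> y))"
    using smooth_fun_bilinear[OF bounded_bilinear_scaleR U_open[OF i] smooth_fun_subset[OF t(1)] fs(1)]
    by (rule smooth_fun_cong[THEN iffD1, rotated]) (use T\<phi> in auto)
  have "op_app (U j) (T j) \<phi> \<in> Cinf A (U j) (K j)" if j: "j \<in> I" for j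
    unfolding Cinf_iff
  proof (intro conjI ballI allI impI)
    show "smooth_fun A (U j) (op_app (U j) (T j) \<phi>)"
    proof (rule smooth_fun_local)
      fix y assume y: "y \<in> U j"
      show "\<exists>W. open W \<and> y \<in> W \<and> smooth_fun A W (op_app (U j) (T j) \<phi>)"
      proof (cases "y \<in> U i")
        case True
        have o: "open (U i \<inter> U j)" using U_open i j by auto
        have "smooth_fun A (U i \<inter> U j) (\<lambda>x. T j x (\<phi> x))"
          by (rule change_trivialization[OF i j o order_refl \<phi>f smooth_fun_subset[OF smi]]) auto
        then have "smooth_fun A (U i \<inter> U j) (op_app (U j) (T j) \<phi>)"
          by (rule smooth_fun_cong[THEN iffD1, rotated]) (auto simp: op_app_def)
        then show ?thesis using o True y by blast
      next
        case False
        have "smooth_fun A (U j - C) (op_app (U j) (T j) \<phi>)"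
          by (rule smooth_fun_cong[THEN iffD1, OF _ smooth_fun_const[of _ 0]]) (use out[OF j] in \<open>auto simp: op_app_def\<close>)
        moreover have "open (U j - C)" using t(2) U_open[OF j] by auto
        ultimately show ?thesis using False y t(3) by blast
      qed
    qed
  qed (use T_mem[OF j _ \<phi>f] in \<open>auto simp: op_app_def\<close>)
  then have "\<phi> \<in> smooth_sections A F B UNIV" using smooth_sections_iff[OF sec] by blast
  moreover have "T i y (\<phi> y) = f y" if "y \<in> V" for y
    using T\<phi>[of y] t(3,7,8) that by auto
  ultimately show thesis using t by (intro that[of \<phi> V]) auto
qed

lemma Cinf_const: "i \<in> I \<Longrightarrow> v \<in> K i \<Longrightarrow> (\<lambda>x. if x \<in> U i then v else 0) \<in> Cinf A (U i) (K i)"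
  using smooth_fun_cong[of "U i" "\<lambda>x. if x \<in> U i then v else 0" "\<lambda>x. v"] smooth_fun_const[of "U i" v]
  by (simp add: Cinf_iff)

end

section \<open>Metric connections\<close>

lemma dense_orthogonal_eq_0:
  fixes k :: "'k::complex_hilbert"
  assumes dense: "\<And>e. e > 0 \<Longrightarrow> \<exists>y\<in>Y. norm (y - k) < e" and orth: "\<And>y. y \<in> Y \<Longrightarrow> cinner k y = 0"
  shows "k = 0"
proof (rule ccontr)
  assume "k \<noteq> 0"
  then obtain y where y: "y \<in> Y" "norm (y - k) < norm k" using dense[of "norm k"] by auto
  have "complex_of_real ((norm k)\<^sup>2) = cinner k (k - y)"
    using orth[OF y(1)] by (simp add: cinner_diff_right cinner_self)
  then have "(norm k)\<^sup>2 \<le> norm k * norm (k - y)"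
    using Cauchy_Schwarz_cinner[of k "k - y"] by (metis norm_of_real abs_of_nonneg zero_le_power2)
  then have "norm k \<le> norm (k - y)" using \<open>k \<noteq> 0\<close> by (simp add: power2_eq_square)
  then show False using y(2) by (simp add: norm_minus_commute)
qed

text \<open>Vectors of \<open>K\<close> are identified by their inner products with \<open>K\<close>; this is how all identities between
  \<open>K\<close>-valued expressions are derived from metric compatibility.\<close>

lemma orthogonal_subspace_eq:
  assumes K: "closed_csubspace K" "k \<in> K" "l \<in> K" and eq: "\<And>w. w \<in> K \<Longrightarrow> cinner k w = cinner l w"
  shows "k = l"
proof -
  have "k - l \<in> K" using closed_csubspace_facts(2)[OF K(1)] K by (simp add: subspace_diff)
  then have "cinner (k - l) (k - l) = 0" using eq by (simp add: cinner_diff_left)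
  then show ?thesis by (simp add: cinner_self)
qed

lemma vconj_vconj [simp]: "vconj (vconj X) = X"
  by (simp add: vconj_def)

lemma vagree_vconj: "vagree W X Y \<Longrightarrow> vagree W (vconj X) (vconj Y)"
  by (simp add: vagree_def vconj_def)

lemma vagree_subset: "vagree W X Y \<Longrightarrow> W' \<subseteq> W \<Longrightarrow> vagree W' X Y"
  by (auto simp: vagree_def)

lemma vagree_sym: "vagree W X Y \<Longrightarrow> vagree W Y X"
  by (simp add: vagree_def)

locale bundle_connection = hilbert_bundle A F B I U K T
  for A :: "('m::{t2_space, second_countable_topology}, 'e::euclidean_space) chart set"
    and F :: "('m, 'h) hfield" and B :: "('h, 'b::banach) chart set" and I :: "'i set" and U :: "'i \<Rightarrow> 'm set"
    and K :: "'i \<Rightarrow> 'k::complex_hilbert set" and T :: "'i \<Rightarrow> 'm \<Rightarrow> 'h \<Rightarrow> 'k" +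
  fixes G :: "('m \<Rightarrow> 'h) set" and nab :: "('m, 'e) vfield \<Rightarrow> ('m \<Rightarrow> 'h) \<Rightarrow> 'm \<Rightarrow> 'h"
  assumes G_sections: "G \<subseteq> sections F UNIV"
    and con: "connection_on A F G nab"
begin

lemma G_fiber: "\<phi> \<in> G \<Longrightarrow> \<phi> x \<in> fiber F x"
  using G_sections by (auto simp: sections_def)

lemma nab_mem: "X \<in> Vect A UNIV \<Longrightarrow> \<phi> \<in> G \<Longrightarrow> nab X \<phi> \<in> G"
  using con by (simp add: connection_on_def)

lemma nab_vadd: "X \<in> Vect A UNIV \<Longrightarrow> Y \<in> Vect A UNIV \<Longrightarrow> \<phi> \<in> G \<Longrightarrow> nab (vadd X Y) \<phi> = sadd F (nab X \<phi>) (nab Y \<phi>)"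
  using con by (simp add: connection_on_def)

lemma nab_vscale: "a \<in> Cfun A UNIV \<Longrightarrow> X \<in> Vect A UNIV \<Longrightarrow> \<phi> \<in> G \<Longrightarrow> nab (vscale a X) \<phi> = sscale F a (nab X \<phi>)"
  using con by (simp add: connection_on_def)

lemma nab_metric: "X \<in> Vect A UNIV \<Longrightarrow> \<phi> \<in> G \<Longrightarrow> \<psi> \<in> G \<Longrightarrow>
    vact A X (sinner F \<phi> \<psi>) x = sinner F (nab X \<phi>) \<psi> x + sinner F \<phi> (nab (vconj X) \<psi>) x"
  using con by (simp add: connection_on_def)

lemma sinner_smooth: "\<phi> \<in> G \<Longrightarrow> \<psi> \<in> G \<Longrightarrow> smooth_fun A V (sinner F \<phi> \<psi>)"
proof -
  assume "\<phi> \<in> G" "\<psi> \<in> G"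
  then have "sinner F \<phi> \<psi> \<in> Cfun A UNIV" using con by (simp add: connection_on_def)
  then show ?thesis by (intro smooth_fun_subset[of UNIV _ V]) (auto simp: Cinf_iff)
qed

text \<open>Linearity over the smooth functions makes the connection local in the vector field.\<close>

lemma nab_local:
  assumes X: "X \<in> Vect A UNIV" "Y \<in> Vect A UNIV" and \<phi>: "\<phi> \<in> G" and W: "open W" "x \<in> W" "vagree W X Y"
  shows "nab X \<phi> x = nab Y \<phi> x"
proof -
  obtain \<theta> C V where t: "smooth_fun A UNIV (\<theta> :: 'm \<Rightarrow> real)" "closed C" "C \<subseteq> W" "\<And>y. y \<notin> C \<Longrightarrow> \<theta> y = 0"
    "open V" "x \<in> V" "V \<subseteq> C" "\<And>y. y \<in> V \<Longrightarrow> \<theta> y = 1"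
    using bump_exists[OF W(1,2)] by blast
  let ?a = "\<lambda>y. complex_of_real (\<theta> y)"
  have a: "?a \<in> Cfun A UNIV"
    using smooth_fun_linear[OF bounded_linear_of_real open_UNIV t(1)] by (simp add: Cinf_iff)
  have "fst (vscale ?a X) c y = fst (vscale ?a Y) c y \<and> snd (vscale ?a X) c y = snd (vscale ?a Y) c y" for c y
    using W(3) t(3) t(4)[of y] by (cases "y \<in> C") (auto simp: vscale_def vagree_def)
  then have "vscale ?a X = vscale ?a Y" by (intro prod_eqI ext) auto
  then have "sscale F ?a (nab X \<phi>) x = sscale F ?a (nab Y \<phi>) x"
    using nab_vscale[OF a] X \<phi> by metis
  then show ?thesis
    using t(6,8) fib.scale_one[OF G_fiber[OF nab_mem[OF X(1) \<phi>]], of x]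
      fib.scale_one[OF G_fiber[OF nab_mem[OF X(2) \<phi>]], of x]
    by (simp add: sscale_def)
qed

text \<open>By locality, the extension of the vector field that is chosen in \<open>nabla_restr\<close> is immaterial, and
  one extension can be used at all points near \<open>x\<close>.\<close>

lemma nabla_restr_eq:
  assumes X: "X \<in> Vect A V" "open V" and Y: "Y \<in> Vect A UNIV" and W: "open W" "x \<in> W" "W \<subseteq> V" "vagree W Y X"
    and \<phi>: "\<phi> \<in> G"
  shows "nabla_restr A F nab V X \<phi> x = nab Y \<phi> x"
proof -
  let ?P = "\<lambda>Y. Y \<in> Vect A UNIV \<and> (\<exists>W. open W \<and> x \<in> W \<and> W \<subseteq> V \<and> vagree W Y X)"
  define Y' where "Y' = (SOME Y. ?P Y)"
  have "?P Y" using Y W by blast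
  then have "?P Y'" unfolding Y'_def by (rule someI)
  then obtain W' where W': "Y' \<in> Vect A UNIV" "open W'" "x \<in> W'" "vagree W' Y' X" by blast
  have "nab Y' \<phi> x = nab Y \<phi> x"
  proof (rule nab_local[OF W'(1) Y \<phi>])
    show "open (W \<inter> W')" "x \<in> W \<inter> W'" using W W' by auto
    show "vagree (W \<inter> W') Y' Y"
      using W(4) W'(4) by (auto simp: vagree_def)
  qed
  then show ?thesis using W by (auto simp: nabla_restr_def restr_def Y'_def)
qed

lemma sinner_T:
  "i \<in> I \<Longrightarrow> x \<in> U i \<Longrightarrow> \<phi> x \<in> fiber F x \<Longrightarrow> \<psi> x \<in> fiber F x \<Longrightarrow>
    sinner F \<phi> \<psi> x = cinner (T i x (\<phi> x)) (T i x (\<psi> x))"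
  by (simp add: sinner_def T_inner)

lemma locally_bounded:
  assumes "\<eta> \<in> G" "i \<in> I" "x \<in> U i"
  obtains W M where "open W" "x \<in> W" "W \<subseteq> U i" "M > 0" "\<And>y. y \<in> W \<Longrightarrow> norm (T i y (\<eta> y)) \<le> M"
proof -
  have cont: "continuous_on UNIV (sinner F \<eta> \<eta>)"
    by (intro smooth_fun_continuous open_UNIV sinner_smooth assms)
  define M where "M = cmod (sinner F \<eta> \<eta> x) + 1"
  have M: "M \<ge> 1" by (simp add: M_def)
  let ?W = "{y. cmod (sinner F \<eta> \<eta> y) < M} \<inter> U i"
  have "open {y. cmod (sinner F \<eta> \<eta> y) < M}"
    by (intro open_Collect_less continuous_on_norm cont continuous_on_const)
  then have "open ?W" using U_open[OF assms(2)] by auto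
  moreover have "norm (T i y (\<eta> y)) \<le> M" if "y \<in> ?W" for y
  proof -
    have "sinner F \<eta> \<eta> y = complex_of_real ((norm (T i y (\<eta> y)))\<^sup>2)"
      using sinner_T[OF assms(2), of y \<eta> \<eta>] G_fiber[OF assms(1)] that by (simp add: cinner_self)
    then have "cmod (sinner F \<eta> \<eta> y) = (norm (T i y (\<eta> y)))\<^sup>2" by (metis norm_of_real abs_of_nonneg zero_le_power2)
    then have "(norm (T i y (\<eta> y)))\<^sup>2 \<le> M" using that by simp
    also have "M \<le> M\<^sup>2" using M by (simp add: power2_eq_square)
    finally show ?thesis by (rule power2_le_imp_le) (use M in simp)
  qed
  moreover have "x \<in> ?W" using assms by (simp add: M_def)
  ultimately show thesis using M by (intro that[of ?W M]) auto
qed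

lemma sinner_uniform_limit:
  assumes i: "i \<in> I" "x \<in> U i" and \<eta>: "\<eta> \<in> G" and conv: "loc_unif_conv F (U i) t \<tau>"
    and f: "\<And>j y. y \<in> U i \<Longrightarrow> t j y \<in> fiber F y" "\<And>y. y \<in> U i \<Longrightarrow> \<tau> y \<in> fiber F y"
  obtains W where "open W" "x \<in> W" "W \<subseteq> U i"
    "uniform_limit W (\<lambda>j. sinner F (t j) \<eta>) (sinner F \<tau> \<eta>) sequentially"
proof -
  obtain W1 where W1: "open W1" "x \<in> W1" "W1 \<subseteq> U i"
    "uniform_limit W1 (\<lambda>j y. fdist F (t j y) (\<tau> y)) (\<lambda>y. 0) sequentially"
    using conv i unfolding loc_unif_conv_def by blast
  obtain W2 M where W2: "open W2" "x \<in> W2" "W2 \<subseteq> U i" "M > 0" "\<And>y. y \<in> W2 \<Longrightarrow> norm (T i y (\<eta> y)) \<le> M"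
    using locally_bounded[OF \<eta> i] by blast
  have "uniform_limit (W1 \<inter> W2) (\<lambda>j. sinner F (t j) \<eta>) (sinner F \<tau> \<eta>) sequentially"
  proof (rule uniform_limitI)
    fix e :: real assume "e > 0"
    then have "e / M > 0" using W2 by simp
    from uniform_limitD[OF W1(4) this]
    show "\<forall>\<^sub>F j in sequentially. \<forall>y\<in>W1 \<inter> W2. dist (sinner F (t j) \<eta> y) (sinner F \<tau> \<eta> y) < e"
    proof eventually_elim
      case (elim j)
      show ?case
      proof
        fix y assume y: "y \<in> W1 \<inter> W2"
        then have yU: "y \<in> U i" using W1 by auto
        have "sinner F (t j) \<eta> y - sinner F \<tau> \<eta> y = cinner (T i y (t j y) - T i y (\<tau> y)) (T i y (\<eta> y))"
          using sinner_T[OF i(1) yU, of "t j" \<eta>] sinner_T[OF i(1) yU, of \<tau> \<eta>] f(1)[OF yU, of j] f(2)[OF yU] G_fiber[OF \<eta>]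
          by (simp add: cinner_diff_left)
        then have "dist (sinner F (t j) \<eta> y) (sinner F \<tau> \<eta> y) \<le> norm (T i y (t j y) - T i y (\<tau> y)) * norm (T i y (\<eta> y))"
          using Cauchy_Schwarz_cinner by (simp add: dist_norm)
        also have "\<dots> = fdist F (t j y) (\<tau> y) * norm (T i y (\<eta> y))"
          using fdist_T[OF i(1) yU f(1)[OF yU, of j] f(2)[OF yU]] by simp
        also have "\<dots> \<le> fdist F (t j y) (\<tau> y) * M"
          using W2(5)[of y] y fdist_T[OF i(1) yU f(1)[OF yU, of j] f(2)[OF yU]] by (intro mult_left_mono) auto
        also have "\<dots> < e / M * M"
        proof (rule mult_strict_right_mono[OF _ W2(4)])
          show "fdist F (t j y) (\<tau> y) < e / M" using elim y by (auto simp: dist_real_def)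
        qed
        also have "\<dots> = e" using W2(4) by simp
        finally show "dist (sinner F (t j) \<eta> y) (sinner F \<tau> \<eta> y) < e" .
      qed
    qed
  qed
  moreover have "open (W1 \<inter> W2)" "x \<in> W1 \<inter> W2" "W1 \<inter> W2 \<subseteq> U i" using W1 W2 by auto
  ultimately show thesis using that by blast
qed

text \<open>For the approximating sections \<open>s j\<close> in place of \<open>\<psi>\<close> this is metric compatibility, and both terms on the
  right converge locally uniformly; the derivatives on the left converge to that of the limit by
  \<open>rvact_limit\<close>.  The section \<open>\<eta>\<close> is taken from the domain \<open>G\<close> of a connection that extends \<open>nabla\<close>, so that the
  lemma serves both for \<open>\<Gamma>\<close> itself and for the smooth sections of the bundle.\<close>

lemma metric_limit:
  assumes i: "i \<in> I" "x \<in> U i"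
    and \<Gamma>: "bundle_connection A F B I U K T \<Gamma> nabla" "\<Gamma> \<subseteq> G" "\<And>X \<phi>. X \<in> Vect A UNIV \<Longrightarrow> \<phi> \<in> \<Gamma> \<Longrightarrow> nab X \<phi> = nabla X \<phi>"
    and \<psi>: "\<psi> \<in> sections F (U i)" and s: "C1_approx A F \<Gamma> nabla (U i) \<psi> s"
    and X: "X \<in> Vect A (U i)" and \<xi>: "\<xi> \<in> sections F (U i)"
    and conv: "loc_unif_conv F (U i) (\<lambda>j. nabla_restr A F nabla (U i) X (s j)) \<xi>"
    and \<eta>: "\<eta> \<in> G" and sm: "smooth_fun A (U i) (sinner F \<psi> \<eta>)"
    and Y: "Y \<in> Vect A UNIV" "open W" "x \<in> W" "W \<subseteq> U i" "vagree W Y X"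
  shows "vact A X (sinner F \<psi> \<eta>) x = sinner F \<xi> \<eta> x + sinner F \<psi> (nab (vconj Y) \<eta>) x"
proof -
  interpret G0: bundle_connection A F B I U K T \<Gamma> nabla by (rule \<Gamma>(1))
  have sG: "s j \<in> \<Gamma>" for j using s by (simp add: C1_approx_def)
  have sG': "s j \<in> G" for j using sG \<Gamma>(2) by auto
  have convs: "loc_unif_conv F (U i) s \<psi>" using s by (simp add: C1_approx_def)
  have \<psi>f: "\<psi> y \<in> fiber F y" for y using \<psi> by (simp add: sections_def)
  have rf: "nabla_restr A F nabla (U i) Z (s j) y \<in> fiber F y"
    and rG: "\<And>Z' W'. Z' \<in> Vect A UNIV \<Longrightarrow> open W' \<Longrightarrow> y \<in> W' \<Longrightarrow> W' \<subseteq> U i \<Longrightarrow> vagree W' Z' Z \<Longrightarrow>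
       nabla_restr A F nabla (U i) Z (s j) y = nab Z' (s j) y"
    if Z: "Z \<in> Vect A (U i)" "y \<in> U i" for Z j y
  proof -
    show 1: "nabla_restr A F nabla (U i) Z (s j) y = nab Z' (s j) y"
      if "Z' \<in> Vect A UNIV" "open W'" "y \<in> W'" "W' \<subseteq> U i" "vagree W' Z' Z" for Z' W'
      using G0.nabla_restr_eq[OF Z(1) U_open[OF i(1)] that sG] \<Gamma>(3)[OF that(1) sG] by simp
    obtain Z' W' where Z': "Z' \<in> Vect A UNIV" "open W'" "y \<in> W'" "W' \<subseteq> U i" "vagree W' Z' Z"
      using Vect_extension[OF Z(1) U_open[OF i(1)] Z(2)] by blast
    show "nabla_restr A F nabla (U i) Z (s j) y \<in> fiber F y"
      unfolding 1[OF Z'] by (rule G_fiber[OF nab_mem[OF Z'(1) sG']])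
  qed
  have met: "vact A Z (sinner F (s j) \<eta>) y =
      sinner F (nabla_restr A F nabla (U i) Z (s j)) \<eta> y + sinner F (s j) (nab (vconj Z') \<eta>) y"
    if Z: "Z \<in> Vect A (U i)" "Z' \<in> Vect A UNIV" "open W'" "y \<in> W'" "W' \<subseteq> U i" "vagree W' Z' Z" for Z Z' W' j y
  proof -
    have "vact A Z (sinner F (s j) \<eta>) y = vact A Z' (sinner F (s j) \<eta>) y"
      by (rule vact_vagree[OF Z(6,4), symmetric])
    then show ?thesis
      using nab_metric[OF Z(2) sG' \<eta>] rG[OF Z(1) _ Z(2-6)] Z(4,5) by (auto simp: sinner_def)
  qed
  have lim: "(\<lambda>j. rvact A R (sinner F (s j) \<eta>) x) \<longlonglongrightarrow> rvact A R (sinner F \<psi> \<eta>) x"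
    if R: "R \<in> rVect A (U i)" for R
  proof -
    \<comment> \<open>\<open>rvact_limit\<close> is about real vector fields, so real and imaginary part of \<open>X\<close> are treated separately;
      the covariant derivatives along each of them converge by the definition of \<open>C1_approx\<close>.\<close>
    let ?Z = "(R, \<lambda>c x. 0 :: 'e)"
    have Z: "?Z \<in> Vect A (U i)" using R rVect_zero by (simp add: Vect_def)
    have vZ: "vact A ?Z f y = rvact A R f y" for f :: "'m \<Rightarrow> complex" and y by (simp add: vact_def rvact_zero)
    obtain \<xi>R where \<xi>R: "\<xi>R \<in> sections F (U i)" "loc_unif_conv F (U i) (\<lambda>j. nabla_restr A F nabla (U i) ?Z (s j)) \<xi>R"
      using s Z unfolding C1_approx_def by blast
    obtain Z' W0 where Z': "Z' \<in> Vect A UNIV" "open W0" "x \<in> W0" "W0 \<subseteq> U i" "vagree W0 Z' ?Z"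
      using Vect_extension[OF Z U_open[OF i(1)] i(2)] by blast
    have zG: "nab (vconj Z') \<eta> \<in> G" by (rule nab_mem[OF Vect_vconj[OF open_UNIV Z'(1)] \<eta>])
    have \<xi>Rf: "\<xi>R y \<in> fiber F y" for y using \<xi>R by (simp add: sections_def)
    obtain W1 where W1: "open W1" "x \<in> W1" "W1 \<subseteq> U i"
      "uniform_limit W1 (\<lambda>j. sinner F (nabla_restr A F nabla (U i) ?Z (s j)) \<eta>) (sinner F \<xi>R \<eta>) sequentially"
      by (rule sinner_uniform_limit[OF i \<eta> \<xi>R(2) rf[OF Z] \<xi>Rf])
    obtain W2 where W2: "open W2" "x \<in> W2" "W2 \<subseteq> U i"
      "uniform_limit W2 (\<lambda>j. sinner F (s j) (nab (vconj Z') \<eta>)) (sinner F \<psi> (nab (vconj Z') \<eta>)) sequentially"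
      by (rule sinner_uniform_limit[OF i zG convs G_fiber[OF sG'] \<psi>f])
    obtain W3 where W3: "open W3" "x \<in> W3" "W3 \<subseteq> U i"
      "uniform_limit W3 (\<lambda>j. sinner F (s j) \<eta>) (sinner F \<psi> \<eta>) sequentially"
      by (rule sinner_uniform_limit[OF i \<eta> convs G_fiber[OF sG'] \<psi>f])
    let ?W = "W0 \<inter> W1 \<inter> W2 \<inter> W3"
    let ?w = "\<lambda>y. sinner F \<xi>R \<eta> y + sinner F \<psi> (nab (vconj Z') \<eta>) y"
    have W: "open ?W" "x \<in> ?W" "?W \<subseteq> U i" using Z' W1 W2 W3 by auto
    have "uniform_limit ?W (\<lambda>j y. sinner F (nabla_restr A F nabla (U i) ?Z (s j)) \<eta> y + sinner F (s j) (nab (vconj Z') \<eta>) y) ?w sequentially"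
      by (intro uniform_limit_add uniform_limit_on_subset[OF W1(4)] uniform_limit_on_subset[OF W2(4)]) auto
    moreover have "sinner F (nabla_restr A F nabla (U i) ?Z (s j)) \<eta> y + sinner F (s j) (nab (vconj Z') \<eta>) y
        = rvact A R (sinner F (s j) \<eta>) y" if "y \<in> ?W" for j y
      using met[OF Z Z'(1,2) _ Z'(4,5), of y j] that vZ by auto
    ultimately have ul: "uniform_limit ?W (\<lambda>j. rvact A R (sinner F (s j) \<eta>)) ?w sequentially"
      by (rule uniform_limit_cong'[THEN iffD1, rotated 2]) auto
    have "rvact A R (sinner F \<psi> \<eta>) x = ?w x"
    proof (rule rvact_limit[OF W(1,2) R W(3)])
      show "uniform_limit ?W (\<lambda>j. sinner F (s j) \<eta>) (sinner F \<psi> \<eta>) sequentially"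
        by (rule uniform_limit_on_subset[OF W3(4)]) auto
    qed (use ul sinner_smooth[OF sG' \<eta>] smooth_fun_subset[OF sm W(3)] in auto)
    then show ?thesis using tendsto_uniform_limitI[OF ul W(2)] by simp
  qed
  have fs: "fst X \<in> rVect A (U i)" "snd X \<in> rVect A (U i)" using VectD[OF X] by auto
  have "(\<lambda>j. vact A X (sinner F (s j) \<eta>) x) \<longlonglongrightarrow> vact A X (sinner F \<psi> \<eta>) x"
    unfolding vact_def scaleC_complex_def
    by (intro tendsto_add tendsto_mult tendsto_const lim fs)
  moreover have "(\<lambda>j. vact A X (sinner F (s j) \<eta>) x) \<longlonglongrightarrow> sinner F \<xi> \<eta> x + sinner F \<psi> (nab (vconj Y) \<eta>) x"
  proof -
    have zG: "nab (vconj Y) \<eta> \<in> G" by (rule nab_mem[OF Vect_vconj[OF open_UNIV Y(1)] \<eta>])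
    have \<xi>f: "\<xi> y \<in> fiber F y" for y using \<xi> by (simp add: sections_def)
    obtain W1 where W1: "open W1" "x \<in> W1" "W1 \<subseteq> U i"
      "uniform_limit W1 (\<lambda>j. sinner F (nabla_restr A F nabla (U i) X (s j)) \<eta>) (sinner F \<xi> \<eta>) sequentially"
      by (rule sinner_uniform_limit[OF i \<eta> conv rf[OF X] \<xi>f])
    obtain W2 where W2: "open W2" "x \<in> W2" "W2 \<subseteq> U i"
      "uniform_limit W2 (\<lambda>j. sinner F (s j) (nab (vconj Y) \<eta>)) (sinner F \<psi> (nab (vconj Y) \<eta>)) sequentially"
      by (rule sinner_uniform_limit[OF i zG convs G_fiber[OF sG'] \<psi>f])
    show ?thesis
      unfolding met[OF X Y]
      by (intro tendsto_add tendsto_uniform_limitI[OF W1(4,2)] tendsto_uniform_limitI[OF W2(4,2)])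
  qed
  ultimately show ?thesis by (rule LIMSEQ_unique)
qed

end

section \<open>From a connection to the operators \<open>A\<^sub>i(X)\<close>\<close>

lemma vagree_vadd: "vagree W X' X \<Longrightarrow> vagree W Y' Y \<Longrightarrow> vagree W (vadd X' Y') (vadd X Y)"
  by (simp add: vagree_def vadd_def)

lemma vagree_vscale: "vagree W X' X \<Longrightarrow> (\<And>y. y \<in> W \<Longrightarrow> a' y = a y) \<Longrightarrow> vagree W (vscale a' X') (vscale a X)"
  by (simp add: vagree_def vscale_def)

text \<open>Multiplication by a cutoff function extends a germ to all of \<open>N\<close>.\<close>

lemma (in manifold) Cfun_extension:
  assumes a: "a \<in> Cfun A V" and V: "open V" "x \<in> V"
  obtains a' W where "a' \<in> Cfun A UNIV" "open W" "x \<in> W" "W \<subseteq> V" "\<And>y. y \<in> W \<Longrightarrow> a' y = a y"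
proof -
  obtain \<theta> C W where t: "smooth_fun A UNIV (\<theta> :: 'm \<Rightarrow> real)" "closed C" "C \<subseteq> V" "\<And>y. y \<notin> C \<Longrightarrow> \<theta> y = 0"
    "open W" "x \<in> W" "W \<subseteq> C" "\<And>y. y \<in> W \<Longrightarrow> \<theta> y = 1"
    using bump_exists[OF V] by blast
  let ?a = "\<lambda>y. \<theta> y *\<^sub>R a y"
  have "smooth_fun A UNIV ?a"
  proof (rule smooth_fun_local)
    fix y
    show "\<exists>W. open W \<and> y \<in> W \<and> smooth_fun A W ?a"
    proof (cases "y \<in> V")
      case True
      have "smooth_fun A V ?a"
        using a by (intro smooth_fun_bilinear[OF bounded_bilinear_scaleR V(1)] smooth_fun_subset[OF t(1)]) (auto simp: Cinf_iff)
      then show ?thesis using V(1) True by blast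
    next
      case False
      have "smooth_fun A (- C) ?a"
        by (rule smooth_fun_cong[THEN iffD1, OF _ smooth_fun_const[of _ 0]]) (simp add: t(4))
      then show ?thesis using False t(2,3) by blast
    qed
  qed
  then show thesis using t by (intro that[of ?a W]) (auto simp: Cinf_iff)
qed

lemma (in hilbert_bundle) smooth_section_fiber: "\<phi> \<in> smooth_sections A F B UNIV \<Longrightarrow> \<phi> x \<in> fiber F x"
  by (simp add: smooth_sections_def sections_def)

lemma (in hilbert_bundle) smooth_section_triv:
  assumes "\<phi> \<in> smooth_sections A F B UNIV" "i \<in> I"
  shows "op_app (U i) (T i) \<phi> \<in> Cinf A (U i) (K i)" "smooth_fun A (U i) (\<lambda>y. T i y (\<phi> y))"
proof -
  have "\<phi> \<in> sections F UNIV" using assms(1) by (simp add: smooth_sections_def)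
  then show 1: "op_app (U i) (T i) \<phi> \<in> Cinf A (U i) (K i)" using smooth_sections_iff assms by blast
  then have "smooth_fun A (U i) (op_app (U i) (T i) \<phi>)" by (simp add: Cinf_iff)
  then show "smooth_fun A (U i) (\<lambda>y. T i y (\<phi> y))"
    by (rule smooth_fun_cong[THEN iffD1, rotated]) (simp add: op_app_def)
qed

lemma (in hilbert_bundle) tau_T: "i \<in> I \<Longrightarrow> x \<in> U i \<Longrightarrow> v \<in> fiber F x \<Longrightarrow> tau F T i j x (T i x v) = T j x v"
  by (simp add: tau_def adj_T)

lemma (in hilbert_bundle) tau_add:
  assumes ij: "i \<in> I" "j \<in> I" and x: "x \<in> U i" "x \<in> U j" and vw: "v \<in> K i" "w \<in> K i"
  shows "tau F T i j x (v + w) = tau F T i j x v + tau F T i j x w"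
proof -
  note a = adj_mem[OF ij(1) x(1) vw(1)] adj_mem[OF ij(1) x(1) vw(2)]
  have "tau F T i j x (T i x (fadd F (adj F (T i) x v) (adj F (T i) x w)))
     = T j x (adj F (T i) x v) + T j x (adj F (T i) x w)"
    using tau_T[OF ij(1) x(1) fib.add_closed[OF a(1,3)], of j] T_add[OF ij(2) x(2) a(1,3)] by simp
  then show ?thesis using T_add[OF ij(1) x(1) a(1,3)] a(2,4) by (simp add: tau_def)
qed

locale smooth_connection = hilbert_bundle A F B I U K T
  for A :: "('m::{t2_space, second_countable_topology}, 'e::euclidean_space) chart set"
    and F :: "('m, 'h) hfield" and B :: "('h, 'b::banach) chart set" and I :: "'i set" and U :: "'i \<Rightarrow> 'm set"
    and K :: "'i \<Rightarrow> 'k::complex_hilbert set" and T :: "'i \<Rightarrow> 'm \<Rightarrow> 'h \<Rightarrow> 'k" +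
  fixes nab :: "('m, 'e) vfield \<Rightarrow> ('m \<Rightarrow> 'h) \<Rightarrow> 'm \<Rightarrow> 'h"
  assumes connection: "connection_on A F (smooth_sections A F B UNIV) nab"
begin

sublocale bundle_connection A F B I U K T "smooth_sections A F B UNIV" nab
  by unfold_locales (use connection in \<open>auto simp: smooth_sections_def\<close>)

definition const_section :: "'i \<Rightarrow> 'm \<Rightarrow> 'k \<Rightarrow> 'm \<Rightarrow> 'h" where
  "const_section i x v = (SOME \<phi>. \<phi> \<in> smooth_sections A F B UNIV \<and>
     (\<exists>W. open W \<and> x \<in> W \<and> W \<subseteq> U i \<and> (\<forall>y\<in>W. T i y (\<phi> y) = v)))"

definition vext :: "'m set \<Rightarrow> ('m, 'e) vfield \<Rightarrow> 'm \<Rightarrow> ('m, 'e) vfield" where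
  "vext V X x = (SOME Y. Y \<in> Vect A UNIV \<and> (\<exists>W. open W \<and> x \<in> W \<and> W \<subseteq> V \<and> vagree W Y X))"

text \<open>The derivative of the constant function \<open>v\<close> along \<open>X\<close> is zero, so \<open>T\<^sub>i \<nabla>\<^sub>X T\<^sub>i\<^sup>* v\<close> is the operator \<open>A\<^sub>i(X)\<close> applied
  to \<open>v\<close>.  The field \<open>X\<close> over \<open>U i\<close> and the section \<open>T\<^sub>i\<^sup>* v\<close> are replaced by global ones that agree with them near \<open>x\<close>.\<close>

definition conn_form :: "'i \<Rightarrow> ('m, 'e) vfield \<Rightarrow> 'm \<Rightarrow> 'k \<Rightarrow> 'k" where
  "conn_form i X x v = T i x (nab (vext (U i) X x) (const_section i x v) x)"

lemma const_section:
  assumes i: "i \<in> I" "x \<in> U i" and v: "v \<in> K i"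
  shows "const_section i x v \<in> smooth_sections A F B UNIV"
    and "\<exists>W. open W \<and> x \<in> W \<and> W \<subseteq> U i \<and> (\<forall>y\<in>W. T i y (const_section i x v y) = v)"
proof -
  obtain \<phi> W where W: "\<phi> \<in> smooth_sections A F B UNIV" "open W" "x \<in> W" "W \<subseteq> U i"
    "\<And>y. y \<in> W \<Longrightarrow> T i y (\<phi> y) = (if y \<in> U i then v else 0)"
    using section_extension[OF i(1) Cinf_const[OF i(1) v] i(2)] by blast
  have "T i y (\<phi> y) = v" if "y \<in> W" for y using W(4,5) that by auto
  then have "\<exists>\<phi>. \<phi> \<in> smooth_sections A F B UNIV \<and>
     (\<exists>W. open W \<and> x \<in> W \<and> W \<subseteq> U i \<and> (\<forall>y\<in>W. T i y (\<phi> y) = v))" using W by blast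
  from someI_ex[OF this, folded const_section_def]
  show "const_section i x v \<in> smooth_sections A F B UNIV"
    "\<exists>W. open W \<and> x \<in> W \<and> W \<subseteq> U i \<and> (\<forall>y\<in>W. T i y (const_section i x v y) = v)" by auto
qed

lemma T_const_section: "i \<in> I \<Longrightarrow> x \<in> U i \<Longrightarrow> v \<in> K i \<Longrightarrow> T i x (const_section i x v x) = v"
  using const_section(2) by blast

lemma vext:
  assumes X: "X \<in> Vect A V" "open V" "x \<in> V"
  shows "vext V X x \<in> Vect A UNIV" "\<exists>W. open W \<and> x \<in> W \<and> W \<subseteq> V \<and> vagree W (vext V X x) X"
proof -
  have "\<exists>Y. Y \<in> Vect A UNIV \<and> (\<exists>W. open W \<and> x \<in> W \<and> W \<subseteq> V \<and> vagree W Y X)"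
    using Vect_extension[OF X] by metis
  from someI_ex[OF this, folded vext_def]
  show "vext V X x \<in> Vect A UNIV" "\<exists>W. open W \<and> x \<in> W \<and> W \<subseteq> V \<and> vagree W (vext V X x) X" by auto
qed

lemma conn_form_mem:
  assumes i: "i \<in> I" "x \<in> U i" and X: "X \<in> Vect A (U i)" and v: "v \<in> K i"
  shows "conn_form i X x v \<in> K i"
  unfolding conn_form_def
  by (intro T_mem[OF i] G_fiber nab_mem vext[OF X U_open[OF i(1)] i(2)] const_section[OF i v])

lemma conn_form_ext:
  assumes i: "i \<in> I" "x \<in> U i" and X: "X \<in> Vect A (U i)" and v: "v \<in> K i"
    and Y: "Y \<in> Vect A UNIV" "open W" "x \<in> W" "vagree W Y X"
  shows "conn_form i X x v = T i x (nab Y (const_section i x v) x)"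
proof -
  obtain W' where W': "open W'" "x \<in> W'" "vagree W' (vext (U i) X x) X"
    using vext(2)[OF X U_open[OF i(1)] i(2)] by blast
  have "nab (vext (U i) X x) (const_section i x v) x = nab Y (const_section i x v) x"
  proof (rule nab_local[OF vext(1)[OF X U_open[OF i(1)] i(2)] Y(1) const_section(1)[OF i v]])
    show "open (W \<inter> W')" "x \<in> W \<inter> W'" using Y W' by auto
    show "vagree (W \<inter> W') (vext (U i) X x) Y" using Y(4) W'(3) by (auto simp: vagree_def)
  qed
  then show ?thesis by (simp add: conn_form_def)
qed

lemma vact_const_section:
  assumes i: "i \<in> I" "x \<in> U i" and X: "X \<in> Vect A (U i)" and w: "w \<in> K i"
    and g: "open V" "x \<in> V" "smooth_fun A V g"
  shows "vact A X (\<lambda>y. cinner (g y) (T i y (const_section i x w y))) x = cinner (vact A X g x) w"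
proof -
  obtain W where W: "open W" "x \<in> W" "\<And>y. y \<in> W \<Longrightarrow> T i y (const_section i x w y) = w"
    using const_section(2)[OF i w] by blast
  have "vact A X (\<lambda>y. cinner (g y) (T i y (const_section i x w y))) x = vact A X (\<lambda>y. cinner (g y) w) x"
    by (rule vact_cong[OF X i(2) W(1,2)]) (simp add: W(3))
  also have "\<dots> = cinner (vact A X g x) w"
    using vact_cinner[OF X i(2) g smooth_fun_const[of V w]] by (simp add: vact_const)
  finally show ?thesis .
qed

text \<open>Metric compatibility for two locally constant sections says that the connection form is skew.\<close>

lemma conn_form_skew:
  assumes i: "i \<in> I" "x \<in> U i" and X: "X \<in> Vect A (U i)" and vw: "v \<in> K i" "w \<in> K i"
  shows "cinner (conn_form i X x v) w = - cinner v (conn_form i (vconj X) x w)"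
proof -
  note c = const_section(1)[OF i vw(1)] const_section(1)[OF i vw(2)]
  obtain Y W where Y: "Y \<in> Vect A UNIV" "open W" "x \<in> W" "W \<subseteq> U i" "vagree W Y X"
    using Vect_extension[OF X U_open[OF i(1)] i(2)] by blast
  obtain W' where W': "open W'" "x \<in> W'" "W' \<subseteq> U i" "\<And>y. y \<in> W' \<Longrightarrow> T i y (const_section i x v y) = v"
    using const_section(2)[OF i vw(1)] by blast
  let ?\<phi> = "const_section i x v" and ?\<eta> = "const_section i x w"
  have "vact A Y (sinner F ?\<phi> ?\<eta>) x = vact A X (sinner F ?\<phi> ?\<eta>) x" by (rule vact_vagree[OF Y(5,3)])
  also have "\<dots> = vact A X (\<lambda>y. cinner (T i y (?\<phi> y)) (T i y (?\<eta> y))) x"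
    by (rule vact_cong[OF X i(2) U_open[OF i(1)] i(2)]) (intro sinner_T i G_fiber c)
  also have "\<dots> = cinner (vact A X (\<lambda>y. T i y (?\<phi> y)) x) w"
    by (rule vact_const_section[OF i X vw(2) U_open[OF i(1)] i(2) smooth_section_triv(2)[OF c(1) i(1)]])
  also have "vact A X (\<lambda>y. T i y (?\<phi> y)) x = vact A X (\<lambda>y. v) x"
    by (rule vact_cong[OF X i(2) W'(1,2)]) (rule W'(4))
  finally have "0 = sinner F (nab Y ?\<phi>) ?\<eta> x + sinner F ?\<phi> (nab (vconj Y) ?\<eta>) x"
    using nab_metric[OF Y(1) c, of x] by (simp add: vact_const)
  also have "sinner F (nab Y ?\<phi>) ?\<eta> x = cinner (T i x (nab Y ?\<phi> x)) (T i x (?\<eta> x))"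
    by (intro sinner_T i G_fiber nab_mem Y c)
  also have "sinner F ?\<phi> (nab (vconj Y) ?\<eta>) x = cinner (T i x (?\<phi> x)) (T i x (nab (vconj Y) ?\<eta> x))"
    by (intro sinner_T i G_fiber nab_mem Vect_vconj Y c open_UNIV)
  also have "T i x (nab Y ?\<phi> x) = conn_form i X x v" using conn_form_ext[OF i X vw(1) Y(1-3,5)] by simp
  also have "T i x (nab (vconj Y) ?\<eta> x) = conn_form i (vconj X) x w"
    using conn_form_ext[OF i Vect_vconj[OF U_open[OF i(1)] X] vw(2) Vect_vconj[OF open_UNIV Y(1)] Y(2,3) vagree_vconj[OF Y(5)]]
    by simp
  finally show ?thesis using T_const_section[OF i] vw by (simp add: eq_neg_iff_add_eq_0)
qed

text \<open>The product rule for \<open>\<langle>g, w\<rangle>\<close> with all constants \<open>w\<close>, together with skewness, determines the value of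
  the derivative of \<open>T\<^sub>i\<^sup>* g\<close>.  It is applied to covariant derivatives of smooth sections and to those defined
  by limits.\<close>

lemma conn_form_characterization:
  assumes i: "i \<in> I" "x \<in> U i" and X: "X \<in> Vect A (U i)" and z: "z \<in> K i"
    and g: "smooth_fun A (U i) g" "\<And>y. y \<in> U i \<Longrightarrow> g y \<in> K i"
    and eq: "\<And>w. w \<in> K i \<Longrightarrow> vact A X (\<lambda>y. cinner (g y) (T i y (const_section i x w y))) x =
        cinner z w + cinner (g x) (conn_form i (vconj X) x w)"
  shows "z = vact A X g x + conn_form i X x (g x)"
proof (rule orthogonal_subspace_eq[OF K_closed[OF i(1)] z])
  show "vact A X g x + conn_form i X x (g x) \<in> K i"
    by (intro closed_csubspace_facts(4)[OF K_closed[OF i(1)]] conn_form_mem[OF i X] g(2) i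
        vact_mem[OF X i(2) U_open[OF i(1)] i(2) g(1) K_closed[OF i(1)] g(2)])
  fix w assume w: "w \<in> K i"
  show "cinner z w = cinner (vact A X g x + conn_form i X x (g x)) w"
    using eq[OF w] vact_const_section[OF i X w U_open[OF i(1)] i(2) g(1)] conn_form_skew[OF i X g(2)[OF i(2)] w]
    by (simp add: cinner_add_left)
qed

lemma nab_triv:
  assumes i: "i \<in> I" "x \<in> U i" and X: "X \<in> Vect A (U i)" and \<phi>: "\<phi> \<in> smooth_sections A F B UNIV"
    and Y: "Y \<in> Vect A UNIV" "open W" "x \<in> W" "vagree W Y X"
  shows "T i x (nab Y \<phi> x) = vact A X (\<lambda>y. T i y (\<phi> y)) x + conn_form i X x (T i x (\<phi> x))"
proof (rule conn_form_characterization[OF i X])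
  show "T i x (nab Y \<phi> x) \<in> K i" by (intro T_mem[OF i] G_fiber nab_mem Y \<phi>)
  show "smooth_fun A (U i) (\<lambda>y. T i y (\<phi> y))" by (rule smooth_section_triv(2)[OF \<phi> i(1)])
  show "T i y (\<phi> y) \<in> K i" if "y \<in> U i" for y by (intro T_mem i that G_fiber \<phi>)
  fix w assume w: "w \<in> K i"
  let ?\<eta> = "const_section i x w"
  note \<eta> = const_section(1)[OF i w]
  have "vact A X (\<lambda>y. cinner (T i y (\<phi> y)) (T i y (?\<eta> y))) x = vact A X (sinner F \<phi> ?\<eta>) x"
    by (rule vact_cong[OF X i(2) U_open[OF i(1)] i(2)]) (intro sinner_T[symmetric] i G_fiber \<phi> \<eta>)
  also have "\<dots> = vact A Y (sinner F \<phi> ?\<eta>) x" by (rule vact_vagree[OF Y(4,3), symmetric])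
  also have "\<dots> = sinner F (nab Y \<phi>) ?\<eta> x + sinner F \<phi> (nab (vconj Y) ?\<eta>) x" by (rule nab_metric[OF Y(1) \<phi> \<eta>])
  also have "sinner F (nab Y \<phi>) ?\<eta> x = cinner (T i x (nab Y \<phi> x)) (T i x (?\<eta> x))"
    by (intro sinner_T i G_fiber nab_mem Y \<phi> \<eta>)
  also have "sinner F \<phi> (nab (vconj Y) ?\<eta>) x = cinner (T i x (\<phi> x)) (T i x (nab (vconj Y) ?\<eta> x))"
    by (intro sinner_T i G_fiber nab_mem Vect_vconj Y \<phi> \<eta> open_UNIV)
  also have "T i x (nab (vconj Y) ?\<eta> x) = conn_form i (vconj X) x w"
    using conn_form_ext[OF i Vect_vconj[OF U_open[OF i(1)] X] w Vect_vconj[OF open_UNIV Y(1)] Y(2,3) vagree_vconj[OF Y(4)]]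
    by simp
  also have "T i x (?\<eta> x) = w" by (rule T_const_section[OF i w])
  finally show "vact A X (\<lambda>y. cinner (T i y (\<phi> y)) (T i y (?\<eta> y))) x =
      cinner (T i x (nab Y \<phi> x)) w + cinner (T i x (\<phi> x)) (conn_form i (vconj X) x w)" .
qed

text \<open>Linearity and boundedness both come from the existence of the adjoint \<open>-A\<^sub>i(conj X)\<close>.\<close>

lemma conn_form_bounded_clinear:
  assumes i: "i \<in> I" "x \<in> U i" and X: "X \<in> Vect A (U i)"
  shows "bounded_clinear_on (K i) (conn_form i X x)"
proof -
  let ?L = "conn_form i X x" and ?M = "conn_form i (vconj X) x"
  have Xc: "vconj X \<in> Vect A (U i)" by (rule Vect_vconj[OF U_open[OF i(1)] X])
  note Kf = closed_csubspace_facts[OF K_closed[OF i(1)]]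
  note mem = conn_form_mem[OF i X] and memM = conn_form_mem[OF i Xc] and skew = conn_form_skew[OF i X]
  have add: "?L (v + w) = ?L v + ?L w" if "v \<in> K i" "w \<in> K i" for v w
    using that by (intro orthogonal_subspace_eq[OF K_closed[OF i(1)]] mem Kf(4)) (simp_all add: cinner_add_left skew Kf(4))
  have scale: "?L (a *\<^sub>C v) = a *\<^sub>C ?L v" if "v \<in> K i" for a v
    using that by (intro orthogonal_subspace_eq[OF K_closed[OF i(1)]] mem Kf(5)) (simp_all add: cinner_scaleC_left skew Kf(5))
  have "\<exists>C. \<forall>v\<in>K i. norm (?L v) \<le> C * norm v"
  proof (rule Hellinger_Toeplitz[OF K_closed[OF i(1)] mem _ add scale])
    show "- ?M v \<in> K i" if "v \<in> K i" for v using memM[OF that] Kf(2) by (simp add: subspace_neg)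
    show "cinner y (?L v) = cinner (- ?M y) v" if "v \<in> K i" "y \<in> K i" for v y
      using conn_form_skew[OF i Xc that(2,1)] by (simp add: cinner_minus_left)
  qed
  then show ?thesis using mem add scale by (simp add: bounded_clinear_on_def)
qed

lemma conn_form_Cinf:
  assumes i: "i \<in> I" and X: "X \<in> Vect A (U i)" and f: "f \<in> Cinf A (U i) (K i)"
  shows "op_app (U i) (conn_form i X) f \<in> Cinf A (U i) (K i)"
  unfolding Cinf_iff
proof (intro conjI ballI allI impI)
  have fs: "smooth_fun A (U i) f" "\<And>y. y \<in> U i \<Longrightarrow> f y \<in> K i" using f by (auto simp: Cinf_iff)
  show "op_app (U i) (conn_form i X) f x \<in> K i" if "x \<in> U i" for x
    using conn_form_mem[OF i that X fs(2)[OF that]] that by (simp add: op_app_def)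
  show "smooth_fun A (U i) (op_app (U i) (conn_form i X) f)"
  proof (rule smooth_fun_local)
    fix x assume x: "x \<in> U i"
    obtain \<phi> W where \<phi>: "\<phi> \<in> smooth_sections A F B UNIV" "open W" "x \<in> W" "W \<subseteq> U i" "\<And>y. y \<in> W \<Longrightarrow> T i y (\<phi> y) = f y"
      using section_extension[OF i f x] by blast
    obtain Y W' where Y: "Y \<in> Vect A UNIV" "open W'" "x \<in> W'" "W' \<subseteq> U i" "vagree W' Y X"
      using Vect_extension[OF X U_open[OF i] x] by blast
    let ?W = "W \<inter> W'"
    have W: "open ?W" "?W \<subseteq> U i" using \<phi> Y by auto
    have "smooth_fun A ?W (\<lambda>y. T i y (nab Y \<phi> y) - vact A X f y)"
    proof (rule smooth_fun_diff[OF W(1)])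
      show "smooth_fun A ?W (\<lambda>y. T i y (nab Y \<phi> y))"
        by (rule smooth_fun_subset[OF smooth_section_triv(2)[OF nab_mem[OF Y(1) \<phi>(1)] i] W(2)])
      have "smooth_fun A (U i) (vact A X f)" using vact_Cinf[OF U_open[OF i] X K_closed[OF i] f] by (simp add: Cinf_iff)
      then show "smooth_fun A ?W (vact A X f)" using W(2) by (rule smooth_fun_subset)
    qed
    moreover have "T i y (nab Y \<phi> y) - vact A X f y = op_app (U i) (conn_form i X) f y" if y: "y \<in> ?W" for y
    proof -
      have yU: "y \<in> U i" using y W by auto
      have "vact A X (\<lambda>y. T i y (\<phi> y)) y = vact A X f y"
        by (rule vact_cong[OF X yU \<phi>(2)]) (use y \<phi>(5) in auto)
      then show ?thesis using nab_triv[OF i yU X \<phi>(1) Y(1,2) _ Y(5)] y yU \<phi>(5)[of y] by (simp add: op_app_def)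
    qed
    ultimately have "smooth_fun A ?W (op_app (U i) (conn_form i X) f)"
      by (rule smooth_fun_cong[THEN iffD1, rotated])
    then show "\<exists>W. open W \<and> x \<in> W \<and> smooth_fun A W (op_app (U i) (conn_form i X) f)"
      using W \<phi> Y by (intro exI[of _ ?W]) auto
  qed
qed (simp add: op_app_def)

text \<open>Apply \<open>nab_triv\<close> in both trivializations to the same section.\<close>

lemma conn_form_tau:
  assumes ij: "i \<in> I" "j \<in> I" and X: "X \<in> Vect A (U i)" "Y \<in> Vect A (U j)"
    and W: "open W" "W \<subseteq> U i \<inter> U j" "vagree W X Y" and f: "f \<in> Cinf A (U i) (K i)" and x: "x \<in> W"
  shows "tau_hat A F U T i j X f x =
    tau F T i j x (conn_form i X x (f x)) - conn_form j Y x (tau F T i j x (f x))"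
proof -
  have xU: "x \<in> U i" "x \<in> U j" using W x by auto
  have fs: "smooth_fun A (U i) f" "\<And>y. y \<in> U i \<Longrightarrow> f y \<in> K i" using f by (auto simp: Cinf_iff)
  obtain \<phi> V where \<phi>: "\<phi> \<in> smooth_sections A F B UNIV" "open V" "x \<in> V" "V \<subseteq> U i" "\<And>y. y \<in> V \<Longrightarrow> T i y (\<phi> y) = f y"
    using section_extension[OF ij(1) f xU(1)] by blast
  obtain Z V' where Z: "Z \<in> Vect A UNIV" "open V'" "x \<in> V'" "V' \<subseteq> U i" "vagree V' Z X"
    using Vect_extension[OF X(1) U_open[OF ij(1)] xU(1)] by blast
  have ZY: "vagree (V' \<inter> W) Z Y" using Z(5) W(3) by (auto simp: vagree_def)
  have oW: "open (V' \<inter> W)" "x \<in> V' \<inter> W" using Z W x by auto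
  note nf = G_fiber[OF nab_mem[OF Z(1) \<phi>(1)]]
  have Ti: "T i x (nab Z \<phi> x) = vact A X f x + conn_form i X x (f x)"
  proof -
    have "vact A X (\<lambda>y. T i y (\<phi> y)) x = vact A X f x" by (rule vact_cong[OF X(1) xU(1) \<phi>(2,3,5)])
    then show ?thesis using nab_triv[OF ij(1) xU(1) X(1) \<phi>(1) Z(1-3,5)] \<phi>(5)[OF \<phi>(3)] by simp
  qed
  have \<tau>: "tau F T i j y (f y) = T j y (\<phi> y)" if "y \<in> V" for y
    using tau_T[OF ij(1), of y "\<phi> y" j] \<phi>(4,5) that G_fiber[OF \<phi>(1)] by (metis subsetD)
  have "vact A Y (\<lambda>y. T j y (\<phi> y)) x = vact A Y (op_app (U i \<inter> U j) (tau F T i j) f) x"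
    by (rule vact_cong[OF X(2) xU(2), of "V \<inter> U j"])
      (use \<phi> xU \<tau> U_open[OF ij(2)] in \<open>auto simp: op_app_def\<close>)
  also have "\<dots> = vact A X (op_app (U i \<inter> U j) (tau F T i j) f) x"
    by (rule vact_vagree[OF W(3) x, symmetric])
  finally have Tj: "T j x (nab Z \<phi> x) = vact A X (op_app (U i \<inter> U j) (tau F T i j) f) x + conn_form j Y x (tau F T i j x (f x))"
    using nab_triv[OF ij(2) xU(2) X(2) \<phi>(1) Z(1) oW ZY] \<tau>[OF \<phi>(3)] by simp
  have "T j x (nab Z \<phi> x) = tau F T i j x (vact A X f x + conn_form i X x (f x))"
    using tau_T[OF ij(1) xU(1) nf, of j] Ti by simp
  also have "\<dots> = tau F T i j x (vact A X f x) + tau F T i j x (conn_form i X x (f x))"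
  proof -
    have mem: "vact A X f x \<in> K i" "conn_form i X x (f x) \<in> K i"
      using vact_mem[OF X(1) xU(1) U_open[OF ij(1)] xU(1) fs(1) K_closed[OF ij(1)] fs(2)]
        conn_form_mem[OF ij(1) xU(1) X(1) fs(2)[OF xU(1)]] by auto
    then show ?thesis by (rule tau_add[OF ij xU])
  qed
  finally show ?thesis using Tj by (simp add: tau_hat_def algebra_simps)
qed

lemma conn_form_vadd:
  assumes i: "i \<in> I" "x \<in> U i" and X: "X \<in> Vect A (U i)" "Y \<in> Vect A (U i)" and v: "v \<in> K i"
  shows "conn_form i (vadd X Y) x v = conn_form i X x v + conn_form i Y x v"
proof -
  obtain X' W where X': "X' \<in> Vect A UNIV" "open W" "x \<in> W" "W \<subseteq> U i" "vagree W X' X"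
    using Vect_extension[OF X(1) U_open[OF i(1)] i(2)] by blast
  obtain Y' W' where Y': "Y' \<in> Vect A UNIV" "open W'" "x \<in> W'" "W' \<subseteq> U i" "vagree W' Y' Y"
    using Vect_extension[OF X(2) U_open[OF i(1)] i(2)] by blast
  note c = const_section(1)[OF i v]
  have "conn_form i (vadd X Y) x v = T i x (nab (vadd X' Y') (const_section i x v) x)"
    by (rule conn_form_ext[OF i Vect_vadd[OF U_open[OF i(1)] X] v Vect_vadd[OF open_UNIV X'(1) Y'(1)], of "W \<inter> W'"])
      (use X' Y' in \<open>auto intro!: vagree_vadd elim: vagree_subset\<close>)
  then show ?thesis
    using conn_form_ext[OF i X(1) v X'(1-3,5)] conn_form_ext[OF i X(2) v Y'(1-3,5)]
      T_add[OF i G_fiber[OF nab_mem[OF X'(1) c]] G_fiber[OF nab_mem[OF Y'(1) c]]]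
    by (simp add: nab_vadd[OF X'(1) Y'(1) c] sadd_def)
qed

lemma conn_form_vscale:
  assumes i: "i \<in> I" "x \<in> U i" and X: "X \<in> Vect A (U i)" and a: "a \<in> Cfun A (U i)" and v: "v \<in> K i"
  shows "conn_form i (vscale a X) x v = a x *\<^sub>C conn_form i X x v"
proof -
  obtain X' W where X': "X' \<in> Vect A UNIV" "open W" "x \<in> W" "W \<subseteq> U i" "vagree W X' X"
    using Vect_extension[OF X U_open[OF i(1)] i(2)] by blast
  obtain a' W' where a': "a' \<in> Cfun A UNIV" "open W'" "x \<in> W'" "W' \<subseteq> U i" "\<And>y. y \<in> W' \<Longrightarrow> a' y = a y"
    using Cfun_extension[OF a U_open[OF i(1)] i(2)] by blast
  note c = const_section(1)[OF i v]
  have sm: "smooth_fun A (U i) a" "smooth_fun A UNIV a'" using a a' by (auto simp: Cinf_iff)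
  have "conn_form i (vscale a X) x v = T i x (nab (vscale a' X') (const_section i x v) x)"
    by (rule conn_form_ext[OF i Vect_vscale[OF U_open[OF i(1)] X sm(1)] v Vect_vscale[OF open_UNIV X'(1) sm(2)], of "W \<inter> W'"])
      (use X' a' in \<open>auto intro!: vagree_vscale elim: vagree_subset\<close>)
  then show ?thesis
    using conn_form_ext[OF i X v X'(1-3,5)] T_scale[OF i G_fiber[OF nab_mem[OF X'(1) c]]] a'(3,5)
    by (simp add: nab_vscale[OF a'(1) X'(1) c] sscale_def)
qed

end

section \<open>From the operators \<open>A\<^sub>i(X)\<close> to a connection\<close>

text \<open>The conditions on \<open>A\<^sub>i(X)\<close>, stated for vectors \<open>v\<close> where the theorem has values \<open>f(x)\<close>; these exhaust \<open>K i\<close>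
  because constant functions are smooth.\<close>

locale connection_forms = hilbert_bundle A F B I U K T
  for A :: "('m::{t2_space, second_countable_topology}, 'e::euclidean_space) chart set"
    and F :: "('m, 'h) hfield" and B :: "('h, 'b::banach) chart set" and I :: "'i set" and U :: "'i \<Rightarrow> 'm set"
    and K :: "'i \<Rightarrow> 'k::complex_hilbert set" and T :: "'i \<Rightarrow> 'm \<Rightarrow> 'h \<Rightarrow> 'k" +
  fixes L :: "'i \<Rightarrow> ('m, 'e) vfield \<Rightarrow> 'm \<Rightarrow> 'k \<Rightarrow> 'k"
  assumes L_linear: "i \<in> I \<Longrightarrow> X \<in> Vect A (U i) \<Longrightarrow> x \<in> U i \<Longrightarrow> bounded_clinear_on (K i) (L i X x)"
    and L_Cinf: "i \<in> I \<Longrightarrow> X \<in> Vect A (U i) \<Longrightarrow> f \<in> Cinf A (U i) (K i) \<Longrightarrow> op_app (U i) (L i X) f \<in> Cinf A (U i) (K i)"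
    and L_tau: "i \<in> I \<Longrightarrow> j \<in> I \<Longrightarrow> X \<in> Vect A (U i) \<Longrightarrow> Y \<in> Vect A (U j) \<Longrightarrow> vagree (U i \<inter> U j) X Y \<Longrightarrow>
        f \<in> Cinf A (U i) (K i) \<Longrightarrow> x \<in> U i \<Longrightarrow> x \<in> U j \<Longrightarrow>
        tau_hat A F U T i j X f x = tau F T i j x (L i X x (f x)) - L j Y x (tau F T i j x (f x))"
    and L_vadd: "i \<in> I \<Longrightarrow> X \<in> Vect A (U i) \<Longrightarrow> Y \<in> Vect A (U i) \<Longrightarrow> x \<in> U i \<Longrightarrow> v \<in> K i \<Longrightarrow>
        L i (vadd X Y) x v = L i X x v + L i Y x v"
    and L_vscale: "i \<in> I \<Longrightarrow> X \<in> Vect A (U i) \<Longrightarrow> a \<in> Cfun A (U i) \<Longrightarrow> x \<in> U i \<Longrightarrow> v \<in> K i \<Longrightarrow>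
        L i (vscale a X) x v = a x *\<^sub>C L i X x v"
    and L_skew: "i \<in> I \<Longrightarrow> X \<in> Vect A (U i) \<Longrightarrow> x \<in> U i \<Longrightarrow> v \<in> K i \<Longrightarrow> w \<in> K i \<Longrightarrow>
        cinner (L i X x v) w = - cinner v (L i (vconj X) x w)"
begin

definition glued :: "('m, 'e) vfield \<Rightarrow> ('m \<Rightarrow> 'h) \<Rightarrow> 'm \<Rightarrow> 'h" where
  "glued X \<phi> x = (let i = (SOME i. i \<in> I \<and> x \<in> U i) in
     adj F (T i) x (vact A X (\<lambda>y. T i y (\<phi> y)) x + L i (vrestr (U i) X) x (T i x (\<phi> x))))"

abbreviation S where "S \<equiv> smooth_sections A F B UNIV"

context
  fixes X \<phi>
  assumes X: "X \<in> Vect A UNIV" and \<phi>: "\<phi> \<in> S"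
begin

lemma local_mem:
  assumes "i \<in> I" "x \<in> U i"
  shows "vact A X (\<lambda>y. T i y (\<phi> y)) x \<in> K i" "L i (vrestr (U i) X) x (T i x (\<phi> x)) \<in> K i"
proof -
  show "vact A X (\<lambda>y. T i y (\<phi> y)) x \<in> K i"
    by (rule vact_mem[OF X UNIV_I U_open[OF assms(1)] assms(2) smooth_section_triv(2)[OF \<phi> assms(1)] K_closed[OF assms(1)]])
      (rule T_mem[OF assms(1) _ smooth_section_fiber[OF \<phi>]])
  have "vrestr (U i) X \<in> Vect A (U i)" by (rule Vect_vrestr[OF X U_open[OF assms(1)]]) simp
  then show "L i (vrestr (U i) X) x (T i x (\<phi> x)) \<in> K i"
    using L_linear[OF assms(1) _ assms(2)] T_mem[OF assms smooth_section_fiber[OF \<phi>]] by (simp add: bounded_clinear_on_def)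
qed

text \<open>The formula defining \<open>glued\<close> in the chosen trivialization \<open>j\<close> holds in every trivialization \<open>i\<close>
  around \<open>x\<close>: the identity for \<open>\<tau>\<^sub>j\<^sub>i\<close> says that \<open>\<tau>\<^sub>j\<^sub>i\<close> intertwines \<open>X + A\<^sub>j(X)\<close> and \<open>X + A\<^sub>i(X)\<close>.\<close>

lemma glued_triv:
  assumes i: "i \<in> I" "x \<in> U i"
  shows "glued X \<phi> x \<in> fiber F x"
    and "T i x (glued X \<phi> x) = vact A X (\<lambda>y. T i y (\<phi> y)) x + L i (vrestr (U i) X) x (T i x (\<phi> x))"
proof -
  define j where "j = (SOME i. i \<in> I \<and> x \<in> U i)"
  have "\<exists>i. i \<in> I \<and> x \<in> U i" using i by blast
  from someI_ex[OF this, folded j_def] have j: "j \<in> I" "x \<in> U j" by auto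
  let ?a = "vact A X (\<lambda>y. T j y (\<phi> y)) x" and ?b = "L j (vrestr (U j) X) x (T j x (\<phi> x))"
  have g: "glued X \<phi> x = adj F (T j) x (?a + ?b)" by (simp add: glued_def j_def Let_def)
  note mem = local_mem[OF j]
  have ab: "?a + ?b \<in> K j" using closed_csubspace_facts(4)[OF K_closed[OF j(1)]] mem by blast
  show "glued X \<phi> x \<in> fiber F x" unfolding g by (rule adj_mem(1)[OF j ab])
  let ?f = "op_app (U j) (T j) \<phi>"
  have f: "?f \<in> Cinf A (U j) (K j)" by (rule smooth_section_triv(1)[OF \<phi> j(1)])
  have XV: "vrestr (U k) X \<in> Vect A (U k)" if "k \<in> I" for k by (rule Vect_vrestr[OF X U_open[OF that]]) simp
  have \<tau>: "tau F T j i y (T j y (\<phi> y)) = T i y (\<phi> y)" if "y \<in> U j" for y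
    by (rule tau_T[OF j(1) that smooth_section_fiber[OF \<phi>]])
  have o: "open (U j \<inter> U i)" using U_open i j by auto
  have 1: "vact A (vrestr (U j) X) (op_app (U j \<inter> U i) (tau F T j i) ?f) x = vact A X (\<lambda>y. T i y (\<phi> y)) x"
    unfolding vact_vrestr[OF j(2)]
    by (rule vact_cong[OF X UNIV_I o]) (use i j \<tau> in \<open>auto simp: op_app_def\<close>)
  have 2: "vact A (vrestr (U j) X) ?f x = ?a"
    unfolding vact_vrestr[OF j(2)]
    by (rule vact_cong[OF X UNIV_I U_open[OF j(1)] j(2)]) (simp add: op_app_def)
  have fx: "?f x = T j x (\<phi> x)" using j by (simp add: op_app_def)
  have "vagree (U j \<inter> U i) (vrestr (U j) X) (vrestr (U i) X)" by (auto simp: vagree_def vrestr_def)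
  from L_tau[OF j(1) i(1) XV[OF j(1)] XV[OF i(1)] this f j(2) i(2)]
  have "vact A X (\<lambda>y. T i y (\<phi> y)) x - tau F T j i x ?a =
      tau F T j i x ?b - L i (vrestr (U i) X) x (T i x (\<phi> x))"
    by (simp only: tau_hat_def 1 2 fx \<tau>[OF j(2)])
  moreover have "T i x (glued X \<phi> x) = tau F T j i x ?a + tau F T j i x ?b"
    unfolding g tau_add[OF j(1) i(1) j(2) i(2) mem, symmetric] by (simp add: tau_def)
  ultimately show "T i x (glued X \<phi> x) = vact A X (\<lambda>y. T i y (\<phi> y)) x + L i (vrestr (U i) X) x (T i x (\<phi> x))"
    by (simp add: algebra_simps)
qed

lemma glued_fiber: "glued X \<phi> x \<in> fiber F x"
  using cover[of x] glued_triv(1) by metis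

lemma glued_smooth: "glued X \<phi> \<in> S"
proof (rule smooth_sections_iff[THEN iffD2], simp add: sections_def glued_fiber, rule ballI)
  fix i assume i: "i \<in> I"
  let ?f = "op_app (U i) (T i) \<phi>" and ?X = "vrestr (U i) X"
  have f: "?f \<in> Cinf A (U i) (K i)" by (rule smooth_section_triv(1)[OF \<phi> i])
  have XV: "?X \<in> Vect A (U i)" by (rule Vect_vrestr[OF X U_open[OF i]]) simp
  have sm: "smooth_fun A (U i) (\<lambda>x. vact A ?X ?f x + op_app (U i) (L i ?X) ?f x)"
    using vact_Cinf[OF U_open[OF i] XV K_closed[OF i] f] L_Cinf[OF i XV f]
    by (intro smooth_fun_add[OF U_open[OF i]]) (auto simp: Cinf_iff)
  have "vact A ?X ?f x + op_app (U i) (L i ?X) ?f x = op_app (U i) (T i) (glued X \<phi>) x" if x: "x \<in> U i" for x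
  proof -
    have "vact A ?X ?f x = vact A X (\<lambda>y. T i y (\<phi> y)) x"
      unfolding vact_vrestr[OF x]
      by (rule vact_cong[OF X UNIV_I U_open[OF i] x]) (simp add: op_app_def)
    then show ?thesis using glued_triv(2)[OF i x] x by (simp add: op_app_def)
  qed
  then have "smooth_fun A (U i) (op_app (U i) (T i) (glued X \<phi>))"
    using smooth_fun_cong[THEN iffD1, OF _ sm] by blast
  then show "op_app (U i) (T i) (glued X \<phi>) \<in> Cinf A (U i) (K i)"
    using T_mem[OF i _ glued_fiber] by (auto simp: Cinf_iff op_app_def)
qed

end

lemma smooth_sections_sscale:
  assumes a: "a \<in> Cfun A UNIV" and \<phi>: "\<phi> \<in> S"
  shows "sscale F a \<phi> \<in> S"
proof (rule smooth_sections_iff[THEN iffD2])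
  note \<phi>f = smooth_section_fiber[OF \<phi>]
  have f: "sscale F a \<phi> x \<in> fiber F x" for x unfolding sscale_def by (rule fib.scale_closed[OF \<phi>f])
  then show "sscale F a \<phi> \<in> sections F UNIV" by (simp add: sections_def)
  show "\<forall>i\<in>I. op_app (U i) (T i) (sscale F a \<phi>) \<in> Cinf A (U i) (K i)"
  proof
    fix i assume i: "i \<in> I"
    have "smooth_fun A (U i) (\<lambda>y. a y *\<^sub>C T i y (\<phi> y))"
      by (rule smooth_fun_bilinear[OF bounded_bilinear_scaleC U_open[OF i] smooth_fun_subset[of UNIV]
            smooth_section_triv(2)[OF \<phi> i]]) (use a in \<open>auto simp: Cinf_iff\<close>)
    then have "smooth_fun A (U i) (op_app (U i) (T i) (sscale F a \<phi>))"
      by (rule smooth_fun_cong[THEN iffD1, rotated]) (simp add: op_app_def sscale_def T_scale[OF i _ \<phi>f])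
    then show "op_app (U i) (T i) (sscale F a \<phi>) \<in> Cinf A (U i) (K i)"
      using T_mem[OF i _ f] by (auto simp: Cinf_iff op_app_def)
  qed
qed

lemma section_eqI:
  assumes "\<And>x. \<phi> x \<in> fiber F x" "\<And>x. \<psi> x \<in> fiber F x"
    and "\<And>i x. i \<in> I \<Longrightarrow> x \<in> U i \<Longrightarrow> T i x (\<phi> x) = T i x (\<psi> x)"
  shows "\<phi> = \<psi>"
proof
  fix x
  obtain i where "i \<in> I" "x \<in> U i" by (rule cover)
  then show "\<phi> x = \<psi> x" using T_inj assms by blast
qed

lemma glued_connection: "connection_on A F S glued"
proof -
  note fb = smooth_section_fiber and sm = smooth_section_triv(2)
  have TK: "T i x (\<phi> x) \<in> K i" if "\<phi> \<in> S" "i \<in> I" "x \<in> U i" for \<phi> i x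
    by (rule T_mem[OF that(2,3) fb[OF that(1)]])
  have VX: "vrestr (U i) X \<in> Vect A (U i)" if "X \<in> Vect A UNIV" "i \<in> I" for X i
    by (rule Vect_vrestr[OF that(1) U_open[OF that(2)]]) simp
  have C2: "glued (vadd X Y) \<phi> = sadd F (glued X \<phi>) (glued Y \<phi>)"
    if X: "X \<in> Vect A UNIV" "Y \<in> Vect A UNIV" and \<phi>: "\<phi> \<in> S" for X Y \<phi>
  proof (rule section_eqI)
    note XY = Vect_vadd[OF open_UNIV X]
    note gX = glued_fiber[OF X(1) \<phi>] and gY = glued_fiber[OF X(2) \<phi>]
    show "glued (vadd X Y) \<phi> x \<in> fiber F x" for x by (rule glued_fiber[OF XY \<phi>])
    show "sadd F (glued X \<phi>) (glued Y \<phi>) x \<in> fiber F x" for x unfolding sadd_def by (rule fib.add_closed[OF gX gY])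
    fix i x assume i: "i \<in> I" "x \<in> U i"
    have "vrestr (U i) (vadd X Y) = vadd (vrestr (U i) X) (vrestr (U i) Y)" by (auto simp: vrestr_def vadd_def fun_eq_iff)
    then show "T i x (glued (vadd X Y) \<phi> x) = T i x (sadd F (glued X \<phi>) (glued Y \<phi>) x)"
      using glued_triv(2)[OF XY \<phi> i] glued_triv(2)[OF X(1) \<phi> i] glued_triv(2)[OF X(2) \<phi> i]
        vact_vadd[OF X U_open[OF i(1)] i(2) sm[OF \<phi> i(1)]] L_vadd[OF i(1) VX[OF X(1) i(1)] VX[OF X(2) i(1)] i(2) TK[OF \<phi> i]]
      by (simp add: sadd_def T_add[OF i gX gY])
  qed
  have C3: "glued (vscale a X) \<phi> = sscale F a (glued X \<phi>)"
    if a: "a \<in> Cfun A UNIV" and X: "X \<in> Vect A UNIV" and \<phi>: "\<phi> \<in> S" for a X \<phi>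
  proof (rule section_eqI)
    have as: "smooth_fun A UNIV a" using a by (simp add: Cinf_iff)
    note aX = Vect_vscale[OF open_UNIV X as] and gX = glued_fiber[OF X \<phi>]
    show "glued (vscale a X) \<phi> x \<in> fiber F x" for x by (rule glued_fiber[OF aX \<phi>])
    show "sscale F a (glued X \<phi>) x \<in> fiber F x" for x unfolding sscale_def by (rule fib.scale_closed[OF gX])
    fix i x assume i: "i \<in> I" "x \<in> U i"
    let ?a = "\<lambda>y. if y \<in> U i then a y else 0"
    have "smooth_fun A (U i) ?a"
      by (rule smooth_fun_cong[THEN iffD1, OF _ smooth_fun_subset[OF as]]) auto
    then have a': "?a \<in> Cfun A (U i)" by (simp add: Cinf_iff)
    have "vrestr (U i) (vscale a X) = vscale ?a (vrestr (U i) X)" by (auto simp: vrestr_def vscale_def fun_eq_iff)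
    then show "T i x (glued (vscale a X) \<phi> x) = T i x (sscale F a (glued X \<phi>) x)"
      using glued_triv(2)[OF aX \<phi> i] glued_triv(2)[OF X \<phi> i]
        vact_vscale[OF X U_open[OF i(1)] i(2) sm[OF \<phi> i(1)], of a] L_vscale[OF i(1) VX[OF X i(1)] a' i(2) TK[OF \<phi> i]] i(2)
      by (simp add: sscale_def T_scale[OF i gX] scaleC_add_right)
  qed
  have C4: "glued X (sscale F a \<phi>) = sadd F (sscale F (vact A X a) \<phi>) (sscale F a (glued X \<phi>))"
    if a: "a \<in> Cfun A UNIV" and X: "X \<in> Vect A UNIV" and \<phi>: "\<phi> \<in> S" for a X \<phi>
  proof (rule section_eqI)
    note a\<phi> = smooth_sections_sscale[OF a \<phi>] and gX = glued_fiber[OF X \<phi>]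
    note cl = fib.scale_closed[OF fb[OF \<phi>]] fib.scale_closed[OF gX]
    show "glued X (sscale F a \<phi>) x \<in> fiber F x" for x by (rule glued_fiber[OF X a\<phi>])
    show "sadd F (sscale F (vact A X a) \<phi>) (sscale F a (glued X \<phi>)) x \<in> fiber F x" for x
      unfolding sadd_def sscale_def by (rule fib.add_closed[OF cl])
    fix i x assume i: "i \<in> I" "x \<in> U i"
    have as: "smooth_fun A (U i) a" using a smooth_fun_subset[of UNIV a "U i"] by (simp add: Cinf_iff)
    have "vact A X (\<lambda>y. T i y (sscale F a \<phi> y)) x = vact A X (\<lambda>y. a y *\<^sub>C T i y (\<phi> y)) x"
      by (rule vact_cong[OF X UNIV_I U_open[OF i(1)] i(2)]) (simp add: sscale_def T_scale[OF i(1) _ fb[OF \<phi>]])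
    also have "\<dots> = vact A X a x *\<^sub>C T i x (\<phi> x) + a x *\<^sub>C vact A X (\<lambda>y. T i y (\<phi> y)) x"
      by (rule vact_scaleC[OF X UNIV_I U_open[OF i(1)] i(2) as sm[OF \<phi> i(1)]])
    finally show "T i x (glued X (sscale F a \<phi>) x) = T i x (sadd F (sscale F (vact A X a) \<phi>) (sscale F a (glued X \<phi>)) x)"
      using glued_triv(2)[OF X a\<phi> i] glued_triv(2)[OF X \<phi> i] L_linear[OF i(1) VX[OF X i(1)] i(2)] TK[OF \<phi> i]
      by (simp add: sadd_def sscale_def T_add[OF i cl] T_scale[OF i gX] T_scale[OF i fb[OF \<phi>]] bounded_clinear_on_def scaleC_add_right)
  qed
  have inner: "sinner F \<phi> \<psi> x = cinner (T i x (\<phi> x)) (T i x (\<psi> x))"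
    if "\<And>y. \<phi> y \<in> fiber F y" "\<And>y. \<psi> y \<in> fiber F y" "i \<in> I" "x \<in> U i" for \<phi> \<psi> i x
    using T_inner[OF that(3,4,1,2)] by (simp add: sinner_def)
  have C5: "sinner F \<phi> \<psi> \<in> Cfun A UNIV" if \<phi>: "\<phi> \<in> S" "\<psi> \<in> S" for \<phi> \<psi>
  proof -
    have "smooth_fun A UNIV (sinner F \<phi> \<psi>)"
    proof (rule smooth_fun_local)
      fix x
      obtain i where i: "i \<in> I" "x \<in> U i" by (rule cover)
      have "smooth_fun A (U i) (\<lambda>y. cinner (T i y (\<phi> y)) (T i y (\<psi> y)))"
        by (intro smooth_fun_bilinear[OF bounded_bilinear_cinner U_open[OF i(1)]] sm i \<phi>)
      then have "smooth_fun A (U i) (sinner F \<phi> \<psi>)"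
        by (rule smooth_fun_cong[THEN iffD1, rotated]) (intro inner[symmetric] fb \<phi> i)
      then show "\<exists>W. open W \<and> x \<in> W \<and> smooth_fun A W (sinner F \<phi> \<psi>)" using U_open i by blast
    qed
    then show ?thesis by (simp add: Cinf_iff)
  qed
  have C6: "vact A X (sinner F \<phi> \<psi>) x = sinner F (glued X \<phi>) \<psi> x + sinner F \<phi> (glued (vconj X) \<psi>) x"
    if X: "X \<in> Vect A UNIV" and \<phi>: "\<phi> \<in> S" "\<psi> \<in> S" for X \<phi> \<psi> x
  proof -
    obtain i where i: "i \<in> I" "x \<in> U i" by (rule cover)
    note Xc = Vect_vconj[OF open_UNIV X]
    have "vrestr (U i) (vconj X) = vconj (vrestr (U i) X)" by (auto simp: vrestr_def vconj_def fun_eq_iff)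
    note skew = L_skew[OF i(1) VX[OF X i(1)] i(2) TK[OF \<phi>(1) i] TK[OF \<phi>(2) i], folded this]
    have "vact A X (sinner F \<phi> \<psi>) x = vact A X (\<lambda>y. cinner (T i y (\<phi> y)) (T i y (\<psi> y))) x"
      by (rule vact_cong[OF X UNIV_I U_open[OF i(1)] i(2)]) (intro inner fb \<phi> i)
    also have "\<dots> = cinner (vact A X (\<lambda>y. T i y (\<phi> y)) x) (T i x (\<psi> x)) + cinner (T i x (\<phi> x)) (vact A (vconj X) (\<lambda>y. T i y (\<psi> y)) x)"
      by (rule vact_cinner[OF X UNIV_I U_open[OF i(1)] i(2) sm[OF \<phi>(1) i(1)] sm[OF \<phi>(2) i(1)]])
    also have "\<dots> = cinner (T i x (glued X \<phi> x)) (T i x (\<psi> x)) + cinner (T i x (\<phi> x)) (T i x (glued (vconj X) \<psi> x))"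
      using skew by (simp add: glued_triv(2)[OF X \<phi>(1) i] glued_triv(2)[OF Xc \<phi>(2) i] cinner_add_left cinner_add_right)
    finally show ?thesis
      using inner[OF glued_fiber[OF X \<phi>(1)] fb[OF \<phi>(2)] i] inner[OF fb[OF \<phi>(1)] glued_fiber[OF Xc \<phi>(2)] i] by simp
  qed
  show ?thesis unfolding connection_on_def
    by (intro conjI ballI allI) (assumption | rule glued_smooth C2 C3 C4 C5 C6)+
qed

end

section \<open>Covariant derivatives in a trivialization\<close>

locale smooth_hilbert_field = hilbert_bundle A F B I U K T
  for A :: "('m::{t2_space, second_countable_topology}, 'e::euclidean_space) chart set"
    and F :: "('m, 'h) hfield" and B :: "('h, 'b::banach) chart set" and I :: "'i set" and U :: "'i \<Rightarrow> 'm set"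
    and K :: "'i \<Rightarrow> 'k::complex_hilbert set" and T :: "'i \<Rightarrow> 'm \<Rightarrow> 'h \<Rightarrow> 'k" +
  fixes \<Gamma> :: "('m \<Rightarrow> 'h) set" and nabla :: "('m, 'e) vfield \<Rightarrow> ('m \<Rightarrow> 'h) \<Rightarrow> 'm \<Rightarrow> 'h"
    and D :: "'i \<Rightarrow> ('m \<Rightarrow> 'k) set"
  assumes smooth: "smooth_field A F \<Gamma> nabla"
    and D_dense: "i \<in> I \<Longrightarrow> dense_smooth_subspace A (U i) (K i) (D i)"
    and T_smooth: "i \<in> I \<Longrightarrow> smooth_op_field A F \<Gamma> nabla (U i) (K i) (D i) (T i)"
begin

sublocale \<Gamma>: bundle_connection A F B I U K T \<Gamma> nabla
  using smooth by unfold_locales (auto simp: smooth_field_def)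

lemma \<Gamma>_smooth_sections: "\<Gamma> \<subseteq> smooth_sections A F B UNIV"
proof
  fix \<phi> assume \<phi>: "\<phi> \<in> \<Gamma>"
  have "op_app (U i) (T i) \<phi> \<in> Cinf A (U i) (K i)" if "i \<in> I" for i
  proof -
    have "op_app (U i) (T i) (restr F (U i) \<phi>) \<in> Cinf A (U i) (K i)"
      using T_smooth[OF that] \<phi> by (simp add: smooth_op_field_def)
    moreover have "op_app (U i) (T i) (restr F (U i) \<phi>) = op_app (U i) (T i) \<phi>"
      by (auto simp: op_app_def restr_def)
    ultimately show ?thesis by simp
  qed
  then show "\<phi> \<in> smooth_sections A F B UNIV"
    using smooth_sections_iff \<Gamma>.G_sections \<phi> by blast
qed

lemma \<Gamma>_dense:
  assumes i: "i \<in> I" "x \<in> U i" and v: "v \<in> K i" and e: "e > 0"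
  shows "\<exists>y\<in>(\<lambda>\<phi>. T i x (\<phi> x)) ` \<Gamma>. norm (y - v) < e"
proof -
  have "\<forall>x. \<forall>v\<in>fiber F x. \<forall>e>0. \<exists>\<phi>\<in>\<Gamma>. fdist F (\<phi> x) v < e" using smooth by (simp add: smooth_field_def)
  then obtain \<phi> where \<phi>: "\<phi> \<in> \<Gamma>" "fdist F (\<phi> x) (adj F (T i) x v) < e" using adj_mem(1)[OF i v] e by blast
  then have "norm (T i x (\<phi> x) - v) < e"
    using fdist_T[OF i \<Gamma>.G_fiber[OF \<phi>(1)] adj_mem(1)[OF i v]] adj_mem(2)[OF i v] by simp
  then show ?thesis using \<phi> by blast
qed

lemma D_Cinf: "i \<in> I \<Longrightarrow> f \<in> D i \<Longrightarrow> f \<in> Cinf A (U i) (K i)"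
  using D_dense[of i] by (auto simp: dense_smooth_subspace_def)

text \<open>Evaluation at \<open>x\<close> is continuous: the seminorm for the compact set \<open>{x}\<close> and no vector fields is used
  at a constant function.\<close>

lemma D_values_dense:
  assumes i: "i \<in> I" "x \<in> U i" and v: "v \<in> K i" and e: "e > 0"
  shows "\<exists>y\<in>(\<lambda>f. f x) ` D i. norm (y - v) < e"
proof -
  let ?c = "\<lambda>x. if x \<in> U i then v else 0"
  let ?N = "{g \<in> Cinf A (U i) (K i). \<forall>x\<in>{x}. norm (foldr (vact A) [] (\<lambda>y. g y - ?c y) x) < e}"
  have c: "?c \<in> Cinf A (U i) (K i)" by (rule Cinf_const[OF i(1) v])
  have o: "openin (Cinf_topology A (U i) (K i)) ?N"
    unfolding Cinf_topology_def
  proof (rule topology_generated_by_Basis, rule CollectI, intro exI conjI)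
    show "?c \<in> Cinf A (U i) (K i)" by (rule c)
    show "compact {x}" "{x} \<subseteq> U i" "set [] \<subseteq> Vect A (U i)" "0 < e" using i e by auto
  qed (rule refl)
  have cN: "?c \<in> ?N" using c e by simp
  have "?c \<in> Cinf_topology A (U i) (K i) closure_of D i"
    using D_dense[OF i(1)] c by (simp add: dense_smooth_subspace_def)
  from this[unfolded in_closure_of, THEN conjunct2, rule_format, OF conjI[OF cN o]]
  obtain f where f: "f \<in> D i" "f \<in> ?N" by (elim exE conjE)
  then have "norm (f x - v) < e" using i by simp
  then show ?thesis using f(1) by blast
qed

context
  fixes i f
  assumes i: "i \<in> I" and f: "f \<in> Cinf A (U i) (K i)"
begin

lemma adj_app_triv:
  shows "adj_app F (U i) (T i) f \<in> sections F (U i)"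
    and "\<And>y. y \<in> U i \<Longrightarrow> T i y (adj_app F (U i) (T i) f y) = f y"
    and "op_app (U i) (T i) (adj_app F (U i) (T i) f) = f"
proof -
  have fK: "\<And>y. y \<in> U i \<Longrightarrow> f y \<in> K i" and f0: "\<And>y. y \<notin> U i \<Longrightarrow> f y = 0" using f by (auto simp: Cinf_iff)
  show "adj_app F (U i) (T i) f \<in> sections F (U i)"
    using adj_mem(1)[OF i _ fK] fib.zero_closed by (simp add: sections_def adj_app_def restr_def)
  show 1: "T i y (adj_app F (U i) (T i) f y) = f y" if "y \<in> U i" for y
    using adj_mem(2)[OF i that fK[OF that]] that by (simp add: adj_app_def restr_def)
  show "op_app (U i) (T i) (adj_app F (U i) (T i) f) = f"
    using 1 f0 by (auto simp: op_app_def)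
qed

lemma sinner_adj_app:
  assumes "\<eta> y \<in> fiber F y" "y \<in> U i"
  shows "sinner F (adj_app F (U i) (T i) f) \<eta> y = cinner (f y) (T i y (\<eta> y))"
proof -
  have "adj_app F (U i) (T i) f y \<in> fiber F y" using adj_app_triv(1) by (simp add: sections_def)
  then show ?thesis using T_inner[OF i assms(2) _ assms(1)] adj_app_triv(2)[OF assms(2)] by (metis sinner_def)
qed

lemma sinner_adj_app_smooth:
  assumes \<eta>: "\<eta> \<in> smooth_sections A F B UNIV"
  shows "smooth_fun A (U i) (sinner F (adj_app F (U i) (T i) f) \<eta>)"
proof -
  have "smooth_fun A (U i) f" using f by (simp add: Cinf_iff)
  then have "smooth_fun A (U i) (\<lambda>y. cinner (f y) (T i y (\<eta> y)))"
    by (intro smooth_fun_bilinear[OF bounded_bilinear_cinner U_open[OF i]] smooth_section_triv(2)[OF \<eta> i])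
  then show ?thesis
    by (rule smooth_fun_cong[THEN iffD1, rotated]) (intro sinner_adj_app[symmetric] smooth_section_fiber[OF \<eta>])
qed

end

text \<open>The limit that defines \<open>\<nabla>\<^sub>X (T\<^sub>i\<^sup>* f)\<close> is unique, since \<open>metric_limit\<close> gives its inner products with the
  sections in \<open>\<Gamma>\<close>, whose values are dense in every fiber.\<close>

lemma cov_deriv_limit:
  assumes i: "i \<in> I" and f: "f \<in> D i" and X: "X \<in> Vect A (U i)"
  defines "\<psi> \<equiv> adj_app F (U i) (T i) f"
  shows "\<exists>s. C1_approx A F \<Gamma> nabla (U i) \<psi> s \<and>
      loc_unif_conv F (U i) (\<lambda>j. nabla_restr A F nabla (U i) X (s j)) (cov_deriv A F \<Gamma> nabla (U i) X \<psi>)"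
    and "cov_deriv A F \<Gamma> nabla (U i) X \<psi> \<in> sections F (U i)"
proof -
  note fC = D_Cinf[OF i f]
  have \<psi>: "\<psi> \<in> sections F (U i)" unfolding \<psi>_def by (rule adj_app_triv(1)[OF i fC])
  let ?P = "\<lambda>\<xi>. \<xi> \<in> sections F (U i) \<and> (\<exists>s. C1_approx A F \<Gamma> nabla (U i) \<psi> s \<and>
      loc_unif_conv F (U i) (\<lambda>j. nabla_restr A F nabla (U i) X (s j)) \<xi>)"
  have "\<psi> \<in> GammaInf A F \<Gamma> nabla (U i)" using T_smooth[OF i] f by (simp add: smooth_op_field_def \<psi>_def)
  then have "\<psi> \<in> GammaN A F \<Gamma> nabla (U i) (Suc 0)" unfolding GammaInf_def by blast
  then obtain s where s: "C1_approx A F \<Gamma> nabla (U i) \<psi> s" by auto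
  obtain \<xi> where \<xi>: "\<xi> \<in> sections F (U i)" "loc_unif_conv F (U i) (\<lambda>j. nabla_restr A F nabla (U i) X (s j)) \<xi>"
    using s X unfolding C1_approx_def by blast
  have "\<zeta> = \<xi>" if \<zeta>: "?P \<zeta>" for \<zeta>
  proof
    fix x
    show "\<zeta> x = \<xi> x"
    proof (cases "x \<in> U i")
      case False
      then show ?thesis using \<zeta> \<xi> by (simp add: sections_def)
    next
      case x: True
      obtain Y W where Y: "Y \<in> Vect A UNIV" "open W" "x \<in> W" "W \<subseteq> U i" "vagree W Y X"
        using Vect_extension[OF X U_open[OF i] x] by blast
      obtain s' where s': "C1_approx A F \<Gamma> nabla (U i) \<psi> s'"
        "loc_unif_conv F (U i) (\<lambda>j. nabla_restr A F nabla (U i) X (s' j)) \<zeta>" using \<zeta> by blast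
      have fib: "\<zeta> x \<in> fiber F x" "\<xi> x \<in> fiber F x" using \<zeta> \<xi> by (auto simp: sections_def)
      have eq: "cinner (T i x (\<zeta> x)) (T i x (\<eta> x)) = cinner (T i x (\<xi> x)) (T i x (\<eta> x))" if \<eta>: "\<eta> \<in> \<Gamma>" for \<eta>
      proof -
        have sm: "smooth_fun A (U i) (sinner F \<psi> \<eta>)"
          unfolding \<psi>_def using \<Gamma>_smooth_sections \<eta> by (intro sinner_adj_app_smooth[OF i fC]) auto
        have "vact A X (sinner F \<psi> \<eta>) x = sinner F \<zeta> \<eta> x + sinner F \<psi> (nabla (vconj Y) \<eta>) x"
          by (rule \<Gamma>.metric_limit[OF i x \<Gamma>.bundle_connection_axioms order_refl refl \<psi> s'(1) X _ s'(2) \<eta> sm Y])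
            (use \<zeta> in auto)
        moreover have "vact A X (sinner F \<psi> \<eta>) x = sinner F \<xi> \<eta> x + sinner F \<psi> (nabla (vconj Y) \<eta>) x"
          by (rule \<Gamma>.metric_limit[OF i x \<Gamma>.bundle_connection_axioms order_refl refl \<psi> s X \<xi> \<eta> sm Y])
        ultimately have "sinner F \<zeta> \<eta> x = sinner F \<xi> \<eta> x" by simp
        then show ?thesis
          using \<Gamma>.sinner_T[where \<phi> = \<zeta> and \<psi> = \<eta>, OF i x fib(1) \<Gamma>.G_fiber[OF \<eta>]]
            \<Gamma>.sinner_T[where \<phi> = \<xi> and \<psi> = \<eta>, OF i x fib(2) \<Gamma>.G_fiber[OF \<eta>]] by simp
      qed
      have "T i x (\<zeta> x) - T i x (\<xi> x) = 0"
      proof (rule dense_orthogonal_eq_0)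
        have "T i x (\<zeta> x) - T i x (\<xi> x) \<in> K i"
          using T_mem[OF i x] fib closed_csubspace_facts(2)[OF K_closed[OF i]] by (simp add: subspace_diff)
        then show "\<exists>y\<in>(\<lambda>\<phi>. T i x (\<phi> x)) ` \<Gamma>. norm (y - (T i x (\<zeta> x) - T i x (\<xi> x))) < e" if "e > 0" for e
          by (rule \<Gamma>_dense[OF i x _ that])
        show "cinner (T i x (\<zeta> x) - T i x (\<xi> x)) y = 0" if "y \<in> (\<lambda>\<phi>. T i x (\<phi> x)) ` \<Gamma>" for y
          using that eq by (auto simp: cinner_diff_left)
      qed
      then show ?thesis using T_inj[OF i x fib] by simp
    qed
  qed
  then have "?P (cov_deriv A F \<Gamma> nabla (U i) X \<psi>)"
    unfolding cov_deriv_def using s \<xi> by (intro theI[of ?P \<xi>]) blast+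
  then show "\<exists>s. C1_approx A F \<Gamma> nabla (U i) \<psi> s \<and>
      loc_unif_conv F (U i) (\<lambda>j. nabla_restr A F nabla (U i) X (s j)) (cov_deriv A F \<Gamma> nabla (U i) X \<psi>)"
    and "cov_deriv A F \<Gamma> nabla (U i) X \<psi> \<in> sections F (U i)" by auto
qed

text \<open>The case of \<open>metric_limit\<close> on which both directions rest, with the inner products written in the
  trivialization.\<close>

lemma cov_deriv_metric:
  assumes i: "i \<in> I" "x \<in> U i" and f: "f \<in> D i" and X: "X \<in> Vect A (U i)"
    and G: "bundle_connection A F B I U K T G nab" "\<Gamma> \<subseteq> G" "G \<subseteq> smooth_sections A F B UNIV"
      "\<And>X \<phi>. X \<in> Vect A UNIV \<Longrightarrow> \<phi> \<in> \<Gamma> \<Longrightarrow> nab X \<phi> = nabla X \<phi>"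
    and \<eta>: "\<eta> \<in> G" and Y: "Y \<in> Vect A UNIV" "open W" "x \<in> W" "W \<subseteq> U i" "vagree W Y X"
  shows "vact A X (\<lambda>y. cinner (f y) (T i y (\<eta> y))) x =
    cinner (T i x (cov_deriv A F \<Gamma> nabla (U i) X (adj_app F (U i) (T i) f) x)) (T i x (\<eta> x))
    + cinner (f x) (T i x (nab (vconj Y) \<eta> x))"
proof -
  interpret G: bundle_connection A F B I U K T G nab by (rule G(1))
  note fC = D_Cinf[OF i(1) f]
  let ?\<psi> = "adj_app F (U i) (T i) f"
  let ?\<xi> = "cov_deriv A F \<Gamma> nabla (U i) X ?\<psi>"
  obtain s where s: "C1_approx A F \<Gamma> nabla (U i) ?\<psi> s"
      "loc_unif_conv F (U i) (\<lambda>j. nabla_restr A F nabla (U i) X (s j)) ?\<xi>"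
    using cov_deriv_limit(1)[OF i(1) f X] by blast
  note \<xi> = cov_deriv_limit(2)[OF i(1) f X]
  have \<eta>S: "\<eta> \<in> smooth_sections A F B UNIV" using \<eta> G(3) by auto
  note zG = G.nab_mem[OF Vect_vconj[OF open_UNIV Y(1)] \<eta>]
  have "vact A X (\<lambda>y. cinner (f y) (T i y (\<eta> y))) x = vact A X (sinner F ?\<psi> \<eta>) x"
    by (rule vact_cong[OF X i(2) U_open[OF i(1)] i(2)]) (intro sinner_adj_app[OF i(1) fC, symmetric] G.G_fiber[OF \<eta>])
  also have "\<dots> = sinner F ?\<xi> \<eta> x + sinner F ?\<psi> (nab (vconj Y) \<eta>) x"
    by (rule G.metric_limit[OF i \<Gamma>.bundle_connection_axioms G(2,4) adj_app_triv(1)[OF i(1) fC] s(1) X \<xi> s(2) \<eta>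
        sinner_adj_app_smooth[OF i(1) fC \<eta>S] Y])
  also have "sinner F ?\<xi> \<eta> x = cinner (T i x (?\<xi> x)) (T i x (\<eta> x))"
    by (rule G.sinner_T[OF i]) (use \<xi> in \<open>simp add: sections_def\<close>, rule G.G_fiber[OF \<eta>])
  also have "sinner F ?\<psi> (nab (vconj Y) \<eta>) x = cinner (f x) (T i x (nab (vconj Y) \<eta> x))"
    by (rule sinner_adj_app[OF i(1) fC]) (rule G.G_fiber[OF zG], rule i(2))
  finally show ?thesis .
qed

lemma A_tilde_eq:
  assumes i: "i \<in> I" "x \<in> U i" and f: "f \<in> D i"
  shows "A_tilde A F \<Gamma> nabla (U i) (T i) X f x =
    T i x (cov_deriv A F \<Gamma> nabla (U i) X (adj_app F (U i) (T i) f) x) - vact A X f x"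
  using adj_app_triv(3)[OF i(1) D_Cinf[OF i(1) f]] i(2) by (simp add: A_tilde_def nabla_hat_def op_app_def)

lemma A_tilde_conn_form:
  assumes nab: "connection_on A F (smooth_sections A F B UNIV) nab"
      "\<And>X \<phi>. X \<in> Vect A UNIV \<Longrightarrow> \<phi> \<in> \<Gamma> \<Longrightarrow> nab X \<phi> = nabla X \<phi>"
    and i: "i \<in> I" "x \<in> U i" and f: "f \<in> D i" and X: "X \<in> Vect A (U i)"
  shows "A_tilde A F \<Gamma> nabla (U i) (T i) X f x = smooth_connection.conn_form A F B U T nab i X x (f x)"
proof -
  interpret C: smooth_connection A F B I U K T nab by unfold_locales (rule nab(1))
  let ?z = "T i x (cov_deriv A F \<Gamma> nabla (U i) X (adj_app F (U i) (T i) f) x)"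
  have fs: "smooth_fun A (U i) f" "\<And>y. y \<in> U i \<Longrightarrow> f y \<in> K i" using D_Cinf[OF i(1) f] by (auto simp: Cinf_iff)
  have "?z = vact A X f x + C.conn_form i X x (f x)"
  proof (rule C.conn_form_characterization[OF i X _ fs])
    show "?z \<in> K i" using cov_deriv_limit(2)[OF i(1) f X] by (intro T_mem[OF i]) (simp add: sections_def)
    fix w assume w: "w \<in> K i"
    obtain Y W where Y: "Y \<in> Vect A UNIV" "open W" "x \<in> W" "W \<subseteq> U i" "vagree W Y X"
      using Vect_extension[OF X U_open[OF i(1)] i(2)] by blast
    have "T i x (nab (vconj Y) (C.const_section i x w) x) = C.conn_form i (vconj X) x w"
      using C.conn_form_ext[OF i Vect_vconj[OF U_open[OF i(1)] X] w Vect_vconj[OF open_UNIV Y(1)] Y(2,3) vagree_vconj[OF Y(5)]]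
      by simp
    then show "vact A X (\<lambda>y. cinner (f y) (T i y (C.const_section i x w y))) x =
        cinner ?z w + cinner (f x) (C.conn_form i (vconj X) x w)"
      using cov_deriv_metric[OF i f X C.bundle_connection_axioms \<Gamma>_smooth_sections order_refl nab(2) C.const_section(1)[OF i w] Y]
        C.T_const_section[OF i w] by simp
  qed
  then show ?thesis using A_tilde_eq[OF i f] by simp
qed

end

section \<open>The equivalence\<close>

text \<open>The connection glued from the bounded extensions of \<open>A\<^sub>i(X)\<close> extends the given one: the two
  derivatives of a section in \<open>\<Gamma>\<close> have the same inner products with all \<open>f(x)\<close>, \<open>f \<in> D\<^sub>i\<close>.\<close>

lemma (in smooth_hilbert_field) glued_extends_nabla:
  assumes L: "connection_forms A F B I U K T L"
    and LA: "\<And>i X f x. i \<in> I \<Longrightarrow> X \<in> Vect A (U i) \<Longrightarrow> f \<in> D i \<Longrightarrow> x \<in> U i \<Longrightarrow>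
        A_tilde A F \<Gamma> nabla (U i) (T i) X f x = L i X x (f x)"
    and X: "X \<in> Vect A UNIV" and \<phi>: "\<phi> \<in> \<Gamma>"
  shows "connection_forms.glued A F I U T L X \<phi> = nabla X \<phi>"
proof -
  interpret L: connection_forms A F B I U K T L by (rule L)
  have \<phi>S: "\<phi> \<in> smooth_sections A F B UNIV" using \<phi> \<Gamma>_smooth_sections by auto
  note nf = \<Gamma>.G_fiber[OF \<Gamma>.nab_mem[OF X \<phi>]] and gf = L.glued_fiber[OF X \<phi>S]
  show ?thesis
  proof (rule L.section_eqI[OF gf nf])
    fix i x assume i: "i \<in> I" "x \<in> U i"
    let ?X = "vrestr (U i) X" and ?g = "\<lambda>y. T i y (\<phi> y)"
    let ?d = "T i x (L.glued X \<phi> x) - T i x (nabla X \<phi> x)"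
    have XV: "?X \<in> Vect A (U i)" by (rule Vect_vrestr[OF X U_open[OF i(1)]]) simp
    note Xc = Vect_vconj[OF U_open[OF i(1)] XV]
    have gx: "T i x (\<phi> x) \<in> K i" by (rule T_mem[OF i \<Gamma>.G_fiber[OF \<phi>]])
    have "?d = 0"
    proof (rule dense_orthogonal_eq_0)
      have "?d \<in> K i"
        using T_mem[OF i gf] T_mem[OF i nf] closed_csubspace_facts(2)[OF K_closed[OF i(1)]] by (simp add: subspace_diff)
      then show "\<exists>y\<in>(\<lambda>f. f x) ` D i. norm (y - ?d) < e" if "e > 0" for e by (rule D_values_dense[OF i _ that])
      fix y assume "y \<in> (\<lambda>f. f x) ` D i"
      then obtain f where f: "f \<in> D i" "y = f x" by auto
      have fs: "smooth_fun A (U i) f" "f x \<in> K i" using D_Cinf[OF i(1) f(1)] i by (auto simp: Cinf_iff)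
      let ?\<xi> = "cov_deriv A F \<Gamma> nabla (U i) (vconj ?X) (adj_app F (U i) (T i) f)"
      have \<xi>: "T i x (?\<xi> x) = L i (vconj ?X) x (f x) + vact A (vconj ?X) f x"
        using A_tilde_eq[OF i f(1), of "vconj ?X"] LA[OF i(1) Xc f(1) i(2)] by simp
      have "vact A (vconj ?X) (\<lambda>y. cinner (f y) (?g y)) x =
          cinner (T i x (?\<xi> x)) (?g x) + cinner (f x) (T i x (nabla (vconj (vconj X)) \<phi> x))"
        by (rule cov_deriv_metric[OF i f(1) Xc \<Gamma>.bundle_connection_axioms order_refl \<Gamma>_smooth_sections refl \<phi>
            Vect_vconj[OF open_UNIV X] U_open[OF i(1)] i(2) order_refl])
          (rule vagree_vconj[OF vagree_sym[OF vagree_vrestr[OF order_refl]]])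
      moreover have "vact A (vconj ?X) (\<lambda>y. cinner (f y) (?g y)) x =
          cinner (vact A (vconj ?X) f x) (?g x) + cinner (f x) (vact A ?X ?g x)"
        using vact_cinner[OF Xc i(2) U_open[OF i(1)] i(2) fs(1) smooth_section_triv(2)[OF \<phi>S i(1)]] by simp
      moreover have "cinner (L i (vconj ?X) x (f x)) (?g x) = - cinner (f x) (L i ?X x (?g x))"
        using L.L_skew[OF i(1) Xc i(2) fs(2) gx] by simp
      ultimately have "cinner (f x) (T i x (nabla X \<phi> x)) = cinner (f x) (vact A ?X ?g x + L i ?X x (?g x))"
        by (simp add: \<xi> cinner_add_left cinner_add_right algebra_simps)
      also have "vact A ?X ?g x = vact A X ?g x" by (rule vact_vrestr[OF i(2)])
      finally have "cinner (f x) (T i x (nabla X \<phi> x)) = cinner (f x) (T i x (L.glued X \<phi> x))"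
        using L.glued_triv(2)[OF X \<phi>S i] by simp
      then have "cinner (f x) ?d = 0" by (simp add: cinner_diff_right)
      then show "cinner ?d y = 0" unfolding f(2) using cinner_commute[of ?d "f x"] by simp
    qed
    then show "T i x (L.glued X \<phi> x) = T i x (nabla X \<phi> x)" by simp
  qed
qed

theorem proposition2p8:
  fixes A :: "('m::{t2_space, second_countable_topology}, 'e::euclidean_space) chart set"
    and F :: "('m, 'h) hfield"
    and \<Gamma> :: "('m \<Rightarrow> 'h) set"
    and nabla :: "('m, 'e) vfield \<Rightarrow> ('m \<Rightarrow> 'h) \<Rightarrow> 'm \<Rightarrow> 'h"
    and B :: "('h, 'b::banach) chart set"
    and I :: "'i set"
    and U :: "'i \<Rightarrow> 'm set"
    and K :: "'i \<Rightarrow> 'k::complex_hilbert set"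
    and T :: "'i \<Rightarrow> 'm \<Rightarrow> 'h \<Rightarrow> 'k"
    and D :: "'i \<Rightarrow> ('m \<Rightarrow> 'k) set"
  assumes "smooth_manifold A"
    and "smooth_field A F \<Gamma> nabla"
    and "hilbert_bundle_structure A F B I U K T"
    and "\<forall>i\<in>I. GammaInf A F \<Gamma> nabla (U i) \<subseteq> smooth_sections A F B (U i)"
    and "\<forall>i\<in>I. dense_smooth_subspace A (U i) (K i) (D i)"
    and "\<forall>i\<in>I. smooth_op_field A F \<Gamma> nabla (U i) (K i) (D i) (T i)"
  shows
    "(\<exists>nabla'. connection_on A F (smooth_sections A F B UNIV) nabla' \<and>
        (\<forall>X\<in>Vect A UNIV. \<forall>\<phi>\<in>\<Gamma>. nabla' X \<phi> = nabla X \<phi>))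
     \<longleftrightarrow>
     (\<exists>L :: 'i \<Rightarrow> ('m, 'e) vfield \<Rightarrow> 'm \<Rightarrow> 'k \<Rightarrow> 'k.
        (\<forall>i\<in>I. \<forall>X\<in>Vect A (U i).
           bounded_op_field (U i) (K i) (D i) (A_tilde A F \<Gamma> nabla (U i) (T i) X) (L i X) \<and>
           (\<forall>f\<in>Cinf A (U i) (K i). op_app (U i) (L i X) f \<in> Cinf A (U i) (K i))) \<and>
        (\<forall>i\<in>I. \<forall>j\<in>I. \<forall>X\<in>Vect A (U i). \<forall>Y\<in>Vect A (U j). \<forall>W.
           open W \<and> W \<subseteq> U i \<inter> U j \<and> vagree W X Y \<longrightarrow>
           (\<forall>f\<in>Cinf A (U i) (K i). \<forall>x\<in>W.
              tau_hat A F U T i j X f x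
                = tau F T i j x (L i X x (f x)) - L j Y x (tau F T i j x (f x)))) \<and>
        (\<forall>i\<in>I. \<forall>X\<in>Vect A (U i). \<forall>Y\<in>Vect A (U i). \<forall>a\<in>Cfun A (U i).
           \<forall>f\<in>Cinf A (U i) (K i). \<forall>g\<in>Cinf A (U i) (K i). \<forall>x\<in>U i.
              L i (vadd X Y) x (f x) = L i X x (f x) + L i Y x (f x) \<and>
              L i (vscale a X) x (f x) = a x *\<^sub>C L i X x (f x) \<and>
              cinner (L i X x (f x)) (g x) = cinner (f x) (- L i (vconj X) x (g x))))"
    (is "?a \<longleftrightarrow> (\<exists>L. ?bounded L \<and> ?tau L \<and> ?linear L)")
proof -
  interpret smooth_hilbert_field A F B I U K T \<Gamma> nabla D
    using assms by unfold_locales (auto simp: smooth_field_def)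
  show ?thesis
  proof
    assume ?a
    then obtain nab where nab: "connection_on A F (smooth_sections A F B UNIV) nab"
      "\<And>X \<phi>. X \<in> Vect A UNIV \<Longrightarrow> \<phi> \<in> \<Gamma> \<Longrightarrow> nab X \<phi> = nabla X \<phi>" by blast
    interpret C: smooth_connection A F B I U K T nab by unfold_locales (rule nab(1))
    have K: "f x \<in> K i" if "f \<in> Cinf A (U i) (K i)" "x \<in> U i" for f i x using that by (simp add: Cinf_iff)
    have "?bounded C.conn_form"
      using C.conn_form_bounded_clinear A_tilde_conn_form[OF nab] C.conn_form_Cinf
      by (simp add: bounded_op_field_def)
    moreover have "?tau C.conn_form" using C.conn_form_tau by blast
    moreover have "?linear C.conn_form"
      using C.conn_form_vadd C.conn_form_vscale C.conn_form_skew K by (simp add: cinner_minus_right)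
    ultimately show "\<exists>L. ?bounded L \<and> ?tau L \<and> ?linear L" by blast
  next
    assume "\<exists>L. ?bounded L \<and> ?tau L \<and> ?linear L"
    then obtain L where bd: "?bounded L" and tau: "?tau L" and lin: "?linear L" by (elim exE conjE)
    have const: "\<exists>f\<in>Cinf A (U i) (K i). f x = v" if "i \<in> I" "x \<in> U i" "v \<in> K i" for i x v
      using Cinf_const[OF that(1,3)] that(2) by (intro bexI) auto
    have L: "connection_forms A F B I U K T L"
    proof unfold_locales
      fix i X x assume i: "i \<in> I" and X: "X \<in> Vect A (U i)"
      show "x \<in> U i \<Longrightarrow> bounded_clinear_on (K i) (L i X x)" using bd i X by (simp add: bounded_op_field_def)
      show "f \<in> Cinf A (U i) (K i) \<Longrightarrow> op_app (U i) (L i X) f \<in> Cinf A (U i) (K i)" for f using bd i X by blast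
      show "tau_hat A F U T i j X f x = tau F T i j x (L i X x (f x)) - L j Y x (tau F T i j x (f x))"
        if "j \<in> I" "Y \<in> Vect A (U j)" "vagree (U i \<inter> U j) X Y" "f \<in> Cinf A (U i) (K i)" "x \<in> U i" "x \<in> U j" for j Y f
      proof -
        have "open (U i \<inter> U j)" using U_open[OF i] U_open[OF that(1)] by auto
        then show ?thesis using tau[rule_format, OF i that(1) X that(2) _ that(4), of "U i \<inter> U j" x] that by simp
      qed
      have z: "(\<lambda>x. 0) \<in> Cfun A (U i)" by (simp add: Cinf_iff smooth_fun_const)
      show "L i (vadd X Y) x v = L i X x v + L i Y x v" if Y: "Y \<in> Vect A (U i)" "x \<in> U i" "v \<in> K i" for Y v
        using const[OF i Y(2,3)] lin[rule_format, OF i X Y(1) z _ _ Y(2)] by blast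
      show "L i (vscale a X) x v = a x *\<^sub>C L i X x v" if a: "a \<in> Cfun A (U i)" "x \<in> U i" "v \<in> K i" for a v
        using const[OF i a(2,3)] lin[rule_format, OF i X X a(1) _ _ a(2)] by blast
      show "cinner (L i X x v) w = - cinner v (L i (vconj X) x w)" if v: "x \<in> U i" "v \<in> K i" "w \<in> K i" for v w
        using const[OF i v(1,2)] const[OF i v(1,3)] lin[rule_format, OF i X X z _ _ v(1)]
        by (auto simp: cinner_minus_right)
    qed
    interpret L: connection_forms A F B I U K T L by (rule L)
    have "L.glued X \<phi> = nabla X \<phi>" if "X \<in> Vect A UNIV" "\<phi> \<in> \<Gamma>" for X \<phi>
      using glued_extends_nabla[OF L _ that] bd by (simp add: bounded_op_field_def)
    then show ?a using L.glued_connection by blast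
  qed
qed

end
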